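(* Let $(X, d)$ be a compact geodesic space, $p \in X$, and $f : X \to \mathbb{R}$ the distance function $f = d(p, \cdot)$. Suppose that the Reeb graph $R_f$ is a finite topological graph. Then the distortion of the Reeb quotient map $\varphi : X \to R_f$ satisfies $$\operatorname{dis}(\varphi) \le 2(b'_1(X) + 1) D,$$ where $b'_1(X) = \operatorname{corank}(\pi_1(X))$ and $D$ is the supremum of the diameters of contours of $f$. In particular, the Gromov--Hausdorff distance satisfies $$d_{GH}(X, R_f) \le (b'_1(X) + 1) D.$$
   Context: A geodesic space is a metric space in which any two points are joined by a path whose length equals their distance. A contour of $f$ is a connected component of a level set $f^{-1}(y)$, $y \in \mathbb{R}$. The Reeb graph $R_f$ is the quotient space $X/\sim$ with the quotient topology, where $x \sim y$ iff $x$ and $y$ lie in the same contour of $f$; the quotient map $\varphi : X \to R_f$ is the Reeb quotient map. A finite topological graph is a space homeomorphic to the geometric realization of a finite graph. The function $f$ induces $\bar f : R_f \to \mathbb{R}$ with $f = \bar f \circ \varphi$, and $R_f$ carries the metric $d_{R_f}(a,b) = \inf_\gamma (\text{total variation of } \bar f \circ \gamma)$, the infimum being over continuous paths $\gamma$ in $R_f$ from $a$ to $b$ (i.e. edge lengths are measured by the variation of $f$). The distortion of a map $\varphi : (X, d_X) \to (Y, d_Y)$ is $\operatorname{dis}(\varphi) = \sup_{x, x' \in X} |d_X(x,x') - d_Y(\varphi(x), \varphi(x'))|$. The Gromov--Hausdorff distance $d_{GH}(X,Y)$ is the infimum of $r > 0$ for which there are a metric space $Z$ and subspaces $X', Y'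 \subseteq Z$ isometric to $X$, $Y$ respectively with Hausdorff distance $d_H(X', Y') < r$. Diameters of contours are measured in $d$. The co-rank of a group $G$, $\operatorname{corank}(G)$, is the supremum (in $\{0,1,2,\dots\}\cup\{\infty\}$) of the ranks of free groups that are homomorphic images of $G$. *)

theory Defs
  imports
    "HOL-Analysis.Analysis"
    "HOL-Algebra.Group"
    "HOL-Library.Extended_Nat"
    "Graph_Theory.Digraph"
begin

section \<open>Length and geodesic spaces\<close>

text \<open>
  Supremum over all partitions of the unit interval (repeated partition points are harmless).
  For a real-valued map \<open>g\<close> this is the total variation of \<open>g\<close>.
\<close>

definition path_length :: "(real \<Rightarrow> 'a::metric_space) \<Rightarrow> ereal" where
  "path_length g =
     (SUP ts \<in> {ts. sorted ts \<and> set ts \<subseteq> {0..1}}.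
        ereal (\<Sum>i<length ts - 1. dist (g (ts ! i)) (g (ts ! Suc i))))"

definition geodesic_space :: "'a::metric_space set \<Rightarrow> bool" where
  "geodesic_space X \<longleftrightarrow>
     (\<forall>x\<in>X. \<forall>y\<in>X. \<exists>g. path g \<and> path_image g \<subseteq> X \<and> pathstart g = x \<and> pathfinish g = y \<and>
        path_length g = ereal (dist x y))"


section \<open>Reeb graphs\<close>

definition quotient_topology :: "'a topology \<Rightarrow> ('a \<Rightarrow> 'b) \<Rightarrow> 'b topology" where
  "quotient_topology T q =
     topology (\<lambda>U. U \<subseteq> q ` topspace T \<and> openin T {x \<in> topspace T. q x \<in> U})"

lemma openin_quotient_topology:
  "openin (quotient_topology T q) U \<longleftrightarrow>
     U \<subseteq> q ` topspace T \<and> openin T {x \<in> topspace T. q x \<in> U}"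
proof -
  have "istopology (\<lambda>U. U \<subseteq> q ` topspace T \<and> openin T {x \<in> topspace T. q x \<in> U})"
    unfolding istopology_def
  proof (intro conjI allI impI; (elim conjE)?)
    fix S U assume "openin T {x \<in> topspace T. q x \<in> S}" "openin T {x \<in> topspace T. q x \<in> U}"
    then have "openin T ({x \<in> topspace T. q x \<in> S} \<inter> {x \<in> topspace T. q x \<in> U})"
      by (rule openin_Int)
    then show "openin T {x \<in> topspace T. q x \<in> S \<inter> U}"
      by (rule back_subst) auto
  next
    fix K assume K: "\<forall>S\<in>K. S \<subseteq> q ` topspace T \<and> openin T {x \<in> topspace T. q x \<in> S}"
    then have "openin T (\<Union>S\<in>K. {x \<in> topspace T. q x \<in> S})"
      by blast
    then show "openin T {x \<in> topspace T. q x \<in> \<Union>K}"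
      by (rule back_subst) auto
  qed auto
  then show ?thesis
    by (simp add: quotient_topology_def)
qed

lemma topspace_quotient_topology [simp]: "topspace (quotient_topology T q) = q ` topspace T"
proof -
  have "{x \<in> topspace T. q x \<in> q ` topspace T} = topspace T"
    by auto
  then have "openin (quotient_topology T q) (q ` topspace T)"
    by (simp add: openin_quotient_topology)
  then show ?thesis
    by (auto simp: topspace_def openin_quotient_topology)
qed

lemma quotient_map_quotient_topology: "quotient_map T (quotient_topology T q) q"
  by (auto simp: quotient_map_def openin_quotient_topology)

definition contours :: "'a::topological_space set \<Rightarrow> ('a \<Rightarrow> real) \<Rightarrow> 'a set set" where
  "contours X f = (\<Union>y. components {x \<in> X. f x = y})"

definition reeb_map :: "'a::topological_space set \<Rightarrow> ('a \<Rightarrow> real) \<Rightarrow> 'a \<Rightarrow> 'a set" where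
  "reeb_map X f x = connected_component_set {x' \<in> X. f x' = f x} x"

definition reeb_graph :: "'a::topological_space set \<Rightarrow> ('a \<Rightarrow> real) \<Rightarrow> 'a set topology" where
  "reeb_graph X f = quotient_topology (top_of_set X) (reeb_map X f)"

lemma topspace_reeb_graph: "topspace (reeb_graph X f) = contours X f"
  by (auto simp: reeb_graph_def contours_def reeb_map_def components_def)

definition reeb_fun :: "('a \<Rightarrow> real) \<Rightarrow> 'a set \<Rightarrow> real" where
  "reeb_fun f C = the_elem (f ` C)"

lemma reeb_fun_reeb_map:
  assumes "x \<in> X"
  shows "reeb_fun f (reeb_map X f x) = f x"
proof -
  have "f ` reeb_map X f x = {f x}"
    using assms connected_component_subset[of "{x' \<in> X. f x' = f x}" x]
    by (auto simp: reeb_map_def image_iff intro!: exI[of _ x])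
  then show ?thesis
    by (simp add: reeb_fun_def)
qed

text \<open>
  Extended-real-valued, so that the infimum is meaningful even if no path from \<open>a\<close> to \<open>b\<close>
  has finite variation.
\<close>

definition reeb_dist :: "'a::topological_space set \<Rightarrow> ('a \<Rightarrow> real) \<Rightarrow> 'a set \<Rightarrow> 'a set \<Rightarrow> ereal" where
  "reeb_dist X f a b =
     (INF \<gamma> \<in> {\<gamma>. pathin (reeb_graph X f) \<gamma> \<and> \<gamma> 0 = a \<and> \<gamma> 1 = b}.
        path_length (reeb_fun f \<circ> \<gamma>))"

definition contour_diameter :: "'a::metric_space set \<Rightarrow> ('a \<Rightarrow> real) \<Rightarrow> ereal" where
  "contour_diameter X f = (SUP C \<in> contours X f. ereal (diameter C))"


section \<open>Finite topological graphs\<close>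

text \<open>
  The realization of a directed multigraph (loops and parallel arcs allowed) glues a copy of
  the unit interval to the discrete set of vertices for every arc; the orientation only
  parametrizes the edges.  A point is a vertex or a pair of an arc and an interior parameter,
  and \<open>graph_point G e\<close> is the characteristic map of the arc \<open>e\<close>.
\<close>

definition graph_point :: "('v, 'e) pre_digraph \<Rightarrow> 'e \<Rightarrow> real \<Rightarrow> 'v + 'e \<times> real" where
  "graph_point G e t =
     (if t = 0 then Inl (tail G e) else if t = 1 then Inl (head G e) else Inr (e, t))"

definition graph_points :: "('v, 'e) pre_digraph \<Rightarrow> ('v + 'e \<times> real) set" where
  "graph_points G = Inl ` verts G \<union> Inr ` (arcs G \<times> {0<..<1})"

definition graph_realization :: "('v, 'e) pre_digraph \<Rightarrow> ('v + 'e \<times> real) topology" where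
  "graph_realization G =
     topology (\<lambda>U. U \<subseteq> graph_points G \<and>
       (\<forall>e\<in>arcs G. openin (top_of_set {0..1}) {t \<in> {0..1}. graph_point G e t \<in> U}))"

lemma openin_graph_realization:
  "openin (graph_realization G) U \<longleftrightarrow> U \<subseteq> graph_points G \<and>
     (\<forall>e\<in>arcs G. openin (top_of_set {0..1}) {t \<in> {0..1}. graph_point G e t \<in> U})"
proof -
  have "istopology (\<lambda>U. U \<subseteq> graph_points G \<and>
       (\<forall>e\<in>arcs G. openin (top_of_set {0..1}) {t \<in> {0..1}. graph_point G e t \<in> U}))"
    unfolding istopology_def
  proof (intro conjI allI impI ballI; (elim conjE)?)
    fix S U e assume "\<forall>e\<in>arcs G. openin (top_of_set {0..1}) {t \<in> {0..1}. graph_point G e t \<in> S}"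
      "\<forall>e\<in>arcs G. openin (top_of_set {0..1}) {t \<in> {0..1}. graph_point G e t \<in> U}" "e \<in> arcs G"
    then have "openin (top_of_set {0..1})
        ({t \<in> {0..1}. graph_point G e t \<in> S} \<inter> {t \<in> {0..1}. graph_point G e t \<in> U})"
      by (intro openin_Int) auto
    then show "openin (top_of_set {0..1}) {t \<in> {0..1}. graph_point G e t \<in> S \<inter> U}"
      by (rule back_subst) auto
  next
    fix K e assume K: "\<forall>S\<in>K. S \<subseteq> graph_points G \<and>
       (\<forall>e\<in>arcs G. openin (top_of_set {0..1}) {t \<in> {0..1}. graph_point G e t \<in> S})"
      and e: "e \<in> arcs G"
    then have "openin (top_of_set {0..1}) (\<Union>S\<in>K. {t \<in> {0..1}. graph_point G e t \<in> S})"
      by blast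
    then show "openin (top_of_set {0..1}) {t \<in> {0..1}. graph_point G e t \<in> \<Union>K}"
      by (rule back_subst) auto
  qed auto
  then show ?thesis
    by (simp add: graph_realization_def)
qed

lemma (in wf_digraph) topspace_graph_realization:
  "topspace (graph_realization G) = graph_points G"
proof -
  have "{t \<in> {0..1}. graph_point G e t \<in> graph_points G} = {0..1}" if "e \<in> arcs G" for e
    using that by (auto simp: graph_point_def graph_points_def)
  then have "openin (graph_realization G) (graph_points G)"
    by (auto simp: openin_graph_realization)
  then show ?thesis
    by (auto simp: topspace_def openin_graph_realization)
qed

text \<open>Up to isomorphism every finite graph has natural numbers as vertices and edges.\<close>

definition finite_topological_graph :: "'a topology \<Rightarrow> bool" where
  "finite_topological_graph T \<longleftrightarrow>
     (\<exists>G :: (nat, nat) pre_digraph. fin_digraph G \<and> T homeomorphic_space graph_realization G)"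


section \<open>Fundamental group and co-rank\<close>

definition loops_at :: "'a::topological_space set \<Rightarrow> 'a \<Rightarrow> (real \<Rightarrow> 'a) set" where
  "loops_at X p = {g. path g \<and> path_image g \<subseteq> X \<and> pathstart g = p \<and> pathfinish g = p}"

definition loop_class :: "'a::topological_space set \<Rightarrow> (real \<Rightarrow> 'a) \<Rightarrow> (real \<Rightarrow> 'a) set" where
  "loop_class X g = {h. homotopic_paths X g h}"

definition fundamental_group :: "'a::topological_space set \<Rightarrow> 'a \<Rightarrow> (real \<Rightarrow> 'a) set monoid" where
  "fundamental_group X p =
     \<lparr>carrier = loop_class X ` loops_at X p,
      monoid.mult = (\<lambda>A B. \<Union>g\<in>A. \<Union>h\<in>B. loop_class X (g +++ h)),
      one = loop_class X (\<lambda>_. p)\<rparr>"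

text \<open>
  The free group on \<open>S\<close>: reduced words in the letters \<open>(s, True)\<close> (for \<open>s\<close>) and
  \<open>(s, False)\<close> (for the inverse of \<open>s\<close>), with multiplication by concatenation and cancellation.
\<close>

definition inv_letter :: "'b \<times> bool \<Rightarrow> 'b \<times> bool" where
  "inv_letter a = (fst a, \<not> snd a)"

definition push_letter :: "'b \<times> bool \<Rightarrow> ('b \<times> bool) list \<Rightarrow> ('b \<times> bool) list" where
  "push_letter a w = (if w \<noteq> [] \<and> hd w = inv_letter a then tl w else a # w)"

definition free_group :: "'b set \<Rightarrow> ('b \<times> bool) list monoid" where
  "free_group S =
     \<lparr>carrier = {w. set w \<subseteq> S \<times> UNIV \<and> successively (\<lambda>a b. b \<noteq> inv_letter a) w},
      monoid.mult = foldr push_letter,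
      one = []\<rparr>"

text \<open>
  Countable bases suffice: a free group of uncountable rank has the free group of countably
  infinite rank as a homomorphic image, and both have rank \<open>\<infinity>\<close> here.
\<close>

definition corank :: "('g, 'm) monoid_scheme \<Rightarrow> enat" where
  "corank G =
     (SUP S \<in> {S :: nat set. epi G (free_group S) \<noteq> {}}.
        (if finite S then enat (card S) else \<infinity>))"


section \<open>Distortion and Gromov--Hausdorff distance\<close>

definition distortion ::
  "'a set \<Rightarrow> ('a \<Rightarrow> 'a \<Rightarrow> ereal) \<Rightarrow> ('b \<Rightarrow> 'b \<Rightarrow> ereal) \<Rightarrow> ('a \<Rightarrow> 'b) \<Rightarrow> ereal" where
  "distortion A dA dB h = (SUP (x, x') \<in> A \<times> A. \<bar>dA x x' - dB (h x) (h x')\<bar>)"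

definition hausdorff_dist :: "('z \<Rightarrow> 'z \<Rightarrow> real) \<Rightarrow> 'z set \<Rightarrow> 'z set \<Rightarrow> ereal" where
  "hausdorff_dist d A B =
     max (SUP a\<in>A. INF b\<in>B. ereal (d a b)) (SUP b\<in>B. INF a\<in>A. ereal (d a b))"

definition isometric_embedding ::
  "'a set \<Rightarrow> ('a \<Rightarrow> 'a \<Rightarrow> ereal) \<Rightarrow> 'z set \<Rightarrow> ('z \<Rightarrow> 'z \<Rightarrow> real) \<Rightarrow> ('a \<Rightarrow> 'z) \<Rightarrow> bool" where
  "isometric_embedding A dA Z d i \<longleftrightarrow>
     i \<in> A \<rightarrow> Z \<and> (\<forall>x\<in>A. \<forall>y\<in>A. ereal (d (i x) (i y)) = dA x y)"

text \<open>
  The ambient space may be cut down to the union of the two isometric copies, so it can always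
  be realized on a subset of the sum type.
\<close>

definition gh_dist ::
  "'a set \<Rightarrow> ('a \<Rightarrow> 'a \<Rightarrow> ereal) \<Rightarrow> 'b set \<Rightarrow> ('b \<Rightarrow> 'b \<Rightarrow> ereal) \<Rightarrow> ereal" where
  "gh_dist A dA B dB =
     Inf {ereal r | r. 0 < r \<and>
       (\<exists>(Z :: ('a + 'b) set) d i j. Metric_space Z d \<and>
          isometric_embedding A dA Z d i \<and> isometric_embedding B dB Z d j \<and>
          hausdorff_dist d (i ` A) (j ` B) < ereal r)}"

end

theory Submission
  imports Defs
begin

text \<open>
  A geodesic from \<open>x\<close> to \<open>p\<close> meets every level below \<open>f x\<close> once, and so projects to a descending path in
  the Reeb graph.  Let \<open>m\<close> be the number of contours from which such descents branch.  A path in the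
  Reeb graph that avoids these merging contours returns, at its minimum, to the descent of either
  end point, so lifts of the end points are at distance at most the variation of the path plus one
  diameter \<open>D\<close> of a contour.  Cutting an arbitrary path at the merging contours and jumping from the
  first to the last visit of each of them gives \<open>d \<le> d\<^sub>R + (2 m + 1) D\<close>, whereas \<open>d\<^sub>R \<le> d\<close> is immediate.

  Moreover \<open>m\<close> is at most the co-rank.  Just below each merging contour place a cut at one of two
  distinct branches and record the signed crossings of a loop with the cuts as a word in the free
  group on \<open>m\<close> letters.  This is the holonomy of a locally defined cocycle, hence homotopy invariant, and
  loops that climb to a merging contour through its cut and descend along the other branch show,
  by induction on the level, that every generator is attained.
\<close>


section \<open>Free groups\<close>

text \<open>The hypothesis on the Reeb graph is purely topological and does not say how
  \<open>lev\<close> varies along an edge. Finiteness of levels and of merging contours has to be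
  derived: \<open>lev\<close> has no local minimum except at the contour of \<open>p\<close>, hence
  at most one inside an edge. A second obstacle is that a path in the Reeb graph need not lift to
  \<open>X\<close>. Descents are compared instead, and where a lift would be continuous, limits of
  points are taken. The constant 2 m + 1 counts at most m + 1 pieces that avoid merging contours and
  m jumps inside merging contours, one diameter each. Half of it is at most m + 1, which serves for
  the Gromov-Hausdorff distance. For the co-rank, \<open>X\<close> may be locally complicated, so
  covering spaces are out of reach. A cocycle on pairs of points closer than a fixed \<delta>, with
  uniform continuity of paths and homotopies, still defines a homomorphism. One generator for each
  merging contour is enough, even if more than two branches descend from it.\<close>

abbreviation reduced_word :: "('b \<times> bool) list \<Rightarrow> bool" where
  "reduced_word \<equiv> successively (\<lambda>a b. b \<noteq> inv_letter a)"

lemma inv_letter_inv_letter [simp]: "inv_letter (inv_letter a) = a"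
  by (simp add: inv_letter_def)

lemma reduced_push_letter: "reduced_word w \<Longrightarrow> reduced_word (push_letter a w)"
  by (cases w) (auto simp: push_letter_def successively_Cons)

lemma set_push_letter: "set (push_letter a w) \<subseteq> insert a (set w)"
  by (cases w) (auto simp: push_letter_def)

lemma push_letter_cancel: "reduced_word w \<Longrightarrow> push_letter a (push_letter (inv_letter a) w) = w"
  by (cases w) (auto simp: push_letter_def successively_Cons)

lemma reduced_foldr_push_letter: "reduced_word v \<Longrightarrow> reduced_word (foldr push_letter u v)"
  by (induction u) (auto intro: reduced_push_letter)

lemma set_foldr_push_letter: "set (foldr push_letter u v) \<subseteq> set u \<union> set v"
proof (induction u)
  case (Cons a u)
  then show ?case
    using set_push_letter[of a "foldr push_letter u v"] by auto
qed simp

lemma foldr_push_letter_Nil: "reduced_word u \<Longrightarrow> foldr push_letter u [] = u"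
proof (induction u)
  case (Cons a u)
  then show ?case
    by (cases u) (auto simp: push_letter_def)
qed simp

lemma foldr_push_letter_assoc:
  assumes "reduced_word v" "reduced_word w"
  shows "foldr push_letter (foldr push_letter u v) w = foldr push_letter u (foldr push_letter v w)"
proof (induction u)
  case (Cons a u)
  \<comment> \<open>Only the cancelling case has content: on the left \<open>push_letter a\<close>
    deletes the head \<open>inv_letter a\<close> of \<open>x\<close>; on the right \<open>a\<close>
    meets a word onto which \<open>inv_letter a\<close> has just been pushed, and the two cancel
    because that word is reduced.\<close>
  have push: "foldr push_letter (push_letter a x) w = push_letter a (foldr push_letter x w)" for x
  proof (cases "x \<noteq> [] \<and> hd x = inv_letter a")
    case True
    then obtain x' where "x = inv_letter a # x'"
      by (cases x) auto
    then show ?thesis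
      using push_letter_cancel[OF reduced_foldr_push_letter[OF assms(2), of x'], of a]
      by (simp add: push_letter_def)
  qed (auto simp: push_letter_def)
  show ?case
    by (simp add: push Cons)
qed simp

lemma foldr_push_letter_inverse:
  assumes "reduced_word w"
  shows "foldr push_letter (map inv_letter (rev u)) (foldr push_letter u w) = w"
proof (induction u)
  case (Cons a u)
  have "push_letter (inv_letter a) (push_letter a v) = v" if "reduced_word v" for v
    using push_letter_cancel[OF that, of "inv_letter a"] by simp
  then show ?case
    using reduced_foldr_push_letter[OF assms] Cons by simp
qed simp

lemma successively_rev_map_inv_letter:
  "reduced_word u \<Longrightarrow> reduced_word (map inv_letter (rev u))"
  by (auto simp: successively_map rev_map[symmetric] successively_rev elim!: successively_mono)

lemma group_free_group: "group (free_group S)"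
proof (rule groupI)
  fix x assume "x \<in> carrier (free_group S)"
  then have x: "set x \<subseteq> S \<times> UNIV" "reduced_word x"
    by (auto simp: free_group_def)
  show "\<exists>y\<in>carrier (free_group S). y \<otimes>\<^bsub>free_group S\<^esub> x = \<one>\<^bsub>free_group S\<^esub>"
  proof (rule bexI[of _ "map inv_letter (rev x)"])
    show "map inv_letter (rev x) \<otimes>\<^bsub>free_group S\<^esub> x = \<one>\<^bsub>free_group S\<^esub>"
      using foldr_push_letter_inverse[of "[]" x] foldr_push_letter_Nil[OF x(2)]
      by (simp add: free_group_def)
    show "map inv_letter (rev x) \<in> carrier (free_group S)"
      using x successively_rev_map_inv_letter[OF x(2)]
      by (auto simp: free_group_def inv_letter_def)
  qed
next
  fix x y assume "x \<in> carrier (free_group S)" "y \<in> carrier (free_group S)"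
  then show "x \<otimes>\<^bsub>free_group S\<^esub> y \<in> carrier (free_group S)"
    using set_foldr_push_letter[of x y] by (auto simp: free_group_def reduced_foldr_push_letter)
qed (auto simp: free_group_def foldr_push_letter_assoc)

lemma letter_in_free_group: "s \<in> S \<Longrightarrow> [(s, b)] \<in> carrier (free_group S)"
  by (simp add: free_group_def)

lemma inv_letter_free_group:
  assumes "s \<in> S"
  shows "inv\<^bsub>free_group S\<^esub> [(s, b)] = [(s, \<not> b)]"
proof -
  interpret group "free_group S" by (rule group_free_group)
  have "[(s, \<not> b)] \<otimes>\<^bsub>free_group S\<^esub> [(s, b)] = \<one>\<^bsub>free_group S\<^esub>"
    by (simp add: free_group_def push_letter_def inv_letter_def)
  then show ?thesis
    by (rule inv_equality) (use assms in \<open>auto intro: letter_in_free_group\<close>)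
qed

lemma subgroup_free_group_eq_carrier:
  assumes H: "subgroup H (free_group S)" and gen: "\<And>s. s \<in> S \<Longrightarrow> [(s, True)] \<in> H"
  shows "H = carrier (free_group S)"
proof
  show "H \<subseteq> carrier (free_group S)"
    using H by (rule subgroup.subset)
  have letter: "[a] \<in> H" if "fst a \<in> S" for a
  proof (cases "snd a")
    case True
    then show ?thesis
      using gen[OF that] by (cases a) auto
  next
    case False
    then show ?thesis
      using subgroup.m_inv_closed[OF H gen[OF that]] inv_letter_free_group[OF that, of True]
      by (cases a) auto
  qed
  have "w \<in> H" if "set w \<subseteq> S \<times> UNIV" "reduced_word w" for w
    using that
  proof (induction w)
    case Nil
    then show ?case
      using subgroup.one_closed[OF H] by (simp add: free_group_def)
  next
    case (Cons a w)
    have "[a] \<otimes>\<^bsub>free_group S\<^esub> w \<in> H"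
      using Cons letter[of a] by (intro subgroup.m_closed[OF H]) (auto simp: successively_Cons)
    moreover have "push_letter a w = a # w"
      using Cons by (cases w) (auto simp: push_letter_def)
    ultimately show ?case
      by (simp add: free_group_def)
  qed
  then show "carrier (free_group S) \<subseteq> H"
    by (auto simp: free_group_def)
qed

section \<open>Holonomy of locally constant cocycles\<close>

text \<open>\<open>c\<close> is a Cech 1-cocycle with values in a possibly non-abelian group; its
  law is required only for points closer than \<delta>. Its holonomy along loops will give the
  homomorphism from the fundamental group.\<close>

locale local_cocycle = group F for F (structure) +
  fixes X :: "'x::metric_space set" and \<delta> :: real and c :: "'x \<Rightarrow> 'x \<Rightarrow> 'a"
  assumes delta_pos: "0 < \<delta>"
    and c_closed [simp, intro]: "\<And>x y. x \<in> X \<Longrightarrow> y \<in> X \<Longrightarrow> c x y \<in> carrier F"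
    and cocycle: "\<And>x y z. \<lbrakk>x \<in> X; y \<in> X; z \<in> X; dist x y < \<delta>; dist y z < \<delta>; dist x z < \<delta>\<rbrakk>
                    \<Longrightarrow> c x y \<otimes> c y z = c x z"
begin

lemma c_refl: "x \<in> X \<Longrightarrow> c x x = \<one>"
  using cocycle[of x x x] delta_pos by (simp add: r_cancel_one)

lemma c_sym: "\<lbrakk>x \<in> X; y \<in> X; dist x y < \<delta>\<rbrakk> \<Longrightarrow> c y x = inv (c x y)"
  using cocycle[of y x y] delta_pos by (simp add: c_refl dist_commute inv_equality)

text \<open>Parallel transport along \<open>g\<close>, that is, a lift of \<open>g\<close> to the
  covering which \<open>c\<close> would define. A single \<eta> serves the whole interval, so lifts
  can be compared and glued over short steps.\<close>

definition path_lift :: "(real \<Rightarrow> 'x) \<Rightarrow> (real \<Rightarrow> 'a) \<Rightarrow> bool" where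
  "path_lift g L \<longleftrightarrow> (\<forall>t\<in>{0..1}. L t \<in> carrier F) \<and>
     (\<exists>\<eta>>0. \<forall>s\<in>{0..1}. \<forall>t\<in>{0..1}. \<bar>s - t\<bar> < \<eta> \<longrightarrow> L t = L s \<otimes> c (g s) (g t))"

lemma path_lift_closed: "path_lift g L \<Longrightarrow> 0 \<le> t \<Longrightarrow> t \<le> 1 \<Longrightarrow> L t \<in> carrier F"
  by (simp add: path_lift_def)

lemma path_liftE:
  assumes "path_lift g L"
  obtains \<eta> where "0 < \<eta>"
    "\<And>s t. \<lbrakk>s \<in> {0..1}; t \<in> {0..1}; \<bar>s - t\<bar> < \<eta>\<rbrakk> \<Longrightarrow> L t = L s \<otimes> c (g s) (g t)"
proof -
  from assms obtain \<eta> where eta: "\<eta> > 0"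
    "\<forall>s\<in>{0..1}. \<forall>t\<in>{0..1}. \<bar>s - t\<bar> < \<eta> \<longrightarrow> L t = L s \<otimes> c (g s) (g t)"
    unfolding path_lift_def by (elim conjE exE)
  show thesis
    by (rule that[OF eta(1)]) (rule eta(2)[rule_format])
qed

lemma path_mem: "path_image g \<subseteq> X \<Longrightarrow> 0 \<le> t \<Longrightarrow> t \<le> 1 \<Longrightarrow> g t \<in> X"
  by (auto simp: path_image_def)

lemma path_uniform:
  assumes "path (g :: real \<Rightarrow> 'x)"
  obtains \<eta> where "0 < \<eta>" "\<And>s t. \<lbrakk>0 \<le> s; s \<le> 1; 0 \<le> t; t \<le> 1; \<bar>s - t\<bar> < \<eta>\<rbrakk> \<Longrightarrow> dist (g s) (g t) < \<delta>"
proof -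
  have "uniformly_continuous_on {0..1} g"
    using assms by (simp add: path_def compact_uniformly_continuous)
  then obtain d where "d > 0"
    "\<And>x x'. x \<in> {0..1} \<Longrightarrow> x' \<in> {0..1} \<Longrightarrow> dist x' x < d \<Longrightarrow> dist (g x') (g x) < \<delta>"
    using delta_pos unfolding uniformly_continuous_on_def by metis
  then show thesis
    by (intro that[of d]) (auto simp: dist_real_def)
qed

text \<open>Ordered pairs suffice because \<open>c_sym\<close> reverses the relation. Shrinking
  \<eta> by uniform continuity makes nearness on the whole piece between \<open>s\<close> and
  \<open>t\<close> available, so the cocycle law may be used at intermediate points.\<close>

lemma path_liftI:
  assumes g: "path g" "path_image g \<subseteq> X" and L: "\<And>t. 0 \<le> t \<Longrightarrow> t \<le> 1 \<Longrightarrow> L t \<in> carrier F"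
    and "0 < \<eta>"
    and *: "\<And>s t. \<lbrakk>0 \<le> s; s \<le> t; t \<le> 1; t - s < \<eta>;
                \<And>u v. \<lbrakk>s \<le> u; u \<le> t; s \<le> v; v \<le> t\<rbrakk> \<Longrightarrow> dist (g u) (g v) < \<delta>\<rbrakk>
              \<Longrightarrow> L t = L s \<otimes> c (g s) (g t)"
  shows "path_lift g L"
proof -
  obtain \<eta>' where eta': "0 < \<eta>'"
    "\<And>s t. \<lbrakk>0 \<le> s; s \<le> 1; 0 \<le> t; t \<le> 1; \<bar>s - t\<bar> < \<eta>'\<rbrakk> \<Longrightarrow> dist (g s) (g t) < \<delta>"
    using path_uniform[OF g(1)] by blast
  have le: "L t = L s \<otimes> c (g s) (g t)" if "0 \<le> s" "s \<le> t" "t \<le> 1" "t - s < min \<eta> \<eta>'" for s t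
    using that by (intro *) (auto intro!: eta'(2))
  have all: "L t = L s \<otimes> c (g s) (g t)"
    if st: "s \<in> {0..1}" "t \<in> {0..1}" "\<bar>s - t\<bar> < min \<eta> \<eta>'" for s t
  proof (cases "s \<le> t")
    case False
    have gs: "g s \<in> X" "g t \<in> X"
      using st path_mem[OF g(2)] by auto
    have "dist (g t) (g s) < \<delta>"
      using st by (intro eta'(2)) auto
    then have "c (g s) (g t) = inv (c (g t) (g s))"
      using c_sym[of "g t" "g s"] gs by blast
    moreover have "L s = L t \<otimes> c (g t) (g s)"
      using st False by (intro le) auto
    ultimately show ?thesis
      using st L[of t] gs by (simp add: m_assoc)
  next
    case True
    then show ?thesis
      using st by (intro le) auto
  qed
  show ?thesis
    unfolding path_lift_def
    by (intro conjI exI[of _ "min \<eta> \<eta>'"] ballI impI all) (use L \<open>0 < \<eta>\<close> eta'(1) in auto)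
qed

text \<open>Multiply the values of \<open>c\<close> along a grid; the value at \<open>t\<close> is
  the product up to the last grid point before \<open>t\<close>, followed by one factor from there
  to \<open>g t\<close>.\<close>

lemma path_lift_exists:
  assumes g: "path g" "path_image g \<subseteq> X"
  shows "\<exists>L. path_lift g L \<and> L 0 = \<one>"
proof -
  obtain \<eta> where eta: "0 < \<eta>"
    "\<And>s t. \<lbrakk>0 \<le> s; s \<le> 1; 0 \<le> t; t \<le> 1; \<bar>s - t\<bar> < \<eta>\<rbrakk> \<Longrightarrow> dist (g s) (g t) < \<delta>"
    using path_uniform[OF g(1)] by blast
  \<comment> \<open>A grid point and \<open>g t\<close> can be almost two mesh widths apart, one up
    to \<open>s\<close> and one from \<open>s\<close> to \<open>t\<close>; hence the factor
    2.\<close>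
  obtain n :: nat where n: "n > 0" "2 / real n < \<eta>"
  proof -
    obtain n where "inverse (real (Suc n)) < \<eta> / 2"
      using reals_Archimedean[of "\<eta> / 2"] eta(1) by auto
    then show thesis
      by (intro that[of "Suc n"]) (auto simp: field_simps)
  qed
  define x where "x k = g (real k / n)" for k :: nat
  define P where "P = rec_nat \<one> (\<lambda>k a. a \<otimes> c (x k) (x (Suc k)))"
  have P0: "P 0 = \<one>" and PS: "P (Suc k) = P k \<otimes> c (x k) (x (Suc k))" for k
    by (simp_all add: P_def)
  have x: "x k \<in> X" if "k \<le> n" for k
    unfolding x_def using that n by (intro path_mem[OF g(2)]) auto
  have P: "P k \<in> carrier F" if "k \<le> n" for k
    using that by (induction k) (auto simp: P0 PS x)
  define K where "K t = nat \<lfloor>real n * t\<rfloor>" for t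
  have K: "K t \<le> n" "real (K t) / n \<le> t" "t < real (K t) / n + 1 / n" if "0 \<le> t" "t \<le> 1" for t
  proof -
    have "real n * t \<le> n"
      using that by (simp add: mult_left_le)
    then show "K t \<le> n"
      unfolding K_def by linarith
    have *: "real (K t) \<le> real n * t" "real n * t < real (K t) + 1"
      unfolding K_def using that by (auto simp: of_nat_nat)
    then show "real (K t) / n \<le> t" "t < real (K t) / n + 1 / n"
      using n(1) by (auto simp: field_simps)
  qed
  define L where "L t = P (K t) \<otimes> c (x (K t)) (g t)" for t
  have "path_lift g L"
  proof (rule path_liftI[OF g])
    show "L t \<in> carrier F" if "0 \<le> t" "t \<le> 1" for t
      unfolding L_def using K[OF that] that path_mem[OF g(2)] by (auto intro: x P)
    show "0 < 1 / real n"
      using n by simp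
    fix s t assume st: "0 \<le> s" "s \<le> t" "t \<le> 1" "t - s < 1 / real n"
    have gst: "g s \<in> X" "g t \<in> X"
      using st path_mem[OF g(2)] by auto
    define k where "k = K s"
    have k: "k \<le> n" "real k / n \<le> s" "s < real k / n + 1 / n"
      using K[of s] st by (auto simp: k_def)
    define h where "h = 1 / real n"
    have kn: "real k / n \<ge> 0"
      by simp
    have d: "dist (g u) (g v) < \<delta>"
      if "0 \<le> u" "u \<le> 1" "0 \<le> v" "v \<le> 1" "\<bar>u - v\<bar> < h + h" for u v
      using that n by (intro eta) (auto simp: h_def)
    have near: "dist (x k) (g s) < \<delta>" "dist (g s) (g t) < \<delta>" "dist (x k) (g t) < \<delta>"
      unfolding x_def using st k kn by (intro d; fold h_def; linarith)+
    have c1: "c (x k) (g s) \<otimes> c (g s) (g t) = c (x k) (g t)"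
      by (rule cocycle) (use near gst x k in auto)
    have Ls: "L s \<otimes> c (g s) (g t) = P k \<otimes> c (x k) (g t)"
      using c1 gst x[of k] k P[of k] by (simp add: L_def k_def[symmetric] m_assoc)
    \<comment> \<open>The step from \<open>s\<close> to \<open>t\<close> is shorter than the mesh,
      so it passes at most one grid point, which the cocycle law then inserts.\<close>
    have "K t = k \<or> K t = Suc k"
    proof -
      have "real n * s \<le> real n * t" "real n * t < real n * s + 1"
        using st n by (auto simp: field_simps mult_left_mono)
      then have "\<lfloor>real n * s\<rfloor> \<le> \<lfloor>real n * t\<rfloor>" "\<lfloor>real n * t\<rfloor> \<le> \<lfloor>real n * s\<rfloor> + 1" "0 \<le> \<lfloor>real n * s\<rfloor>"
        using st by (auto simp: floor_mono) linarith
      then show ?thesis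
        unfolding k_def K_def by linarith
    qed
    then show "L t = L s \<otimes> c (g s) (g t)"
    proof
      assume "K t = k"
      then show ?thesis
        using Ls by (simp add: L_def)
    next
      assume Kt: "K t = Suc k"
      have k': "Suc k \<le> n" "real (Suc k) / n \<le> t" "t < real (Suc k) / n + 1 / n"
        using K[of t] st Kt by auto
      have "real (Suc k) / n = real k / n + h"
        by (simp add: add_divide_distrib h_def)
      then have near': "dist (x k) (x (Suc k)) < \<delta>" "dist (x (Suc k)) (g t) < \<delta>"
        unfolding x_def using st k k' kn by (intro d; fold h_def; linarith)+
      have "c (x k) (x (Suc k)) \<otimes> c (x (Suc k)) (g t) = c (x k) (g t)"
        by (rule cocycle) (use near near' gst x k k' in auto)
      then show ?thesis
        using Ls gst x k k' P[of k] by (simp add: L_def Kt PS m_assoc)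
    qed
  qed
  moreover have "L 0 = \<one>"
    using x[of 0] by (simp add: L_def K_def P0 c_refl) (simp add: x_def c_refl)
  ultimately show ?thesis
    by blast
qed

lemma inv_mult_telescope:
  assumes "u \<in> carrier F" "v \<in> carrier F" "w \<in> carrier F"
  shows "(inv u \<otimes> v) \<otimes> (inv v \<otimes> w) = inv u \<otimes> w"
proof -
  have "v \<otimes> (inv v \<otimes> w) = w"
    using assms by (simp flip: m_assoc)
  then show ?thesis
    using assms by (simp add: m_assoc)
qed

text \<open>The transport over \<open>[a, b]\<close> is a product of transports over short pieces,
  each of which is a single value of \<open>c\<close>. Bolzano's principle for intervals takes the
  place of an explicit subdivision.\<close>

lemma path_lift_subgroup:
  assumes g: "path g" "path_image g \<subseteq> X" and L: "path_lift g L" and H: "subgroup H F"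
    and ab: "0 \<le> a" "a \<le> b" "b \<le> 1"
    and cH: "\<And>s t. \<lbrakk>a \<le> s; s \<le> t; t \<le> b; dist (g s) (g t) < \<delta>\<rbrakk> \<Longrightarrow> c (g s) (g t) \<in> H"
  shows "inv (L a) \<otimes> L b \<in> H"
proof -
  obtain \<eta> where eta: "0 < \<eta>"
    "\<And>s t. \<lbrakk>s \<in> {0..1}; t \<in> {0..1}; \<bar>s - t\<bar> < \<eta>\<rbrakk> \<Longrightarrow> L t = L s \<otimes> c (g s) (g t)"
    using path_liftE[OF L] by metis
  obtain \<eta>' where eta': "0 < \<eta>'"
    "\<And>s t. \<lbrakk>0 \<le> s; s \<le> 1; 0 \<le> t; t \<le> 1; \<bar>s - t\<bar> < \<eta>'\<rbrakk> \<Longrightarrow> dist (g s) (g t) < \<delta>"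
    using path_uniform[OF g(1)] by blast
  have "a \<le> a \<and> b \<le> b \<longrightarrow> inv (L a) \<otimes> L b \<in> H"
  proof (rule Bolzano[where P = "\<lambda>u v. a \<le> u \<and> v \<le> b \<longrightarrow> inv (L u) \<otimes> L v \<in> H", OF ab(2)], goal_cases)
    case (1 u v w)
    show ?case
    proof
      assume "a \<le> u \<and> w \<le> b"
      then have "inv (L u) \<otimes> L v \<in> H" "inv (L v) \<otimes> L w \<in> H"
        "L u \<in> carrier F" "L v \<in> carrier F" "L w \<in> carrier F"
        using 1 ab by (auto intro!: path_lift_closed[OF L])
      then show "inv (L u) \<otimes> L w \<in> H"
        using subgroup.m_closed[OF H] inv_mult_telescope by metis
    qed
  next
    case (2 x)
    show ?case
    proof (intro exI[of _ "min \<eta> \<eta>'"] conjI allI impI)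
      fix u v assume uv: "u \<le> x \<and> x \<le> v \<and> v - u < min \<eta> \<eta>'" "a \<le> u \<and> v \<le> b"
      then have "L v = L u \<otimes> c (g u) (g v)"
        using ab by (intro eta) auto
      moreover have "L u \<in> carrier F" "g u \<in> X" "g v \<in> X"
        using uv ab by (auto intro!: path_lift_closed[OF L] path_mem[OF g(2)])
      moreover have "dist (g u) (g v) < \<delta>"
        using uv ab by (intro eta') auto
      ultimately show "inv (L u) \<otimes> L v \<in> H"
        using uv cH[of u v] by (simp add: m_assoc[symmetric])
    qed (use eta(1) eta'(1) in auto)
  qed
  then show ?thesis
    by simp
qed

lemma path_lift_unique:
  assumes "path_lift g L" "path_lift g L'" "L 0 = L' 0"
  shows "L 1 = L' 1"
proof -
  obtain \<eta> where eta: "0 < \<eta>"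
    "\<And>s t. \<lbrakk>s \<in> {0..1}; t \<in> {0..1}; \<bar>s - t\<bar> < \<eta>\<rbrakk> \<Longrightarrow> L t = L s \<otimes> c (g s) (g t)"
    using path_liftE[OF assms(1)] by metis
  obtain \<eta>' where eta': "0 < \<eta>'"
    "\<And>s t. \<lbrakk>s \<in> {0..1}; t \<in> {0..1}; \<bar>s - t\<bar> < \<eta>'\<rbrakk> \<Longrightarrow> L' t = L' s \<otimes> c (g s) (g t)"
    using path_liftE[OF assms(2)] by metis
  have "0 \<le> (0::real) \<and> 1 \<le> (1::real) \<longrightarrow> L 0 = L' 0 \<longrightarrow> L 1 = L' 1"
  proof (rule Bolzano[where P = "\<lambda>u v. 0 \<le> u \<and> v \<le> 1 \<longrightarrow> L u = L' u \<longrightarrow> L v = L' v", OF zero_le_one], goal_cases)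
    case (1 u v w)
    then show ?case by auto
  next
    case (2 x)
    show ?case
    proof (intro exI[of _ "min \<eta> \<eta>'"] conjI allI impI)
      fix u v assume uv: "u \<le> x \<and> x \<le> v \<and> v - u < min \<eta> \<eta>'" "0 \<le> u \<and> v \<le> 1" "L u = L' u"
      then show "L v = L' v"
        using eta(2)[of u v] eta'(2)[of u v] by auto
    qed (use eta eta' in auto)
  qed
  then show ?thesis
    using assms by simp
qed

text \<open>The choice is harmless by \<open>path_lift_unique\<close>, and \<open>hol_eqI\<close>
  evaluates it from a lift with any initial value.\<close>

definition hol :: "(real \<Rightarrow> 'x) \<Rightarrow> 'a" where
  "hol g = (SOME L. path_lift g L \<and> L 0 = \<one>) 1"

lemma hol_eqI:
  assumes g: "path_image g \<subseteq> X" and L: "path_lift g L"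
  shows "hol g = inv (L 0) \<otimes> L 1"
proof -
  define L' where "L' t = inv (L 0) \<otimes> L t" for t
  have L0: "L t \<in> carrier F" if "0 \<le> t" "t \<le> 1" for t
    using L that by (simp add: path_lift_def)
  obtain \<eta> where eta: "0 < \<eta>"
    "\<And>s t. \<lbrakk>s \<in> {0..1}; t \<in> {0..1}; \<bar>s - t\<bar> < \<eta>\<rbrakk> \<Longrightarrow> L t = L s \<otimes> c (g s) (g t)"
    using path_liftE[OF L] by metis
  have all: "L' t = L' s \<otimes> c (g s) (g t)" if st: "s \<in> {0..1}" "t \<in> {0..1}" "\<bar>s - t\<bar> < \<eta>" for s t
    using eta(2)[OF st] st L0 path_mem[OF g] by (simp add: L'_def m_assoc)
  have lift: "path_lift g L'"
    unfolding path_lift_def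
    by (intro conjI exI[of _ \<eta>] ballI impI all) (use eta(1) L0 in \<open>auto simp: L'_def\<close>)
  have L'0: "L' 0 = \<one>"
    using L0 by (simp add: L'_def)
  define L'' where "L'' = (SOME L. path_lift g L \<and> L 0 = \<one>)"
  have "path_lift g L'' \<and> L'' 0 = \<one>"
    unfolding L''_def by (rule someI[of _ L']) (simp add: lift L'0)
  then have "L'' 1 = L' 1"
    using path_lift_unique[OF _ lift] L'0 by simp
  then show ?thesis
    by (simp add: hol_def L''_def L'_def)
qed

lemma hol_in_subgroup:
  assumes g: "path g" "path_image g \<subseteq> X" and H: "subgroup H F"
    and cH: "\<And>s t. \<lbrakk>0 \<le> s; s \<le> t; t \<le> 1; dist (g s) (g t) < \<delta>\<rbrakk> \<Longrightarrow> c (g s) (g t) \<in> H"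
  shows "hol g \<in> H"
proof -
  obtain L where L: "path_lift g L"
    using path_lift_exists[OF g] by blast
  show ?thesis
    unfolding hol_eqI[OF g(2) L] by (rule path_lift_subgroup[OF g L H]) (auto intro: cH)
qed

lemma hol_closed: "path g \<Longrightarrow> path_image g \<subseteq> X \<Longrightarrow> hol g \<in> carrier F"
  by (rule hol_in_subgroup[OF _ _ subgroup_self]) (auto simp: path_image_def image_subset_iff)

lemma hol_join:
  assumes g: "path g" "path_image g \<subseteq> X" and h: "path h" "path_image h \<subseteq> X"
    and gh: "pathfinish g = pathstart h"
  shows "hol (g +++ h) = hol g \<otimes> hol h"
proof -
  obtain L where L: "path_lift g L" "L 0 = \<one>"
    using path_lift_exists[OF g] by blast
  obtain L' where L': "path_lift h L'" "L' 0 = \<one>"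
    using path_lift_exists[OF h] by blast
  obtain \<eta> where eta: "0 < \<eta>"
    "\<And>s t. \<lbrakk>s \<in> {0..1}; t \<in> {0..1}; \<bar>s - t\<bar> < \<eta>\<rbrakk> \<Longrightarrow> L t = L s \<otimes> c (g s) (g t)"
    using path_liftE[OF L(1)] by metis
  obtain \<eta>' where eta': "0 < \<eta>'"
    "\<And>s t. \<lbrakk>s \<in> {0..1}; t \<in> {0..1}; \<bar>s - t\<bar> < \<eta>'\<rbrakk> \<Longrightarrow> L' t = L' s \<otimes> c (h s) (h t)"
    using path_liftE[OF L'(1)] by metis
  define k where "k = g +++ h"
  have k: "path k" "path_image k \<subseteq> X"
    using g h gh path_image_join_subset[of g h] by (auto simp: k_def)
  define K where "K t = (if t \<le> 1/2 then L (2 * t) else L 1 \<otimes> L' (2 * t - 1))" for t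
  have Lc: "L t \<in> carrier F" "L' t \<in> carrier F" if "0 \<le> t" "t \<le> 1" for t
    using that path_lift_closed L L' by auto
  have "path_lift k K"
  proof (rule path_liftI[OF k])
    show "K t \<in> carrier F" if "0 \<le> t" "t \<le> 1" for t
      using that by (auto simp: K_def Lc)
    show "0 < min \<eta> \<eta>' / 2"
      using eta(1) eta'(1) by simp
    fix s t assume st: "0 \<le> s" "s \<le> t" "t \<le> 1" "t - s < min \<eta> \<eta>' / 2"
      and near: "\<And>u v. \<lbrakk>s \<le> u; u \<le> t; s \<le> v; v \<le> t\<rbrakk> \<Longrightarrow> dist (k u) (k v) < \<delta>"
    have mem: "k u \<in> X" if "s \<le> u" "u \<le> t" for u
      using that st path_mem[OF k(2)] by auto
    consider "t \<le> 1/2" | "s > 1/2" | "s \<le> 1/2" "t > 1/2"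
      by linarith
    then show "K t = K s \<otimes> c (k s) (k t)"
    proof cases
      case 1
      then show ?thesis
        using st eta(2)[of "2 * s" "2 * t"] by (auto simp: K_def k_def joinpaths_def)
    next
      case 2
      then show ?thesis
        using st eta'(2)[of "2 * s - 1" "2 * t - 1"] mem[of s] mem[of t]
        by (auto simp: K_def k_def joinpaths_def m_assoc Lc)
    next
      \<comment> \<open>Only a pair that straddles the junction is new; the cocycle law through
        \<open>k (1/2)\<close> splits it into a step of \<open>L\<close> and a step of
        \<open>L'\<close>.\<close>
      case 3
      have "k (1/2) = g 1" "k (1/2) = h 0" "k s = g (2 * s)" "k t = h (2 * t - 1)"
        using 3 gh by (auto simp: k_def joinpaths_def pathfinish_def pathstart_def)
      moreover have "L 1 = L (2 * s) \<otimes> c (g (2 * s)) (g 1)"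
        using 3 st by (intro eta(2)) auto
      moreover have "L' (2 * t - 1) = \<one> \<otimes> c (h 0) (h (2 * t - 1))"
        using eta'(2)[of 0 "2 * t - 1"] 3 st L'(2) by auto
      moreover have "c (k s) (k (1/2)) \<otimes> c (k (1/2)) (k t) = c (k s) (k t)"
        using 3 st by (intro cocycle near mem) auto
      moreover have "k s \<in> X" "k t \<in> X" "k (1/2) \<in> X"
        using 3 st mem by auto
      ultimately show ?thesis
        using 3 st Lc[of "2 * s"] by (simp add: K_def m_assoc)
    qed
  qed
  then have "hol k = inv (K 0) \<otimes> K 1"
    by (rule hol_eqI[OF k(2)])
  also have "\<dots> = L 1 \<otimes> L' 1"
    using L Lc by (simp add: K_def)
  also have "\<dots> = hol g \<otimes> hol h"
    using hol_eqI[OF g(2) L(1)] hol_eqI[OF h(2) L'(1)] L L' Lc by simp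
  finally show ?thesis
    by (simp add: k_def)
qed

lemma hol_reversepath:
  assumes g: "path g" "path_image g \<subseteq> X"
  shows "hol (reversepath g) = inv (hol g)"
proof -
  have "hol (reversepath g +++ g) = hol (reversepath g) \<otimes> hol g"
    using g by (intro hol_join) auto
  obtain L where L: "path_lift g L" "L 0 = \<one>"
    using path_lift_exists[OF g] by blast
  obtain \<eta> where eta: "0 < \<eta>"
    "\<And>s t. \<lbrakk>s \<in> {0..1}; t \<in> {0..1}; \<bar>s - t\<bar> < \<eta>\<rbrakk> \<Longrightarrow> L t = L s \<otimes> c (g s) (g t)"
    using path_liftE[OF L(1)] by metis
  have "path_lift (reversepath g) (\<lambda>t. L (1 - t))"
    unfolding path_lift_def
  proof (intro conjI exI[of _ \<eta>] ballI impI)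
    fix s t :: real assume "s \<in> {0..1}" "t \<in> {0..1}" "\<bar>s - t\<bar> < \<eta>"
    then show "L (1 - t) = L (1 - s) \<otimes> c (reversepath g s) (reversepath g t)"
      unfolding reversepath_def by (intro eta(2)) auto
  qed (use eta(1) path_lift_closed[OF L(1)] in auto)
  then have "hol (reversepath g) = inv (L 1) \<otimes> L 0"
    using hol_eqI[of "reversepath g"] g by simp
  then show ?thesis
    using hol_eqI[OF g(2) L(1)] L path_lift_closed[OF L(1), of 1] by simp
qed

text \<open>Curves of the homotopy at nearby parameters are uniformly close, and multiplying a lift
  of one by \<open>c\<close> between corresponding points gives a lift of the other. The end points
  stay fixed, so this factor is trivial there and the holonomy is locally constant in the
  parameter.\<close>

lemma hol_homotopic:
  assumes "homotopic_paths X g g'"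
  shows "hol g = hol g'"
proof -
  obtain h :: "real \<times> real \<Rightarrow> 'x" where h: "continuous_on ({0..1} \<times> {0..1}) h" "h \<in> {0..1} \<times> {0..1} \<rightarrow> X"
    "\<forall>x\<in>{0..1}. h (0, x) = g x" "\<forall>x\<in>{0..1}. h (1, x) = g' x"
    "\<forall>t\<in>{0..1}. pathstart (h \<circ> Pair t) = pathstart g \<and> pathfinish (h \<circ> Pair t) = pathfinish g"
    using assms unfolding homotopic_paths by blast
  have "uniformly_continuous_on ({0..1} \<times> {0..1}) h"
    using h(1) by (intro compact_uniformly_continuous) (auto simp: compact_Times)
  then obtain d where d: "d > 0"
    "\<And>x x'. x \<in> {0..1} \<times> {0..1} \<Longrightarrow> x' \<in> {0..1} \<times> {0..1} \<Longrightarrow> dist x' x < d \<Longrightarrow> dist (h x') (h x) < \<delta>"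
    using delta_pos unfolding uniformly_continuous_on_def by metis
  define H where "H u = h \<circ> Pair u" for u :: real
  have Hpath: "path (H u)" "path_image (H u) \<subseteq> X" if "u \<in> {0..1}" for u
  proof -
    show "path (H u)"
      unfolding H_def path_def using that
      by (intro continuous_on_compose continuous_intros continuous_on_subset[OF h(1)]) auto
    show "path_image (H u) \<subseteq> X"
      using h(2) that by (auto simp: H_def path_image_def)
  qed
  have Hmem: "H u s \<in> X" if "u \<in> {0..1}" "s \<in> {0..1}" for u s
    using h(2) that by (auto simp: H_def)
  \<comment> \<open>The distance of \<open>(u, s)\<close> and \<open>(v, t)\<close> is at most the
    sum of the parameter differences, hence the two halves of \<open>d\<close>.\<close>
  have near: "dist (H u s) (H v t) < \<delta>"
    if "u \<in> {0..1}" "v \<in> {0..1}" "s \<in> {0..1}" "t \<in> {0..1}" "\<bar>u - v\<bar> < d / 2" "\<bar>s - t\<bar> < d / 2" for u v s t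
  proof -
    have "dist (u, s) (v, t) \<le> \<bar>u - v\<bar> + \<bar>s - t\<bar>"
      unfolding dist_Pair_Pair dist_real_def
      by (rule order_trans[OF sqrt_sum_squares_le_sum_abs]) simp
    then show ?thesis
      using that by (auto simp: H_def intro!: d(2))
  qed
  have step: "hol (H u) = hol (H v)" if uv: "u \<in> {0..1}" "v \<in> {0..1}" "\<bar>u - v\<bar> < d / 2" for u v
  proof -
    obtain L where L: "path_lift (H u) L" "L 0 = \<one>"
      using path_lift_exists Hpath[OF uv(1)] by blast
    obtain \<eta> where eta: "0 < \<eta>"
      "\<And>s t. \<lbrakk>s \<in> {0..1}; t \<in> {0..1}; \<bar>s - t\<bar> < \<eta>\<rbrakk> \<Longrightarrow> L t = L s \<otimes> c (H u s) (H u t)"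
      using path_liftE[OF L(1)] by metis
    have Lc: "L t \<in> carrier F" if "0 \<le> t" "t \<le> 1" for t
      using that path_lift_closed[OF L(1)] by auto
    define K where "K t = L t \<otimes> c (H u t) (H v t)" for t
    have "path_lift (H v) K"
    proof (rule path_liftI[OF Hpath[OF uv(2)]])
      show "K t \<in> carrier F" if "0 \<le> t" "t \<le> 1" for t
        using that uv Hmem by (auto simp: K_def Lc)
      show "0 < min \<eta> (d / 2)"
        using eta d by simp
      fix s t assume st: "0 \<le> s" "s \<le> t" "t \<le> 1" "t - s < min \<eta> (d / 2)"
      have mem: "H u s \<in> X" "H u t \<in> X" "H v s \<in> X" "H v t \<in> X"
        using st uv by (auto intro!: Hmem)
      have "c (H u s) (H v s) \<otimes> c (H v s) (H v t) = c (H u s) (H v t)"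
        using st uv d(1) by (intro cocycle near mem) auto
      moreover have "c (H u s) (H u t) \<otimes> c (H u t) (H v t) = c (H u s) (H v t)"
        using st uv d(1) by (intro cocycle near mem) auto
      moreover have "L t = L s \<otimes> c (H u s) (H u t)"
        using st by (intro eta(2)) auto
      ultimately show "K t = K s \<otimes> c (H v s) (H v t)"
        using st mem Lc[of s] by (simp add: K_def m_assoc)
    qed
    then have "hol (H v) = inv (K 0) \<otimes> K 1"
      by (rule hol_eqI[OF Hpath(2)[OF uv(2)]])
    also have "H u 0 = H v 0" "H u 1 = H v 1"
      using h(5) uv by (simp_all add: H_def pathstart_def pathfinish_def)
    then have "inv (K 0) \<otimes> K 1 = L 1"
      using Hmem[OF uv(2), of 0] Hmem[OF uv(2), of 1] L(2) Lc[of 1] by (simp add: K_def c_refl)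
    finally show ?thesis
      using hol_eqI[OF Hpath(2)[OF uv(1)] L(1)] L(2) Lc[of 1] by simp
  qed
  have "0 \<le> (0::real) \<and> 1 \<le> (1::real) \<longrightarrow> hol (H 0) = hol (H 1)"
  proof (rule Bolzano[where P = "\<lambda>u v. 0 \<le> u \<and> v \<le> 1 \<longrightarrow> hol (H u) = hol (H v)", OF zero_le_one], goal_cases)
    case (1 u v w)
    then show ?case by auto
  next
    case (2 x)
    show ?case
      using d(1) by (intro exI[of _ "d / 2"]) (auto intro!: step)
  qed
  then have eq: "hol (H 0) = hol (H 1)"
    by simp
  \<comment> \<open>\<open>H 0\<close> and \<open>H 1\<close> agree with \<open>g\<close> and
    \<open>g'\<close> only on the unit interval, so the comparison goes through their lifts and not
    through equality of functions.\<close>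
  have cong: "path_lift k L = path_lift k' L" if "\<And>x. x \<in> {0..1} \<Longrightarrow> k x = k' x" for k k' L
    using that by (simp add: path_lift_def)
  have "hol g = hol (H 0)" "hol g' = hol (H 1)"
    unfolding hol_def using cong[of "H 0" g] cong[of "H 1" g'] h(3,4) by (auto simp: H_def)
  with eq show ?thesis
    by simp
qed

lemma epi_fundamental_group:
  assumes p: "p \<in> X" and surj: "carrier F \<subseteq> hol ` loops_at X p"
  shows "epi (fundamental_group X p) F \<noteq> {}"
proof -
  define \<Phi> where "\<Phi> A = the_elem (hol ` A)" for A
  have image: "hol ` loop_class X g = {hol g}" if "g \<in> loops_at X p" for g
    using that hol_homotopic by (fastforce simp: loop_class_def loops_at_def)
  have \<Phi>: "\<Phi> (loop_class X g) = hol g" if "g \<in> loops_at X p" for g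
    using image[OF that] by (simp add: \<Phi>_def)
  have join: "g +++ h \<in> loops_at X p" if "g \<in> loops_at X p" "h \<in> loops_at X p" for g h
    using that path_image_join_subset[of g h] by (auto simp: loops_at_def)
  \<comment> \<open>The product in \<open>fundamental_group\<close> is a union over all
    representatives; it collapses to one class because concatenation respects homotopy.\<close>
  have mult: "(\<Union>g'\<in>loop_class X g. \<Union>h'\<in>loop_class X h. loop_class X (g' +++ h')) = loop_class X (g +++ h)"
    if gh: "g \<in> loops_at X p" "h \<in> loops_at X p" for g h
  proof -
    have "loop_class X (g' +++ h') = loop_class X (g +++ h)"
      if "g' \<in> loop_class X g" "h' \<in> loop_class X h" for g' h'
    proof -
      have *: "homotopic_paths X (g +++ h) (g' +++ h')"
        using that gh by (intro homotopic_paths_join) (auto simp: loop_class_def loops_at_def)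
      show ?thesis
        unfolding loop_class_def
        using homotopic_paths_trans[OF *] homotopic_paths_trans[OF homotopic_paths_sym[OF *]] by blast
    qed
    moreover have "g \<in> loop_class X g" "h \<in> loop_class X h"
      using gh by (auto simp: loop_class_def loops_at_def)
    ultimately show ?thesis
      by blast
  qed
  have "\<Phi> \<in> hom (fundamental_group X p) F"
  proof (rule homI)
    fix A assume "A \<in> carrier (fundamental_group X p)"
    then show "\<Phi> A \<in> carrier F"
      by (auto simp: fundamental_group_def \<Phi> loops_at_def intro!: hol_closed)
  next
    fix A B assume "A \<in> carrier (fundamental_group X p)" "B \<in> carrier (fundamental_group X p)"
    then obtain g h where gh: "g \<in> loops_at X p" "h \<in> loops_at X p"
      "A = loop_class X g" "B = loop_class X h"
      by (auto simp: fundamental_group_def)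
    have "A \<otimes>\<^bsub>fundamental_group X p\<^esub> B = loop_class X (g +++ h)"
      using mult[OF gh(1,2)] by (simp add: fundamental_group_def gh)
    then have "\<Phi> (A \<otimes>\<^bsub>fundamental_group X p\<^esub> B) = hol (g +++ h)"
      using \<Phi>[OF join[OF gh(1,2)]] by simp
    also have "\<dots> = hol g \<otimes> hol h"
      using gh by (intro hol_join) (auto simp: loops_at_def)
    finally show "\<Phi> (A \<otimes>\<^bsub>fundamental_group X p\<^esub> B) = \<Phi> A \<otimes> \<Phi> B"
      using gh \<Phi> by simp
  qed
  moreover have "\<Phi> ` carrier (fundamental_group X p) = hol ` loops_at X p"
    by (auto simp: fundamental_group_def \<Phi> image_image cong: image_cong)
  moreover have "hol ` loops_at X p \<subseteq> carrier F"
    by (auto simp: loops_at_def intro: hol_closed)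
  ultimately have "\<Phi> \<in> epi (fundamental_group X p) F"
    using surj by (auto simp: epi_def)
  then show ?thesis
    by blast
qed

lemma subgroup_hol_loops:
  assumes "p \<in> X"
  shows "subgroup (hol ` loops_at X p) F"
proof (rule subgroupI)
  show "hol ` loops_at X p \<subseteq> carrier F"
    by (auto simp: loops_at_def intro: hol_closed)
  have "(\<lambda>_. p) \<in> loops_at X p"
    using assms by (auto simp: loops_at_def path_def path_image_def pathstart_def pathfinish_def)
  then show "hol ` loops_at X p \<noteq> {}"
    by blast
next
  fix a assume "a \<in> hol ` loops_at X p"
  then obtain g where g: "g \<in> loops_at X p" "a = hol g"
    by blast
  then have "reversepath g \<in> loops_at X p" "inv a = hol (reversepath g)"
    by (auto simp: loops_at_def hol_reversepath)
  then show "inv a \<in> hol ` loops_at X p"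
    by blast
next
  fix a b assume "a \<in> hol ` loops_at X p" "b \<in> hol ` loops_at X p"
  then obtain g h where gh: "g \<in> loops_at X p" "a = hol g" "h \<in> loops_at X p" "b = hol h"
    by blast
  then have "g +++ h \<in> loops_at X p" "a \<otimes> b = hol (g +++ h)"
    using path_image_join_subset[of g h] by (auto simp: loops_at_def hol_join)
  then show "a \<otimes> b \<in> hol ` loops_at X p"
    by blast
qed

end

section \<open>Reeb graphs of distance functions\<close>

text \<open>For a geodesic \<open>g\<close> this says that the points at times 0, \<open>s\<close>,
  \<open>t\<close>, 1 are metrically aligned, which is what makes descents possible.\<close>

lemma path_length_triple:
  assumes "0 \<le> s" "s \<le> t" "t \<le> 1"
  shows "ereal (dist (g 0) (g s) + dist (g s) (g t) + dist (g t) (g 1)) \<le> path_length g"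
proof -
  have "ereal (\<Sum>i<length [0, s, t, 1] - 1. dist (g ([0, s, t, 1] ! i)) (g ([0, s, t, 1] ! Suc i)))
        \<le> path_length g"
    unfolding path_length_def using assms by (intro SUP_upper) auto
  then show ?thesis
    by (simp add: numeral_3_eq_3 add.assoc)
qed

locale geodesic_reeb =
  fixes X :: "'a::metric_space set" and p :: 'a
  assumes compact_X: "compact X" and geodesic_X: "geodesic_space X" and p_in: "p \<in> X"
begin

abbreviation "f \<equiv> dist p"
abbreviation "\<phi> \<equiv> reeb_map X f"
abbreviation "R \<equiv> reeb_graph X f"
abbreviation "lev \<equiv> reeb_fun f"
abbreviation "\<C> \<equiv> contours X f"

lemma f_le: "f x \<le> f y + dist x y"
  by (metis add.commute dist_commute dist_triangle2 dist_triangle)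

lemma abs_f_diff: "\<bar>f x - f y\<bar> \<le> dist x y"
  using f_le[of x y] f_le[of y x] by (simp add: dist_commute abs_le_iff)

lemma continuous_f [continuous_intros]: "continuous_on A f"
  by (intro continuous_intros)

lemma phi_self: "x \<in> X \<Longrightarrow> x \<in> \<phi> x"
  by (simp add: reeb_map_def)

lemma phi_subset: "y \<in> \<phi> x \<Longrightarrow> y \<in> X \<and> f y = f x"
  unfolding reeb_map_def using connected_component_subset[of "{x' \<in> X. f x' = f x}" x] by blast

lemma phi_eqI:
  assumes "y \<in> \<phi> x"
  shows "\<phi> y = \<phi> x"
proof -
  have "f y = f x"
    using phi_subset[OF assms] by simp
  then show ?thesis
    using assms connected_component_eq[of y "{x' \<in> X. f x' = f x}" x] by (simp add: reeb_map_def)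
qed

lemma contoursE:
  assumes "C \<in> \<C>" obtains x where "x \<in> X" "C = \<phi> x"
  using assms by (auto simp: contours_def components_def reeb_map_def)

lemma phi_in: "x \<in> X \<Longrightarrow> \<phi> x \<in> \<C>"
  using topspace_reeb_graph[of X f] by (auto simp: reeb_graph_def)

lemma lev_phi: "x \<in> X \<Longrightarrow> lev (\<phi> x) = f x"
  by (rule reeb_fun_reeb_map)

lemma contour_mem:
  assumes "C \<in> \<C>" "x \<in> C"
  shows "x \<in> X" "\<phi> x = C" "f x = lev C"
  using assms phi_eqI phi_subset lev_phi by (metis contoursE)+

lemma contour_nonempty: "C \<in> \<C> \<Longrightarrow> \<exists>x. x \<in> C"
  using phi_self by (metis contoursE)

lemma contour_connected: "C \<in> \<C> \<Longrightarrow> connected C"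
  by (auto elim!: contoursE simp: reeb_map_def)

lemma closed_level: "closed {x \<in> X. f x = r}"
proof -
  have "closed {x \<in> X. f x \<in> {r}}"
    by (rule continuous_closed_preimage_constant[of X f r, simplified, THEN back_subst[of closed]])
       (use compact_X in \<open>auto intro!: continuous_intros compact_imp_closed\<close>)
  then show ?thesis by simp
qed

lemma contour_closed: "C \<in> \<C> \<Longrightarrow> closed C"
  by (elim contoursE) (simp add: reeb_map_def closed_connected_component closed_level)

lemma contour_compact: "C \<in> \<C> \<Longrightarrow> compact C"
  using contour_closed contour_mem(1) compact_X
  by (metis Int_absorb1 compact_Int_closed subsetI)

lemma topspace_R [simp]: "topspace R = \<C>"
  by (rule topspace_reeb_graph)

lemma openin_R: "openin R U \<longleftrightarrow> U \<subseteq> \<C> \<and> openin (top_of_set X) {x \<in> X. \<phi> x \<in> U}"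
  unfolding reeb_graph_def openin_quotient_topology
  using topspace_reeb_graph[of X f] by (simp add: reeb_graph_def)

lemma continuous_phi: "continuous_map (top_of_set X) R \<phi>"
  by (auto simp: continuous_map_def openin_R phi_in)

lemma continuous_lev: "continuous_map R euclideanreal lev"
proof -
  have "openin (top_of_set X) {x \<in> X. \<phi> x \<in> {C \<in> \<C>. lev C \<in> U}}" if "open U" for U
  proof -
    have "{x \<in> X. \<phi> x \<in> {C \<in> \<C>. lev C \<in> U}} = X \<inter> f -` U"
      by (auto simp: phi_in lev_phi)
    moreover have "openin (top_of_set X) (X \<inter> f -` U)"
      using that by (intro continuous_openin_preimage_gen continuous_f)
    ultimately show ?thesis by simp
  qed
  then show ?thesis
    by (auto simp: continuous_map_def openin_R)
qed

text \<open>\<open>contour_diameter_eq\<close> shows that the supremum is finite, by compactness of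
  \<open>X\<close>, so \<open>real_of_ereal\<close> does not fall back to its default value.\<close>

definition diam :: real where "diam = real_of_ereal (contour_diameter X f)"

lemma contour_dist_le_diameter: "\<lbrakk>C \<in> \<C>; x \<in> C; y \<in> C\<rbrakk> \<Longrightarrow> dist x y \<le> diameter C"
  by (intro diameter_bounded_bound compact_imp_bounded contour_compact)

lemma contour_diameter_eq: "contour_diameter X f = ereal diam"
proof -
  have "ereal (diameter C) \<le> ereal (diameter X)" if "C \<in> \<C>" for C
    using that contour_mem(1)[OF that] compact_X
    by (auto intro!: diameter_subset compact_imp_bounded)
  then have "contour_diameter X f \<le> ereal (diameter X)"
    unfolding contour_diameter_def by (intro SUP_least)
  moreover have "ereal (diameter (\<phi> p)) \<le> contour_diameter X f"
    unfolding contour_diameter_def by (intro SUP_upper phi_in p_in)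
  ultimately have "\<bar>contour_diameter X f\<bar> \<noteq> \<infinity>"
    by (cases "contour_diameter X f") auto
  then show ?thesis
    by (simp add: diam_def ereal_real)
qed

lemma dist_le_diam:
  assumes "C \<in> \<C>" "x \<in> C" "y \<in> C"
  shows "dist x y \<le> diam"
proof -
  have "ereal (diameter C) \<le> ereal diam"
    unfolding contour_diameter_eq[symmetric] contour_diameter_def using assms by (intro SUP_upper)
  then show ?thesis
    using contour_dist_le_diameter[OF assms] by simp
qed

lemma diam_nonneg: "0 \<le> diam"
  using dist_le_diam[OF phi_in[OF p_in] phi_self[OF p_in] phi_self[OF p_in]] by simp

subsection \<open>Descending geodesics\<close>

text \<open>Equality in the triangle inequality for \<open>p\<close>, \<open>z\<close>,
  \<open>x\<close>: the point \<open>z\<close> lies on some geodesic from \<open>x\<close> to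
  \<open>p\<close>. This turns descending geodesics into a transitive relation on points.\<close>

definition below :: "'a \<Rightarrow> 'a \<Rightarrow> bool" where
  "below x z \<longleftrightarrow> x \<in> X \<and> z \<in> X \<and> dist x z = f x - f z"

lemma belowD: "below x z \<Longrightarrow> x \<in> X \<and> z \<in> X \<and> f z \<le> f x"
  unfolding below_def by (metis diff_ge_0_iff_ge zero_le_dist)

lemma below_refl: "x \<in> X \<Longrightarrow> below x x"
  by (simp add: below_def)

lemma below_p: "x \<in> X \<Longrightarrow> below x p"
  by (simp add: below_def p_in dist_commute)

lemma belowI: "\<lbrakk>x \<in> X; z \<in> X; dist x z \<le> f x - f z\<rbrakk> \<Longrightarrow> below x z"
  using abs_f_diff[of x z] by (simp add: below_def)

lemma below_trans: "below x y \<Longrightarrow> below y z \<Longrightarrow> below x z"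
  using dist_triangle[of x z y] by (intro belowI) (auto simp: below_def)

lemma below_level_unique: "below x z \<Longrightarrow> f x = f z \<Longrightarrow> x = z"
  by (simp add: below_def)

lemma geodesic:
  assumes "x \<in> X" "y \<in> X"
  obtains g where "path g" "path_image g \<subseteq> X" "pathstart g = x" "pathfinish g = y"
    "\<And>s t. \<lbrakk>0 \<le> s; s \<le> t; t \<le> 1\<rbrakk> \<Longrightarrow> dist x (g s) + dist (g s) (g t) + dist (g t) y \<le> dist x y"
proof -
  obtain g where g: "path g" "path_image g \<subseteq> X" "pathstart g = x" "pathfinish g = y"
    "path_length g = ereal (dist x y)"
    using geodesic_X assms unfolding geodesic_space_def by metis
  show thesis
    using path_length_triple[of _ _ g] g
    by (intro that[of g]) (auto simp: pathstart_def pathfinish_def)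
qed

lemma geodesic_in_ball:
  assumes "x \<in> X" "y \<in> X"
  obtains g where "path g" "path_image g \<subseteq> X \<inter> cball x (dist x y)" "pathstart g = x" "pathfinish g = y"
proof -
  obtain g where g: "path g" "path_image g \<subseteq> X" "pathstart g = x" "pathfinish g = y"
    "\<And>s t. \<lbrakk>0 \<le> s; s \<le> t; t \<le> 1\<rbrakk> \<Longrightarrow> dist x (g s) + dist (g s) (g t) + dist (g t) y \<le> dist x y"
    using geodesic[OF assms] by blast
  have "dist x (g s) \<le> dist x y" if "0 \<le> s" "s \<le> 1" for s
    using g(5)[of s s] that by (smt (verit) zero_le_dist)
  then show thesis
    using g(1-4) by (intro that[of g]) (auto simp: path_image_def)
qed

lemma below_between:
  assumes "below x z" "f z \<le> r" "r \<le> f x"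
  obtains w where "below x w" "below w z" "f w = r"
proof -
  have xz: "x \<in> X" "z \<in> X" and d: "dist x z = f x - f z"
    using assms by (auto simp: below_def)
  obtain g where g: "path g" "path_image g \<subseteq> X" "pathstart g = x" "pathfinish g = z"
    "\<And>s t. \<lbrakk>0 \<le> s; s \<le> t; t \<le> 1\<rbrakk> \<Longrightarrow> dist x (g s) + dist (g s) (g t) + dist (g t) z \<le> dist x z"
    using geodesic[OF xz] by blast
  have "continuous_on {0..1} (\<lambda>t. f (g t))"
    using g(1) unfolding path_def by (intro continuous_intros)
  then obtain t where t: "0 \<le> t" "t \<le> 1" "f (g t) = r"
    using IVT2'[of "\<lambda>t. f (g t)" 1 r 0] g(3,4) assms by (auto simp: pathstart_def pathfinish_def)
  have "g t \<in> X"
    using g(2) t by (auto simp: path_image_def)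
  moreover have "dist x (g t) + dist (g t) z \<le> dist x z"
    using g(5)[of t t] t by simp
  ultimately show thesis
    using xz d t abs_f_diff[of x "g t"] abs_f_diff[of "g t" z]
    by (intro that[of "g t"] belowI) auto
qed

text \<open>A geodesic from \<open>x\<close> through \<open>z\<close> to \<open>p\<close>,
  parametrized by level. A path whose length is the distance of its ends may pause, so some
  parameter is chosen for every level; the choice does not matter, since comparable points of equal
  level coincide.\<close>

lemma ray:
  assumes "below x z"
  obtains D where "\<And>l. \<lbrakk>0 \<le> l; l \<le> f x\<rbrakk> \<Longrightarrow> D l \<in> X \<and> f (D l) = l \<and> below x (D l)"
    "\<And>l l'. \<lbrakk>0 \<le> l; l \<le> l'; l' \<le> f x\<rbrakk> \<Longrightarrow> below (D l') (D l)"
    "D (f x) = x" "D (f z) = z" "D 0 = p"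
proof -
  have seg: "\<exists>D. D (f y) = y \<and> D (f w) = w \<and> (\<forall>l\<in>{f w..f y}. f (D l) = l) \<and>
      (\<forall>l l'. f w \<le> l \<and> l \<le> l' \<and> l' \<le> f y \<longrightarrow> below (D l') (D l))" if yw: "below y w" for y w
  proof -
    have X: "y \<in> X" "w \<in> X" and d: "dist y w = f y - f w"
      using yw by (auto simp: below_def)
    obtain g where g: "path g" "path_image g \<subseteq> X" "pathstart g = y" "pathfinish g = w"
      "\<And>s t. \<lbrakk>0 \<le> s; s \<le> t; t \<le> 1\<rbrakk> \<Longrightarrow> dist y (g s) + dist (g s) (g t) + dist (g t) w \<le> dist y w"
      using geodesic[OF X] by blast
    have gX: "g t \<in> X" if "0 \<le> t" "t \<le> 1" for t
      using g(2) that by (auto simp: path_image_def)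
    have gb: "below (g s) (g t)" if "0 \<le> s" "s \<le> t" "t \<le> 1" for s t
      using that g(5)[OF that] d abs_f_diff[of y "g s"] abs_f_diff[of "g t" w]
      by (intro belowI gX) auto
    have cont: "continuous_on {0..1} (\<lambda>t. f (g t))"
      using g(1) unfolding path_def by (intro continuous_intros)
    have "\<exists>t. 0 \<le> t \<and> t \<le> 1 \<and> f (g t) = l" if "f w \<le> l" "l \<le> f y" for l
      using IVT2'[OF _ _ _ cont, of l] g(3,4) that by (auto simp: pathstart_def pathfinish_def)
    then obtain T where T: "0 \<le> T l" "T l \<le> 1" "f (g (T l)) = l" if "f w \<le> l" "l \<le> f y" for l
      by metis
    have le: "f w \<le> f y"
      using belowD[OF yw] by simp
    have mono: "below (g (T l')) (g (T l))" if "f w \<le> l" "l \<le> l'" "l' \<le> f y" for l l'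
    proof (cases "T l' \<le> T l")
      case True
      then show ?thesis
        using that T[of l] T[of l'] by (intro gb) auto
    next
      case False
      then have "below (g (T l)) (g (T l'))"
        using that T[of l] T[of l'] by (intro gb) auto
      moreover have "f (g (T l)) \<le> f (g (T l'))"
        using that T[of l] T[of l'] by simp
      ultimately show ?thesis
        using belowD[of "g (T l)" "g (T l')"] below_level_unique[of "g (T l)" "g (T l')"]
        by (metis order_antisym)
    qed
    have "g (T (f y)) = y"
      using gb[of 0 "T (f y)"] T[of "f y"] le below_level_unique[of y "g (T (f y))"] g(3)
      by (simp add: pathstart_def)
    moreover have "g (T (f w)) = w"
      using gb[of "T (f w)" 1] T[of "f w"] le below_level_unique[of "g (T (f w))" w] g(4)
      by (simp add: pathfinish_def)
    ultimately show ?thesis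
      using mono T by (intro exI[of _ "g \<circ> T"]) auto
  qed
  obtain D1 where D1: "D1 (f x) = x" "D1 (f z) = z" "\<And>l. f z \<le> l \<Longrightarrow> l \<le> f x \<Longrightarrow> f (D1 l) = l"
     "\<And>l l'. \<lbrakk>f z \<le> l; l \<le> l'; l' \<le> f x\<rbrakk> \<Longrightarrow> below (D1 l') (D1 l)"
    using seg[OF assms] by auto
  have zX: "z \<in> X" "f z \<le> f x"
    using belowD[OF assms] by auto
  obtain D2 where D2: "D2 (f z) = z" "D2 0 = p" "\<And>l. 0 \<le> l \<Longrightarrow> l \<le> f z \<Longrightarrow> f (D2 l) = l"
     "\<And>l l'. \<lbrakk>0 \<le> l; l \<le> l'; l' \<le> f z\<rbrakk> \<Longrightarrow> below (D2 l') (D2 l)"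
    using seg[OF below_p[OF zX(1)]] by auto
  define D where "D l = (if l \<le> f z then D2 l else D1 l)" for l
  have fD: "f (D l) = l" if "0 \<le> l" "l \<le> f x" for l
    using that D1(3)[of l] D2(3)[of l] by (auto simp: D_def)
  have mono: "below (D l') (D l)" if l: "0 \<le> l" "l \<le> l'" "l' \<le> f x" for l l'
  proof -
    consider "l' \<le> f z" | "f z < l" | "l \<le> f z" "f z < l'"
      by linarith
    then show ?thesis
    proof cases
      case 3
      then have "below (D1 l') z" "below z (D2 l)"
        using l D1(4)[of "f z" l'] D2(4)[of l "f z"] D1(2) D2(1) by auto
      then show ?thesis
        using 3 below_trans by (auto simp: D_def)
    qed (use l D1(4) D2(4) in \<open>auto simp: D_def\<close>)
  qed
  have Dx: "D (f x) = x"
  proof (cases "f x \<le> f z")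
    case True
    then have "f x = f z"
      using zX(2) by simp
    then have "D (f x) = z" "x = z"
      using D2(1) below_level_unique[OF assms] by (simp_all add: D_def)
    then show ?thesis by simp
  qed (simp add: D_def D1(1))
  show thesis
  proof (rule that[of D])
    show "D l \<in> X \<and> f (D l) = l \<and> below x (D l)" if "0 \<le> l" "l \<le> f x" for l
      using fD[OF that] mono[OF that order_refl] that Dx by (auto simp: below_def)
    show "D (f x) = x" "D (f z) = z" "D 0 = p"
      using Dx D2(1,2) by (auto simp: D_def)
  qed (rule mono)
qed

text \<open>Along a descent, distance equals difference of levels, so the parametrization by level
  is an isometric embedding.\<close>

lemma ray_continuous:
  assumes "\<And>l l'. \<lbrakk>0 \<le> l; l \<le> l'; l' \<le> r\<rbrakk> \<Longrightarrow> below (D l') (D l)"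
    "\<And>l. \<lbrakk>0 \<le> l; l \<le> r\<rbrakk> \<Longrightarrow> f (D l) = l"
  shows "continuous_on {0..r} D"
proof -
  have "dist (D l) (D l') = dist l l'" if "l \<in> {0..r}" "l' \<in> {0..r}" for l l'
    using that assms(1)[of l l'] assms(1)[of l' l] assms(2)[of l] assms(2)[of l']
    by (cases "l \<le> l'") (auto simp: below_def dist_commute dist_real_def)
  then show ?thesis
    unfolding continuous_on_iff by (metis dist_commute)
qed

end

subsection \<open>Finite graphs\<close>

lemma (in wf_digraph) continuous_graph_point:
  assumes "e \<in> arcs G"
  shows "continuous_map (top_of_set {0..1}) (graph_realization G) (graph_point G e)"
  using assms
  by (auto simp: continuous_map_def openin_graph_realization topspace_graph_realization
      graph_point_def graph_points_def)

lemma (in wf_digraph) open_graph_point_image: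
  assumes "e \<in> arcs G" "0 \<le> a" "b \<le> 1"
  shows "openin (graph_realization G) (graph_point G e ` {a<..<b})"
  unfolding openin_graph_realization
proof (intro conjI ballI)
  show "graph_point G e ` {a<..<b} \<subseteq> graph_points G"
    using assms by (auto simp: graph_point_def graph_points_def)
  fix e' assume "e' \<in> arcs G"
  have "{t \<in> {0..1}. graph_point G e' t \<in> graph_point G e ` {a<..<b}} = (if e' = e then {a<..<b} else {})"
    using assms by (auto simp: graph_point_def image_iff split: if_splits)
  then show "openin (top_of_set {0..1}) {t \<in> {0..1}. graph_point G e' t \<in> graph_point G e ` {a<..<b}}"
    using assms by (auto intro!: open_subset)
qed

text \<open>The open edges are carried over by the homeomorphism: all but finitely many points lie
  on finitely many arcs whose subintervals are open. The finiteness of levels and of merging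
  contours rests on this description alone.\<close>

lemma finite_topological_graph_edges:
  assumes "finite_topological_graph T"
  obtains V and E :: "nat set" and \<psi> where "finite V" "finite E"
    "topspace T \<subseteq> V \<union> (\<Union>e\<in>E. \<psi> e ` {0<..<1::real})"
    "\<And>e. e \<in> E \<Longrightarrow> continuous_map (top_of_set {0<..<1}) T (\<psi> e)"
    "\<And>e. e \<in> E \<Longrightarrow> inj_on (\<psi> e) {0<..<1}"
    "\<And>e a b. \<lbrakk>e \<in> E; 0 \<le> a; b \<le> 1\<rbrakk> \<Longrightarrow> openin T (\<psi> e ` {a<..<b})"
proof -
  obtain G :: "(nat, nat) pre_digraph" and h k where "fin_digraph G"
    and hk: "homeomorphic_maps T (graph_realization G) h k"
    using assms unfolding finite_topological_graph_def homeomorphic_space_def by metis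
  interpret fin_digraph G by fact
  have kh: "k (h x) = x" if "x \<in> topspace T" for x
    using hk that by (simp add: homeomorphic_maps_def)
  have hT: "h x \<in> graph_points G" if "x \<in> topspace T" for x
    using hk that by (auto simp: homeomorphic_maps_def continuous_map_def topspace_graph_realization)
  have gp: "graph_point G e t \<in> graph_points G" if "e \<in> arcs G" "t \<in> {0<..<1}" for e t
    using that by (auto simp: graph_point_def graph_points_def)
  have k_inj: "inj_on k (graph_points G)"
    using hk unfolding homeomorphic_maps_def topspace_graph_realization by (metis inj_onI)
  have k_open: "openin T (k ` U)" if "openin (graph_realization G) U" for U
    using homeomorphic_maps_imp_map[OF homeomorphic_maps_sym[THEN iffD1, OF hk]] that
      homeomorphic_imp_open_map open_map_def by metis
  define \<psi> where "\<psi> e = k \<circ> graph_point G e" for e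
  show thesis
  proof (rule that[of "k ` Inl ` verts G" "arcs G" \<psi>])
    show "topspace T \<subseteq> k ` Inl ` verts G \<union> (\<Union>e\<in>arcs G. \<psi> e ` {0<..<1})"
    proof
      fix x assume x: "x \<in> topspace T"
      have "h x \<in> Inl ` verts G \<or> (\<exists>e\<in>arcs G. \<exists>t\<in>{0<..<1}. h x = graph_point G e t)"
        using hT[OF x] by (auto simp: graph_points_def graph_point_def)
      then show "x \<in> k ` Inl ` verts G \<union> (\<Union>e\<in>arcs G. \<psi> e ` {0<..<1})"
        using kh[OF x] by (auto simp: \<psi>_def image_iff) (metis greaterThanLessThan_iff)+
    qed
  next
    fix e assume e: "e \<in> arcs G"
    have "continuous_map (graph_realization G) T k"
      using hk by (simp add: homeomorphic_maps_def)
    then show "continuous_map (top_of_set {0<..<1}) T (\<psi> e)"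
      unfolding \<psi>_def
      by (rule continuous_map_compose[rotated])
        (rule continuous_map_from_subtopology_mono[OF continuous_graph_point[OF e]], auto)
    have "inj_on (graph_point G e) {0<..<1}"
      by (auto simp: inj_on_def graph_point_def)
    then show "inj_on (\<psi> e) {0<..<1}"
      unfolding \<psi>_def using gp[OF e] by (intro comp_inj_on inj_on_subset[OF k_inj]) auto
    fix a b :: real assume "0 \<le> a" "b \<le> 1"
    then show "openin T (\<psi> e ` {a<..<b})"
      using k_open[OF open_graph_point_image[OF e]] by (simp add: \<psi>_def image_comp)
  qed auto
qed

text \<open>Among five points of \<open>S\<close>, one element of \<open>K\<close> would lie below
  the third and another above it. \<open>K\<close> will be the set of local minima inside an edge,
  which has at most one element.\<close>

lemma finite_of_separating_point:
  fixes S :: "'b::linorder set"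
  assumes sep: "\<And>x y z. \<lbrakk>x \<in> S; y \<in> S; z \<in> S; x < y; y < z\<rbrakk> \<Longrightarrow> \<exists>k\<in>K. x < k \<and> k < z"
    and K: "\<And>k k'. k \<in> K \<Longrightarrow> k' \<in> K \<Longrightarrow> k = k'"
  shows "finite S"
proof (rule ccontr)
  assume "infinite S"
  then obtain B where B: "finite B" "card B = 5" "B \<subseteq> S"
    using infinite_arbitrarily_large by metis
  define l where "l = sorted_list_of_set B"
  have len: "length l = 5" and set: "set l \<subseteq> S" and "sorted_wrt (<) l"
    using B by (simp_all add: l_def)
  then have less: "l ! i < l ! j" if "i < j" "j < 5" for i j
    using that by (auto simp: sorted_wrt_iff_nth_less)
  have mem: "l ! i \<in> S" if "i < 5" for i
    using that len set by (auto simp: subset_eq)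
  obtain k where k: "k \<in> K" "k < l ! 2"
    using sep[of "l ! 0" "l ! 1" "l ! 2"] less[of 0 1] less[of 1 2] mem[of 0] mem[of 1] mem[of 2] by auto
  obtain k' where k': "k' \<in> K" "l ! 2 < k'"
    using sep[of "l ! 2" "l ! 3" "l ! 4"] less[of 2 3] less[of 3 4] mem[of 2] mem[of 3] mem[of 4] by auto
  show False
    using K[OF k(1) k'(1)] k(2) k'(2) by auto
qed

section \<open>Descents near a contour and inside an edge of the Reeb graph\<close>

context geodesic_reeb
begin

text \<open>A contour is compact, so an open set of \<open>X\<close> containing it contains a
  uniform neighbourhood of it. In this way openness in the quotient becomes a metric
  statement.\<close>

lemma contour_nbhd:
  assumes "C \<in> \<C>" "openin R U" "C \<in> U"
  obtains \<epsilon> where "0 < \<epsilon>" "\<And>x y. \<lbrakk>x \<in> C; y \<in> X; dist x y < \<epsilon>\<rbrakk> \<Longrightarrow> \<phi> y \<in> U"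
proof -
  obtain T where T: "open T" "{x \<in> X. \<phi> x \<in> U} = X \<inter> T"
    using assms(2) by (auto simp: openin_R openin_open)
  have "C \<subseteq> T"
    using assms contour_mem T(2) by blast
  then obtain \<epsilon> where eps: "\<epsilon> > 0" "(\<Union>x\<in>C. ball x \<epsilon>) \<subseteq> T"
    using compact_subset_open_imp_ball_epsilon_subset contour_compact[OF assms(1)] T(1) by metis
  show thesis
  proof (rule that[OF eps(1)])
    fix x y assume "x \<in> C" "y \<in> X" "dist x y < \<epsilon>"
    then have "y \<in> {x \<in> X. \<phi> x \<in> U}"
      using eps(2) T(2) by (metis Int_iff UN_I mem_ball subsetD)
    then show "\<phi> y \<in> U"
      by simp
  qed
qed

text \<open>
  In graph terms: at least two edges of the Reeb graph descend from \<open>C\<close>.  Only the levels just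
  below \<open>C\<close> matter, since a descent may also branch further down.
\<close>

definition merging :: "'a set \<Rightarrow> bool" where
  "merging C \<longleftrightarrow> C \<in> \<C> \<and> (\<forall>r<lev C. \<exists>x\<in>C. \<exists>y\<in>C. \<exists>z w. below x z \<and> below y w \<and>
     f z = f w \<and> r \<le> f z \<and> f z < lev C \<and> \<phi> z \<noteq> \<phi> w)"

text \<open>A point away from \<open>p\<close> has a short geodesic descent, which stays in the open
  edge and ends at a strictly lower level.\<close>

lemma edge_no_local_min:
  assumes op: "\<And>a b. \<lbrakk>0 \<le> a; b \<le> 1\<rbrakk> \<Longrightarrow> openin R (\<psi> ` {a<..<b::real})"
    and t: "0 \<le> a" "a < t" "t < b" "b \<le> 1" and ne: "\<psi> t \<noteq> \<phi> p"
  shows "\<exists>s\<in>{a<..<b}. lev (\<psi> s) < lev (\<psi> t)"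
proof -
  have U: "openin R (\<psi> ` {a<..<b})"
    using t by (intro op) auto
  have C: "\<psi> t \<in> \<C>"
    using openin_subset[OF U] t by auto
  obtain x where x: "x \<in> \<psi> t"
    using contour_nonempty[OF C] by blast
  have xX: "x \<in> X" "\<phi> x = \<psi> t" "f x = lev (\<psi> t)"
    using contour_mem[OF C x] by auto
  have "x \<noteq> p"
    using ne xX(2) by metis
  then have fx: "0 < f x"
    by simp
  have tU: "\<psi> t \<in> \<psi> ` {a<..<b}"
    using t by simp
  obtain \<epsilon> where eps: "0 < \<epsilon>" "\<And>x y. \<lbrakk>x \<in> \<psi> t; y \<in> X; dist x y < \<epsilon>\<rbrakk> \<Longrightarrow> \<phi> y \<in> \<psi> ` {a<..<b}"
    using contour_nbhd[OF C U tU] by metis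
  define r where "r = max 0 (f x - \<epsilon> / 2)"
  have r: "0 \<le> r" "r < f x" "f x - r < \<epsilon>"
    using fx eps(1) by (auto simp: r_def)
  obtain w where w: "below x w" "f w = r"
    using below_between[OF below_p[OF xX(1)], of r] r by auto
  then have "dist x w < \<epsilon>" "w \<in> X"
    using r by (auto simp: below_def)
  then have "\<phi> w \<in> \<psi> ` {a<..<b}"
    by (intro eps(2)[OF x])
  then obtain s where s: "s \<in> {a<..<b}" "\<phi> w = \<psi> s"
    by (rule imageE)
  have "lev (\<psi> s) < lev (\<psi> t)"
    using lev_phi[OF \<open>w \<in> X\<close>] w(2) r(2) xX(3) s(2) by simp
  then show ?thesis
    using s(1) by blast
qed

text \<open>The ray from \<open>y\<close> to \<open>w\<close> projects to a connected subset of the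
  edge that contains \<open>\<psi> t\<close> and \<open>\<psi> s'\<close>, hence also
  \<open>\<psi> s\<close> in between. Levels fall strictly along the ray, so the level
  \<open>f w\<close> occurs on it only at \<open>w\<close>, which lies over \<open>\<psi> s'\<close>
  and not over \<open>\<psi> s\<close>.\<close>

lemma edge_same_side:
  assumes op: "\<And>a b. \<lbrakk>0 \<le> a; b \<le> 1\<rbrakk> \<Longrightarrow> openin R (\<psi> ` {a<..<b::real})"
    and inj: "inj_on \<psi> {0<..<1}"
    and t: "0 \<le> a" "b \<le> 1" "t \<in> {a<..<b}" "s \<in> {a<..<b}" "s' \<in> {a<..<b}"
    and yw: "below y w" "\<phi> y = \<psi> t" "\<phi> w = \<psi> s'"
    and stay: "\<And>u. \<lbrakk>below y u; f w \<le> f u\<rbrakk> \<Longrightarrow> \<phi> u \<in> \<psi> ` {a<..<b}"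
    and s: "t < s \<and> s < s' \<or> s' < s \<and> s < t"
  shows "lev (\<psi> s) \<noteq> f w"
proof
  assume lev: "lev (\<psi> s) = f w"
  have w: "w \<in> X" "y \<in> X" "f w \<le> f y"
    using belowD[OF yw(1)] by auto
  obtain D where D: "\<And>l. \<lbrakk>0 \<le> l; l \<le> f y\<rbrakk> \<Longrightarrow> D l \<in> X \<and> f (D l) = l \<and> below y (D l)"
    "\<And>l l'. \<lbrakk>0 \<le> l; l \<le> l'; l' \<le> f y\<rbrakk> \<Longrightarrow> below (D l') (D l)"
    "D (f y) = y" "D (f w) = w" "D 0 = p"
    using ray[OF yw(1)] by metis
  define K where "K = D ` {f w..f y}"
  have D0: "continuous_on {0..f y} D"
    using D(1,2) by (intro ray_continuous) auto
  have "{f w..f y} \<subseteq> {0..f y}"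
    by (rule atLeastatMost_subset_iff[THEN iffD2]) simp
  then have "continuous_on {f w..f y} D"
    by (rule continuous_on_subset[OF D0])
  then have "connected K"
    unfolding K_def by (rule connected_continuous_image) (rule connected_Icc)
  moreover have DX: "D l \<in> X \<and> f (D l) = l \<and> below y (D l)" if "f w \<le> l" "l \<le> f y" for l
    by (rule D(1)[OF order_trans[OF zero_le_dist that(1)] that(2)])
  then have KX: "K \<subseteq> X"
    by (auto simp: K_def)
  ultimately have con: "connectedin R (\<phi> ` K)"
    using connectedin_continuous_map_image[OF continuous_phi] by (simp add: connectedin_subtopology)
  define A where "A = \<psi> ` {a<..<s}"
  define B where "B = \<psi> ` {s<..<b}"
  have "openin R A" "openin R B"
    unfolding A_def B_def using t by (auto intro!: op)
  moreover have "\<phi> ` K \<subseteq> A \<union> B"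
  proof
    fix c assume "c \<in> \<phi> ` K"
    then obtain l where l: "f w \<le> l" "l \<le> f y" "c = \<phi> (D l)"
      by (auto simp: K_def)
    then have Dl: "D l \<in> X" "f (D l) = l" "below y (D l)"
      using DX[of l] by auto
    have "c \<in> \<psi> ` {a<..<b}"
      unfolding l(3) by (rule stay) (use Dl l in auto)
    then obtain u where u: "u \<in> {a<..<b}" "c = \<psi> u"
      by (elim imageE)
    have "u \<noteq> s"
    proof
      assume "u = s"
      then have "l = f w"
        using lev u l Dl lev_phi[OF Dl(1)] by simp
      then have "\<psi> s' = \<psi> s"
        using D(4) l u \<open>u = s\<close> yw(3) by simp
      then show False
        using inj_onD[OF inj, of s' s] t s by auto
    qed
    then show "c \<in> A \<union> B"
      using u by (auto simp: A_def B_def image_iff) (metis greaterThanLessThan_iff linorder_neqE_linordered_idom)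
  qed
  moreover have "A \<inter> B = {}"
  proof -
    have "{a<..<s} \<subseteq> {0<..<1}" "{s<..<b} \<subseteq> {0<..<1}" "{a<..<s} \<inter> {s<..<b} = {}"
      using t by auto
    then show ?thesis
      unfolding A_def B_def using inj_on_image_Int[OF inj, of "{a<..<s}" "{s<..<b}"] by simp
  qed
  moreover have "y \<in> K" "w \<in> K"
    using w(3) imageI[of "f y" "{f w..f y}" D] imageI[of "f w" "{f w..f y}" D] D(3,4) by (simp_all add: K_def)
  then have "\<psi> t \<in> \<phi> ` K" "\<psi> s' \<in> \<phi> ` K"
    unfolding yw(2,3)[symmetric] by (simp_all only: imageI)
  moreover have "\<psi> t \<in> A \<and> \<psi> s' \<in> B \<or> \<psi> t \<in> B \<and> \<psi> s' \<in> A"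
    using s t by (auto simp: A_def B_def)
  ultimately have "openin R A" "openin R B" "\<phi> ` K \<subseteq> A \<union> B" "A \<inter> B \<inter> \<phi> ` K = {}"
    "A \<inter> \<phi> ` K \<noteq> {}" "B \<inter> \<phi> ` K \<noteq> {}"
    by blast+
  then show False
    using con unfolding connectedin by blast
qed

text \<open>Two descents from \<open>\<psi> t\<close> that end in different contours of one level
  must leave on opposite sides: on the same side, the farther one would pass the end of the nearer
  one, against \<open>edge_same_side\<close>.\<close>

lemma edge_merging:
  assumes op: "\<And>a b. \<lbrakk>0 \<le> a; b \<le> 1\<rbrakk> \<Longrightarrow> openin R (\<psi> ` {a<..<b::real})"
    and inj: "inj_on \<psi> {0<..<1}"
    and t: "0 \<le> a" "a < t" "t < b" "b \<le> 1" and merg: "merging (\<psi> t)"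
  shows "(\<exists>s\<in>{a<..<t}. lev (\<psi> s) < lev (\<psi> t)) \<and> (\<exists>s\<in>{t<..<b}. lev (\<psi> s) < lev (\<psi> t))"
proof -
  define C where "C = \<psi> t"
  have U: "openin R (\<psi> ` {a<..<b})"
    using t by (intro op) auto
  have C: "C \<in> \<C>"
    using merg by (simp add: merging_def C_def)
  have tU: "C \<in> \<psi> ` {a<..<b}"
    using t by (simp add: C_def)
  obtain \<epsilon> where eps: "0 < \<epsilon>" "\<And>x y. \<lbrakk>x \<in> C; y \<in> X; dist x y < \<epsilon>\<rbrakk> \<Longrightarrow> \<phi> y \<in> \<psi> ` {a<..<b}"
    using contour_nbhd[OF C U tU] by metis
  \<comment> \<open>Descents that stop above this level remain within \<epsilon> of
    \<open>C\<close>, hence project into the edge.\<close>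
  have "lev C - \<epsilon> / 2 < lev C"
    using eps(1) by simp
  then obtain x y z w where xy: "x \<in> C" "y \<in> C" "below x z" "below y w" "f z = f w"
    "lev C - \<epsilon> / 2 \<le> f z" "f z < lev C" "\<phi> z \<noteq> \<phi> w"
    using merg unfolding merging_def C_def by metis
  have stay: "\<phi> u \<in> \<psi> ` {a<..<b}" if "v \<in> C" "below v u" "f z \<le> f u" for v u
    using eps(2)[OF that(1), of u] that contour_mem[OF C that(1)] xy eps(1) by (auto simp: below_def)
  obtain s1 where s1: "s1 \<in> {a<..<b}" "\<phi> z = \<psi> s1"
    using stay[OF xy(1,3) order_refl] by (elim imageE)
  obtain s2 where s2: "s2 \<in> {a<..<b}" "\<phi> w = \<psi> s2"
    using stay[OF xy(2,4) eq_refl[OF xy(5)]] by (elim imageE)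
  have zw: "z \<in> X" "w \<in> X"
    using belowD xy by auto
  have lev: "lev (\<psi> s1) = f z" "lev (\<psi> s2) = f z"
    using lev_phi[OF zw(1)] lev_phi[OF zw(2)] s1 s2 xy by auto
  have "\<not> (t < s1 \<and> s1 < s2 \<or> s2 < s1 \<and> s1 < t)"
    using edge_same_side[OF op inj t(1,4) _ s1(1) s2(1) xy(4) _ s2(2)] lev xy t stay contour_mem[OF C]
    by (auto simp: C_def)
  moreover have "\<not> (t < s2 \<and> s2 < s1 \<or> s1 < s2 \<and> s2 < t)"
    using edge_same_side[OF op inj t(1,4) _ s2(1) s1(1) xy(3) _ s1(2)] lev xy t stay contour_mem[OF C]
    by (auto simp: C_def)
  moreover have "s1 \<noteq> s2" "s1 \<noteq> t" "s2 \<noteq> t"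
    using xy s1 s2 lev by (auto simp: C_def)
  ultimately have "s1 < t \<and> t < s2 \<or> s2 < t \<and> t < s1"
    by linarith
  moreover have "lev (\<psi> s1) < lev (\<psi> t)" "lev (\<psi> s2) < lev (\<psi> t)"
    using lev xy(7) by (simp_all add: C_def)
  ultimately show ?thesis
    using s1(1) s2(1) by (meson greaterThanLessThan_iff)
qed

end

section \<open>Finiteness of levels and merging contours\<close>

lemma interior_min:
  fixes g :: "real \<Rightarrow> real"
  assumes "continuous_on {u..v} g" "m \<in> {u..v}" "g m < g u" "g m < g v"
  obtains k where "u < k" "k < v" "\<And>t. t \<in> {u<..<v} \<Longrightarrow> g k \<le> g t"
proof -
  obtain k where k: "k \<in> {u..v}" "\<forall>t\<in>{u..v}. g k \<le> g t"
    using continuous_attains_inf[OF compact_Icc _ assms(1)] assms(2) by fastforce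
  then have "g k \<le> g m"
    using assms(2) by blast
  then have "k \<noteq> u" "k \<noteq> v"
    using assms by auto
  then show thesis
    using k by (intro that[of k]) auto
qed

locale finite_geodesic_reeb = geodesic_reeb +
  assumes finite_graph: "finite_topological_graph (reeb_graph X (dist p))"
begin

text \<open>Every local minimum inside an edge is the contour of \<open>p\<close>, and
  \<open>\<psi> e\<close> is injective, so there is at most one. Three points of equal level, or
  three merging points, would force one strictly between the outer two;
  \<open>finite_of_separating_point\<close> concludes.\<close>

lemma finite_level_and_merging: "finite {C \<in> \<C>. lev C = r}" "finite {C. merging C}"
proof -
  obtain V and E :: "nat set" and \<psi> where V: "finite V" and E: "finite E"
    and cover: "topspace R \<subseteq> V \<union> (\<Union>e\<in>E. \<psi> e ` {0<..<1::real})"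
    and cont: "\<And>e. e \<in> E \<Longrightarrow> continuous_map (top_of_set {0<..<1}) R (\<psi> e)"
    and inj: "\<And>e. e \<in> E \<Longrightarrow> inj_on (\<psi> e) {0<..<1}"
    and op: "\<And>e a b. \<lbrakk>e \<in> E; 0 \<le> a; b \<le> 1\<rbrakk> \<Longrightarrow> openin R (\<psi> e ` {a<..<b})"
    using finite_topological_graph_edges[OF finite_graph] by metis
  have "finite {t \<in> {0<..<1}. lev (\<psi> e t) = r} \<and> finite {t \<in> {0<..<1}. merging (\<psi> e t)}"
    if e: "e \<in> E" for e
  proof -
    define g where "g t = lev (\<psi> e t)" for t
    have "continuous_map (top_of_set {0<..<1}) euclideanreal (lev \<circ> \<psi> e)"
      using cont[OF e] continuous_lev by (rule continuous_map_compose)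
    then have g: "continuous_on {0<..<1} g"
      by (simp add: g_def comp_def)
    define K where "K = {k. \<exists>a b. 0 \<le> a \<and> a < k \<and> k < b \<and> b \<le> 1 \<and> (\<forall>t\<in>{a<..<b}. g k \<le> g t)}"
    have "\<psi> e k = \<phi> p \<and> k \<in> {0<..<1}" if k: "k \<in> K" for k
    proof -
      obtain a b where ab: "0 \<le> a" "a < k" "k < b" "b \<le> 1" "\<forall>t\<in>{a<..<b}. g k \<le> g t"
        using k unfolding K_def by blast
      then show ?thesis
        using edge_no_local_min[OF op[OF e] ab(1-4)] unfolding g_def by force
    qed
    then have K1: "k = k'" if "k \<in> K" "k' \<in> K" for k k'
      using inj_onD[OF inj[OF e]] that by metis
    have intK: "\<exists>k\<in>K. u < k \<and> k < v"
      if uv: "0 < u" "v < 1" "m \<in> {u..v}" "g m < g u" "g m < g v" for u v m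
    proof -
      have "continuous_on {u..v} g"
        using uv by (intro continuous_on_subset[OF g]) auto
      then obtain k where "u < k" "k < v" "\<And>t. t \<in> {u<..<v} \<Longrightarrow> g k \<le> g t"
        using interior_min uv(3-5) by metis
      then show ?thesis
        unfolding K_def using uv(1,2) less_imp_le by blast
    qed
    have "finite {t \<in> {0<..<1}. g t = r}"
    proof (rule finite_of_separating_point[OF _ K1])
      fix x y z assume xyz: "x \<in> {t \<in> {0<..<1}. g t = r}" "y \<in> {t \<in> {0<..<1}. g t = r}"
        "z \<in> {t \<in> {0<..<1}. g t = r}" "x < y" "y < z"
      \<comment> \<open>Either the function dips below the common level between two neighbours and
        has an interior minimum there, or \<open>y\<close> itself is a local minimum.\<close>
      consider m where "m \<in> {x..y}" "g m < r" | m where "m \<in> {y..z}" "g m < r" | "\<forall>m\<in>{x<..<z}. r \<le> g m"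
        by (metis atLeastAtMost_iff greaterThanLessThan_iff linorder_not_le nle_le)
      then show "\<exists>k\<in>K. x < k \<and> k < z"
      proof cases
        case (1 m)
        then show ?thesis
          using intK[of x y m] xyz by (auto intro: less_trans)
      next
        case (2 m)
        then show ?thesis
          using intK[of y z m] xyz by (auto intro: less_trans)
      next
        case 3
        have "0 \<le> x \<and> x < y \<and> y < z \<and> z \<le> 1 \<and> (\<forall>t\<in>{x<..<z}. g y \<le> g t)"
          using 3 xyz by auto
        then have "y \<in> K"
          unfolding K_def by blast
        then show ?thesis
          using xyz by blast
      qed
    qed
    moreover have "finite {t \<in> {0<..<1}. merging (\<psi> e t)}"
    proof (rule finite_of_separating_point[OF _ K1])
      fix x y z assume xyz: "x \<in> {t \<in> {0<..<1}. merging (\<psi> e t)}" "y \<in> {t \<in> {0<..<1}. merging (\<psi> e t)}"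
        "z \<in> {t \<in> {0<..<1}. merging (\<psi> e t)}" "x < y" "y < z"
      have "\<exists>s\<in>{x<..<z}. g s < g x"
        using edge_merging[OF op[OF e] inj[OF e], of 0 x z] xyz by (auto simp: g_def)
      moreover have "\<exists>s\<in>{x<..<z}. g s < g z"
        using edge_merging[OF op[OF e] inj[OF e], of x z 1] xyz by (auto simp: g_def)
      \<comment> \<open>Of the two times found, the one with the smaller value lies below both
        \<open>g x\<close> and \<open>g z\<close>.\<close>
      ultimately have "\<exists>m\<in>{x..z}. g m < g x \<and> g m < g z"
        by (metis atLeastAtMost_iff greaterThanLessThan_iff less_imp_le linorder_le_less_linear order.strict_trans1)
      then show "\<exists>k\<in>K. x < k \<and> k < z"
        using intK[of x z] xyz by auto
    qed
    ultimately show ?thesis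
      by (simp add: g_def)
  qed
  then have fin: "finite (V \<union> (\<Union>e\<in>E. \<psi> e ` {t \<in> {0<..<1}. lev (\<psi> e t) = r}))"
    "finite (V \<union> (\<Union>e\<in>E. \<psi> e ` {t \<in> {0<..<1}. merging (\<psi> e t)}))"
    using V E by auto
  show "finite {C \<in> \<C>. lev C = r}"
    by (rule finite_subset[OF _ fin(1)]) (use cover in fastforce)
  show "finite {C. merging C}"
    by (rule finite_subset[OF _ fin(2)]) (use cover in \<open>fastforce simp: merging_def\<close>)
qed

text \<open>Finitely many contours share the level of \<open>C\<close>, so the others form a closed
  set \<open>L\<close> at positive distance from \<open>C\<close>. Outside disjoint neighbourhoods
  of \<open>C\<close> and \<open>L\<close>, compactness bounds the level away from
  \<open>lev C\<close>; a contour in the resulting slab is connected and lies in one of the two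
  neighbourhoods.\<close>

lemma contour_isolated:
  assumes "C \<in> \<C>"
  obtains \<epsilon> U V where "0 < \<epsilon>" "openin R U" "openin R V" "U \<inter> V = {}" "C \<in> U"
    "\<And>B. \<lbrakk>B \<in> \<C>; \<bar>lev B - lev C\<bar> < \<epsilon>\<rbrakk> \<Longrightarrow> B \<in> U \<union> V"
    "\<And>B. \<lbrakk>B \<in> U; lev B = lev C\<rbrakk> \<Longrightarrow> B = C"
proof -
  define L where "L = \<Union>{B \<in> \<C>. lev B = lev C \<and> B \<noteq> C}"
  have finL: "finite {B \<in> \<C>. lev B = lev C \<and> B \<noteq> C}"
    by (rule finite_subset[OF _ finite_level_and_merging(1)[of "lev C"]]) auto
  have cL: "closed L"
    unfolding L_def using finL contour_closed by (intro closed_Union) auto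
  have CL: "C \<inter> L = {}"
    unfolding L_def using contour_mem assms by blast
  obtain d where "d > 0" "(\<Union>x\<in>C. ball x d) \<subseteq> - L"
    using compact_subset_open_imp_ball_epsilon_subset[OF contour_compact[OF assms], of "- L"] cL CL
    by auto
  then have d: "d > 0" "\<forall>x\<in>C. \<forall>y\<in>L. d \<le> dist x y"
    by (force simp: subset_eq)+
  define A where "A = (\<Union>x\<in>C. ball x (d / 2))"
  define B where "B = (\<Union>x\<in>L. ball x (d / 2))"
  have AB: "open A" "open B" "C \<subseteq> A" "L \<subseteq> B"
    using d(1) by (auto simp: A_def B_def)
  have disj: "A \<inter> B = {}"
  proof -
    have False if "x \<in> C" "y \<in> L" "dist x z < d / 2" "dist y z < d / 2" for x y z
      using d(2) that dist_triangle_half_r[of z x d y] by (force simp: dist_commute)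
    then show ?thesis
      by (force simp: A_def B_def)
  qed
  obtain \<epsilon> where eps: "\<epsilon> > 0" "\<And>x. \<lbrakk>x \<in> X; \<bar>f x - lev C\<bar> < \<epsilon>\<rbrakk> \<Longrightarrow> x \<in> A \<union> B"
  proof (cases "X - (A \<union> B) = {}")
    case True
    then show thesis
      by (intro that[of 1]) auto
  next
    case False
    have "compact (X - (A \<union> B))"
      using compact_X AB by (intro compact_diff) auto
    moreover have "continuous_on (X - (A \<union> B)) (\<lambda>x. \<bar>f x - lev C\<bar>)"
      by (intro continuous_intros)
    ultimately obtain y where y: "y \<in> X - (A \<union> B)"
      "\<forall>x\<in>X - (A \<union> B). \<bar>f y - lev C\<bar> \<le> \<bar>f x - lev C\<bar>"
      using continuous_attains_inf[OF _ False] by blast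
    have "f y \<noteq> lev C"
    proof
      assume *: "f y = lev C"
      have "y \<in> \<phi> y" "\<phi> y \<in> \<C>" "lev (\<phi> y) = lev C"
        using y(1) * by (auto simp: phi_self phi_in lev_phi)
      then have "y \<in> C \<union> L"
        unfolding L_def by blast
      then show False
        using y(1) AB by blast
    qed
    then show thesis
      using y(2) by (intro that[of "\<bar>f y - lev C\<bar>"]) force+
  qed
  define slab where "slab = {x \<in> X. \<bar>f x - lev C\<bar> < \<epsilon>}"
  have slab_open: "openin (top_of_set X) (slab \<inter> T)" if "open T" for T
  proof -
    have "openin (top_of_set X) (X \<inter> (\<lambda>x. \<bar>f x - lev C\<bar>) -` {..<\<epsilon>})"
      by (intro continuous_openin_preimage_gen continuous_intros)
    then have "openin (top_of_set X) ((X \<inter> (\<lambda>x. \<bar>f x - lev C\<bar>) -` {..<\<epsilon>}) \<inter> (X \<inter> T))"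
      by (rule openin_Int[OF _ openin_open_Int[OF that]])
    then show ?thesis
      by (rule back_subst) (auto simp: slab_def)
  qed
  have side: "\<phi> x \<subseteq> T" if T: "T = A \<or> T = B" and x: "x \<in> slab \<inter> T" for x T
  proof -
    have xX: "x \<in> X"
      using x by (simp add: slab_def)
    have "\<phi> x \<subseteq> slab"
      using x phi_subset by (auto simp: slab_def)
    then have "\<phi> x \<subseteq> A \<union> B"
      using eps(2) by (auto simp: slab_def)
    then have "A \<inter> \<phi> x = {} \<or> B \<inter> \<phi> x = {}"
      using connectedD[OF contour_connected[OF phi_in[OF xX]] AB(1,2)] disj by blast
    then show ?thesis
      using T x phi_self[OF xX] \<open>\<phi> x \<subseteq> A \<union> B\<close> by blast
  qed
  define S where "S T = {D \<in> \<C>. \<bar>lev D - lev C\<bar> < \<epsilon> \<and> D \<subseteq> T}" for T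
  have S_open: "openin R (S T)" if T: "T = A \<or> T = B" for T
    unfolding openin_R
  proof
    have "{x \<in> X. \<phi> x \<in> S T} = slab \<inter> T"
      using side[OF T] phi_self by (auto simp: S_def slab_def phi_in lev_phi)
    then show "openin (top_of_set X) {x \<in> X. \<phi> x \<in> S T}"
      using slab_open T AB by auto
  qed (auto simp: S_def)
  show thesis
  proof (rule that[of \<epsilon> "S A" "S B"])
    show "S A \<inter> S B = {}"
      using disj contour_nonempty by (fastforce simp: S_def)
    show "C \<in> S A"
      using AB eps(1) assms by (simp add: S_def)
    show "D \<in> S A \<union> S B" if D: "D \<in> \<C>" "\<bar>lev D - lev C\<bar> < \<epsilon>" for D
    proof -
      obtain x where x: "x \<in> D"
        using contour_nonempty D by blast
      then have "x \<in> slab" "\<phi> x = D"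
        using contour_mem[OF D(1) x] D by (auto simp: slab_def)
      moreover have "x \<in> A \<or> x \<in> B"
        using eps(2)[of x] \<open>x \<in> slab\<close> by (auto simp: slab_def)
      ultimately show ?thesis
        using side[of A x] side[of B x] D by (auto simp: S_def)
    qed
    show "D = C" if D: "D \<in> S A" "lev D = lev C" for D
    proof (rule ccontr)
      assume "D \<noteq> C"
      then have "D \<subseteq> L"
        using D by (auto simp: L_def S_def)
      moreover obtain x where "x \<in> D"
        using contour_nonempty D by (auto simp: S_def)
      ultimately show False
        using D(1) AB(3,4) disj unfolding S_def by blast
    qed
  qed (use eps(1) S_open in auto)
qed

text \<open>Contours of different levels are separated by \<open>lev\<close>, those of equal level
  by \<open>contour_isolated\<close>.\<close>

lemma Hausdorff_R: "Hausdorff_space R"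
  unfolding Hausdorff_space_def
proof (intro allI impI, elim conjE)
  fix C C' assume C: "C \<in> topspace R" "C' \<in> topspace R" "C \<noteq> C'"
  show "\<exists>U V. openin R U \<and> openin R V \<and> C \<in> U \<and> C' \<in> V \<and> disjnt U V"
  proof (cases "lev C = lev C'")
    case True
    obtain \<epsilon> U V where UV: "0 < \<epsilon>" "openin R U" "openin R V" "U \<inter> V = {}" "C \<in> U"
      "\<And>B. \<lbrakk>B \<in> \<C>; \<bar>lev B - lev C\<bar> < \<epsilon>\<rbrakk> \<Longrightarrow> B \<in> U \<union> V"
      "\<And>B. \<lbrakk>B \<in> U; lev B = lev C\<rbrakk> \<Longrightarrow> B = C"
      using contour_isolated[of C] C(1) unfolding topspace_R by metis
    have "C' \<in> U \<union> V"
      using UV(1,6) C True by auto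
    then have "C' \<in> V"
      using UV(7)[of C'] C(3) True by auto
    then show ?thesis
      using UV(2-5) by (auto simp: disjnt_def)
  next
    case False
    then obtain S T where ST: "open S" "open T" "lev C \<in> S" "lev C' \<in> T" "S \<inter> T = {}"
      using hausdorff by metis
    have op: "openin R {x \<in> topspace R. lev x \<in> W}" if "open W" for W
      using continuous_lev that by (auto simp: continuous_map_def)
    show ?thesis
      using C ST op[OF ST(1)] op[OF ST(2)]
      by (intro exI[of _ "{x \<in> topspace R. lev x \<in> S}"] exI[of _ "{x \<in> topspace R. lev x \<in> T}"])
        (auto simp: disjnt_def)
  qed
qed

lemma phi_limit:
  assumes "\<And>n::nat. u n \<in> X" "x \<in> X" "u \<longlonglongrightarrow> x"
  shows "limitin R (\<lambda>n. \<phi> (u n)) (\<phi> x) sequentially"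
proof -
  have "limitin (top_of_set X) u x sequentially"
    using assms by (simp add: limitin_subtopology)
  from continuous_map_limit[OF continuous_phi this] show ?thesis
    by (simp add: comp_def)
qed

text \<open>Limits in \<open>R\<close> are unique, so the relation of lying in one contour is
  closed.\<close>

lemma phi_limit_unique:
  assumes "\<And>n::nat. u n \<in> X" "\<And>n. v n \<in> X" "x \<in> X" "y \<in> X" "u \<longlonglongrightarrow> x" "v \<longlonglongrightarrow> y"
    "\<And>n. \<phi> (u n) = \<phi> (v n)"
  shows "\<phi> x = \<phi> y"
  using limitin_Hausdorff_unique[OF phi_limit[OF assms(1,3,5)] _ _ Hausdorff_R] phi_limit[OF assms(2,4,6)]
    assms(7) by simp

end

subsection \<open>Unique descent off the merging contours\<close>

lemma first_time_below:
  fixes h :: "real \<Rightarrow> real"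
  assumes h: "continuous_on {a..b} h" and "a \<le> b" "l \<le> h a" "h b \<le> l"
  obtains c where "a \<le> c" "c \<le> b" "h c = l" "\<And>t. \<lbrakk>a \<le> t; t \<le> c\<rbrakk> \<Longrightarrow> l \<le> h t"
proof -
  define S where "S = {t \<in> {a..b}. h t \<le> l}"
  have "S = {a..b} \<inter> h -` {..l}"
    by (auto simp: S_def)
  then have "closed S"
    using continuous_closed_preimage[OF h] by simp
  then have S: "Inf S \<in> S"
    using assms by (intro closed_contains_Inf) (auto simp: S_def intro!: bdd_belowI[of _ a])
  have le: "Inf S \<le> t" if "t \<in> S" for t
    using that by (intro cInf_lower) (auto simp: S_def intro!: bdd_belowI[of _ a])
  obtain t where t: "a \<le> t" "t \<le> Inf S" "h t = l"
    using IVT2'[of h "Inf S" l a] S assms(3) continuous_on_subset[OF h, of "{a..Inf S}"]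
    by (auto simp: S_def)
  then have eq: "t = Inf S"
    using le[of t] S by (auto simp: S_def)
  show thesis
  proof (rule that[of "Inf S"])
    show "l \<le> h u" if "a \<le> u" "u \<le> Inf S" for u
    proof (rule ccontr)
      assume "\<not> l \<le> h u"
      then have "u \<in> S"
        using that S by (auto simp: S_def)
      then have "u = Inf S"
        using le that by fastforce
      then show False
        using t(3) eq \<open>\<not> l \<le> h u\<close> by simp
    qed
  qed (use S t eq in \<open>auto simp: S_def\<close>)
qed

lemma sequence_from_above:
  fixes r c :: real
  assumes "r < c"
  obtains s :: "nat \<Rightarrow> real" where "\<And>n. r < s n" "\<And>n. s n \<le> c" "s \<longlonglongrightarrow> r"
proof -
  define s where "s n = r + (c - r) * inverse (real (Suc n))" for n
  have "(c - r) * inverse (real (Suc n)) \<le> c - r" for n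
    using assms by (intro mult_left_le) (auto simp: field_simps)
  then have "s n \<le> c" for n
    unfolding s_def by (metis add.commute diff_add_cancel add_le_cancel_right)
  moreover have "r < s n" for n
    using assms by (simp add: s_def)
  moreover have "s \<longlonglongrightarrow> r + (c - r) * 0"
    unfolding s_def by (intro tendsto_intros LIMSEQ_inverse_real_of_nat)
  ultimately show thesis
    using that[of s] by simp
qed

context finite_geodesic_reeb
begin

definition unique_descent :: "'a set \<Rightarrow> real \<Rightarrow> bool" where
  "unique_descent C r \<longleftrightarrow>
     (\<forall>x\<in>C. \<forall>y\<in>C. \<forall>z w. below x z \<and> below y w \<and> f z = r \<and> f w = r \<longrightarrow> \<phi> z = \<phi> w)"

lemma unique_descent_self: "C \<in> \<C> \<Longrightarrow> unique_descent C (lev C)"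
  unfolding unique_descent_def
proof (intro ballI allI impI, elim conjE)
  fix x y z w assume *: "C \<in> \<C>" "x \<in> C" "y \<in> C" "below x z" "below y w" "f z = lev C" "f w = lev C"
  then have "x = z" "y = w"
    using contour_mem[of C] below_level_unique by metis+
  then show "\<phi> z = \<phi> w"
    using * contour_mem[of C] by metis
qed

lemma not_merging:
  assumes "C \<in> \<C>" "\<not> merging C"
  obtains r where "r < lev C" "\<And>s. \<lbrakk>r \<le> s; s \<le> lev C\<rbrakk> \<Longrightarrow> unique_descent C s"
proof -
  obtain r where r: "r < lev C" "\<not> (\<exists>x\<in>C. \<exists>y\<in>C. \<exists>z w. below x z \<and> below y w \<and>
     f z = f w \<and> r \<le> f z \<and> f z < lev C \<and> \<phi> z \<noteq> \<phi> w)"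
    using assms unfolding merging_def by blast
  have "unique_descent C s" if "r \<le> s" "s \<le> lev C" for s
  proof (cases "s = lev C")
    case False
    then show ?thesis
      unfolding unique_descent_def using r(2) that by (metis order_le_less)
  qed (simp add: unique_descent_self assms(1))
  then show thesis
    using r(1) that by blast
qed

text \<open>On both descents take the points at levels that decrease to \<open>r\<close>. They lie
  pairwise in common contours, and \<open>phi_limit_unique\<close> passes this to the ends.\<close>

lemma unique_descent_closed:
  assumes C: "C \<in> \<C>" "r < lev C" and uniq: "\<And>s. \<lbrakk>r < s; s \<le> lev C\<rbrakk> \<Longrightarrow> unique_descent C s"
  shows "unique_descent C r"
  unfolding unique_descent_def
proof (intro ballI allI impI, elim conjE)
  fix x y z w assume *: "x \<in> C" "y \<in> C" "below x z" "below y w" "f z = r" "f w = r"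
  have xy: "f x = lev C" "f y = lev C"
    using contour_mem[OF C(1)] * by auto
  obtain s where s: "\<And>n. r < s n" "\<And>n. s n \<le> lev C" "s \<longlonglongrightarrow> r"
    using sequence_from_above[OF C(2)] by blast
  have s_lim: "(\<lambda>n. s n - r) \<longlonglongrightarrow> 0"
    using s(3) by (simp add: LIM_zero_iff)
  have "\<exists>v. below x v \<and> below v z \<and> f v = s n" for n
    using below_between[OF *(3), of "s n"] s(1,2)[of n] * xy by (metis less_imp_le)
  then obtain u where u: "\<And>n. below x (u n) \<and> below (u n) z \<and> f (u n) = s n"
    by metis
  have "\<exists>v. below y v \<and> below v w \<and> f v = s n" for n
    using below_between[OF *(4), of "s n"] s(1,2)[of n] * xy by (metis less_imp_le)
  then obtain v where v: "\<And>n. below y (v n) \<and> below (v n) w \<and> f (v n) = s n"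
    by metis
  show "\<phi> z = \<phi> w"
  proof (rule phi_limit_unique)
    show "u n \<in> X" "v n \<in> X" for n
      using belowD u v by blast+
    show "z \<in> X" "w \<in> X"
      using belowD * by blast+
    have "dist (u n) z = s n - r" "dist (v n) w = s n - r" for n
      using u[of n] v[of n] * by (auto simp: below_def)
    then show "u \<longlonglongrightarrow> z" "v \<longlonglongrightarrow> w"
      using s_lim by (subst tendsto_dist_iff, simp)+
    show "\<phi> (u n) = \<phi> (v n)" for n
      using uniq[OF s(1,2)[of n]] u[of n] v[of n] *(1,2) unfolding unique_descent_def by blast
  qed
qed

text \<open>Every descent to \<open>r'\<close> passes level \<open>r\<close>, where by assumption
  all descents from \<open>C\<close> are in the same contour.\<close>

lemma unique_descent_extend:
  assumes C: "C \<in> \<C>" and r: "r' \<le> r" "r \<le> lev C" and u: "unique_descent C r"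
    and ext: "\<And>x z. \<lbrakk>x \<in> C; below x z; f z = r\<rbrakk> \<Longrightarrow> unique_descent (\<phi> z) r'"
  shows "unique_descent C r'"
  unfolding unique_descent_def
proof (intro ballI allI impI, elim conjE)
  fix x y z w assume *: "x \<in> C" "y \<in> C" "below x z" "below y w" "f z = r'" "f w = r'"
  have xy: "f x = lev C" "f y = lev C"
    using contour_mem[OF C(1)] * by auto
  obtain z1 where z1: "below x z1" "below z1 z" "f z1 = r"
    using below_between[OF *(3), of r] xy r * by metis
  obtain w1 where w1: "below y w1" "below w1 w" "f w1 = r"
    using below_between[OF *(4), of r] xy r * by metis
  have "\<phi> z1 = \<phi> w1"
    using u z1 w1 * unfolding unique_descent_def by blast
  then have "z1 \<in> \<phi> z1" "w1 \<in> \<phi> z1"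
    using phi_self belowD z1(1) w1(1) by auto
  then show "\<phi> z = \<phi> w"
    using ext[OF *(1) z1(1,3)] z1 w1 * unfolding unique_descent_def by blast
qed

text \<open>Continuous induction downwards from \<open>lev C\<close>: uniqueness persists at the
  infimum of the good levels by closedness, and the contour reached there is not merging, so it
  extends a little further.\<close>

lemma unique_descent_no_merging:
  assumes C: "C \<in> \<C>" "\<not> merging C" and r: "r \<le> lev C"
    and none: "\<And>D. merging D \<Longrightarrow> \<not> (r < lev D \<and> lev D < lev C)"
  shows "unique_descent C r"
proof (cases "r < 0")
  case True
  then have "f z \<noteq> r" for z
    using zero_le_dist[of p z] by linarith
  then show ?thesis
    by (simp add: unique_descent_def)
next
  case False
  define S where "S = {s \<in> {r..lev C}. \<forall>t\<in>{s..lev C}. unique_descent C t}"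
  have "lev C \<in> S"
    using r by (simp add: S_def unique_descent_self C)
  have bdd: "bdd_below S"
    by (auto simp: S_def intro!: bdd_belowI[of _ r])
  define s where "s = Inf S"
  have s: "r \<le> s" "s \<le> lev C"
    unfolding s_def using \<open>lev C \<in> S\<close> bdd by (auto intro!: cInf_greatest cInf_lower simp: S_def)
  have above: "unique_descent C t" if t: "s < t" "t \<le> lev C" for t
  proof -
    have "S \<noteq> {}"
      using \<open>lev C \<in> S\<close> by blast
    then obtain s' where "s' \<in> S" "s' < t"
      using t(1) bdd cInf_less_iff[of S t] by (auto simp: s_def)
    then show ?thesis
      using t by (auto simp: S_def)
  qed
  have at: "unique_descent C s"
    using unique_descent_closed[OF C(1) _ above] s unique_descent_self[OF C(1)]
    by (cases "s = lev C") auto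
  have "s = r"
  proof (rule ccontr)
    assume "s \<noteq> r"
    obtain x where x: "x \<in> C"
      using contour_nonempty C by blast
    have xX: "x \<in> X" "f x = lev C"
      using contour_mem[OF C(1) x] by auto
    obtain z where z: "below x z" "f z = s"
      using below_between[OF below_p[OF xX(1)], of s] s False xX by auto
    have zX: "z \<in> X"
      using belowD z by blast
    define D where "D = \<phi> z"
    have D: "D \<in> \<C>" "lev D = s"
      using zX z by (auto simp: D_def phi_in lev_phi)
    have D_eq: "\<phi> z' = D" if "x' \<in> C" "below x' z'" "f z' = s" for x' z'
      using at that z x unfolding unique_descent_def D_def by blast
    \<comment> \<open>For \<open>s = lev C\<close> the contour \<open>D\<close> is \<open>C\<close>
      itself; otherwise its level lies strictly between \<open>r\<close> and
      \<open>lev C\<close>.\<close>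
    have "\<not> merging D"
    proof (cases "s = lev C")
      case True
      then show ?thesis
        using D_eq[OF x below_refl[OF xX(1)]] xX contour_mem[OF C(1) x] C(2) by auto
    next
      case False
      then show ?thesis
        using none[of D] D s \<open>s \<noteq> r\<close> by auto
    qed
    then obtain r' where r': "r' < s" "\<And>t. \<lbrakk>r' \<le> t; t \<le> s\<rbrakk> \<Longrightarrow> unique_descent D t"
      using not_merging[OF D(1)] D(2) by metis
    define s' where "s' = max r r'"
    have "unique_descent C t" if "s' \<le> t" "t \<le> lev C" for t
    proof (cases "s < t")
      case False
      then show ?thesis
        using that D_eq by (intro unique_descent_extend[OF C(1) _ s(2) at]) (auto simp: s'_def intro!: r'(2))
    qed (use above that in auto)
    moreover have "r \<le> s'" "s' < s"
      using s r' \<open>s \<noteq> r\<close> by (auto simp: s'_def)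
    ultimately have "s' \<in> S"
      using s by (auto simp: S_def)
    then show False
      using cInf_lower[OF _ bdd, of s'] \<open>s' < s\<close> by (simp add: s_def)
  qed
  then show ?thesis
    using at by simp
qed

subsection \<open>Paths in the Reeb graph\<close>

lemma path_contour: "pathin R \<gamma> \<Longrightarrow> 0 \<le> t \<Longrightarrow> t \<le> 1 \<Longrightarrow> \<gamma> t \<in> \<C>"
  by (auto simp: pathin_def continuous_map_def)

lemma path_lev_continuous: "pathin R \<gamma> \<Longrightarrow> continuous_on {0..1} (\<lambda>t. lev (\<gamma> t))"
  using continuous_map_compose[of "top_of_set {0..1}" R \<gamma> euclideanreal lev] continuous_lev
  by (simp add: pathin_def comp_def)

text \<open>The contours \<open>\<gamma> (t n)\<close> converge to \<open>\<gamma> l\<close> and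
  also to the contour of \<open>x\<close>, and \<open>R\<close> is Hausdorff.\<close>

lemma path_limit:
  assumes \<gamma>: "pathin R \<gamma>" and t: "\<And>n::nat. 0 \<le> t n \<and> t n \<le> 1" "t \<longlonglongrightarrow> l"
    and u: "\<And>n. u n \<in> \<gamma> (t n)" "u \<longlonglongrightarrow> x"
  shows "0 \<le> l" "l \<le> 1" "x \<in> \<gamma> l"
proof -
  show l: "0 \<le> l" "l \<le> 1"
    using t by (auto intro: LIMSEQ_le_const LIMSEQ_le_const2)
  have uX: "u n \<in> X" "\<phi> (u n) = \<gamma> (t n)" for n
    using contour_mem[OF path_contour[OF \<gamma>] u(1)] t(1) by auto
  have x: "x \<in> X"
    using closed_sequentially[OF compact_imp_closed[OF compact_X]] uX u(2) by metis
  have "limitin (top_of_set {0..1}) t l sequentially"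
    using t l by (simp add: limitin_subtopology)
  then have "limitin R (\<gamma> \<circ> t) (\<gamma> l) sequentially"
    using \<gamma> by (auto simp: pathin_def intro: continuous_map_limit)
  moreover have "limitin R (\<lambda>n. \<phi> (u n)) (\<phi> x) sequentially"
    using uX x u(2) by (intro phi_limit)
  ultimately have "\<phi> x = \<gamma> l"
    using uX limitin_Hausdorff_unique[OF _ _ _ Hausdorff_R] by (fastforce simp: comp_def)
  then show "x \<in> \<gamma> l"
    using phi_self[OF x] by simp
qed

text \<open>\<open>X \<times> X\<close> is compact and the conditions defining \<open>below\<close>
  are closed, so a subsequence of the descents converges to a descent from
  \<open>\<gamma> l\<close>.\<close>

lemma path_below_limit:
  assumes \<gamma>: "pathin R \<gamma>" and t: "\<And>n::nat. 0 \<le> t n \<and> t n \<le> 1" "t \<longlonglongrightarrow> l"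
    and u: "\<And>n. u n \<in> \<gamma> (t n)" "\<And>n. below (u n) (v n)" "\<And>n. f (v n) = r"
  obtains x z k where "x \<in> \<gamma> l" "below x z" "f z = r" "strict_mono (k :: nat \<Rightarrow> nat)" "(v \<circ> k) \<longlonglongrightarrow> z"
proof -
  have "\<forall>n. (u n, v n) \<in> X \<times> X"
    using u belowD by blast
  then obtain q k where q: "q \<in> X \<times> X" "strict_mono (k :: nat \<Rightarrow> nat)" "((\<lambda>n. (u n, v n)) \<circ> k) \<longlonglongrightarrow> q"
    using seq_compactE[OF compact_imp_seq_compact[OF compact_Times[OF compact_X compact_X]]] by metis
  have lims: "(u \<circ> k) \<longlonglongrightarrow> fst q" "(v \<circ> k) \<longlonglongrightarrow> snd q"
    using tendsto_fst[OF q(3)] tendsto_snd[OF q(3)] by (simp_all add: comp_def)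
  have "fst q \<in> \<gamma> l"
    using path_limit(3)[OF \<gamma>, of "t \<circ> k" l "u \<circ> k" "fst q"] t u(1) lims LIMSEQ_subseq_LIMSEQ[OF t(2) q(2)]
    by simp
  moreover have fr: "f (snd q) = r"
  proof (rule LIMSEQ_unique)
    show "(\<lambda>n. f ((v \<circ> k) n)) \<longlonglongrightarrow> f (snd q)"
      by (intro tendsto_intros lims)
    show "(\<lambda>n. f ((v \<circ> k) n)) \<longlonglongrightarrow> r"
      using u(3) by simp
  qed
  moreover have "dist (fst q) (snd q) = f (fst q) - f (snd q)"
  proof (rule LIMSEQ_unique)
    show "(\<lambda>n. dist ((u \<circ> k) n) ((v \<circ> k) n)) \<longlonglongrightarrow> dist (fst q) (snd q)"
      by (intro tendsto_intros lims)
    have "(\<lambda>n. f ((u \<circ> k) n) - f ((v \<circ> k) n)) \<longlonglongrightarrow> f (fst q) - f (snd q)"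
      by (intro tendsto_intros lims)
    then show "(\<lambda>n. dist ((u \<circ> k) n) ((v \<circ> k) n)) \<longlonglongrightarrow> f (fst q) - f (snd q)"
      using u(2) by (simp add: below_def)
  qed
  then have "below (fst q) (snd q)"
    using q(1) by (auto simp: below_def)
  ultimately show thesis
    using q(2) lims(2) that by blast
qed

text \<open>
  By induction on the number of merging levels above the end point.  The last time at which some
  descent misses the end point would be a time with two different descents; descending first only
  to the lowest merging level in between, where the path itself is not merging, excludes this.
\<close>

lemma descent_along_path:
  assumes \<gamma>: "pathin R \<gamma>" and s: "0 \<le> s" "s \<le> u" "u \<le> 1"
    and avoid: "\<And>t. \<lbrakk>s \<le> t; t \<le> u\<rbrakk> \<Longrightarrow> \<not> merging (\<gamma> t) \<and> lev (\<gamma> u) \<le> lev (\<gamma> t)"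
    and x: "x \<in> \<gamma> s" "below x z" "f z = lev (\<gamma> u)"
  shows "z \<in> \<gamma> u"
  using s avoid x
proof (induction "card {l \<in> lev ` {D. merging D}. lev (\<gamma> u) < l}" arbitrary: s u x z rule: less_induct)
  case less
  define r where "r = lev (\<gamma> u)"
  define \<Lambda> where "\<Lambda> q = {l \<in> lev ` {D. merging D}. q < l}" for q
  have fin: "finite (\<Lambda> q)" for q
    using finite_level_and_merging(2) by (simp add: \<Lambda>_def)
  have u01: "0 \<le> u" "u \<le> 1"
    using less.prems by auto
  have Cu: "\<gamma> u \<in> \<C>"
    using path_contour[OF \<gamma>] u01 by auto
  \<comment> \<open>The times at which some descent misses \<open>\<gamma> u\<close>. Its supremum
    \<tau> will admit both a descent that misses \<open>\<gamma> u\<close> and one that hits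
    it.\<close>
  define N where "N = {t \<in> {s..u}. \<exists>x z. x \<in> \<gamma> t \<and> below x z \<and> f z = r \<and> z \<notin> \<gamma> u}"
  show ?case
  proof (rule ccontr)
    assume "z \<notin> \<gamma> u"
    then have "s \<in> N"
      using less.prems by (auto simp: N_def r_def)
    have bdd: "bdd_above N"
      by (auto simp: N_def intro!: bdd_aboveI[of _ u])
    define \<tau> where "\<tau> = Sup N"
    have \<tau>: "s \<le> \<tau>" "\<tau> \<le> u"
      unfolding \<tau>_def using \<open>s \<in> N\<close> bdd
      by (auto intro: cSup_upper cSup_least simp: N_def)
    have "\<tau> \<in> closure N"
      unfolding \<tau>_def using \<open>s \<in> N\<close> bdd by (intro closure_contains_Sup) auto
    then obtain t where t: "\<And>n. t n \<in> N" "t \<longlonglongrightarrow> \<tau>"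
      unfolding closure_sequential by blast
    then have "\<exists>x z. x \<in> \<gamma> (t n) \<and> below x z \<and> f z = r \<and> z \<notin> \<gamma> u" for n
      by (auto simp: N_def)
    then obtain a b where ab: "\<And>n. a n \<in> \<gamma> (t n)" "\<And>n. below (a n) (b n)" "\<And>n. f (b n) = r"
      "\<And>n. b n \<notin> \<gamma> u"
      by metis
    have "0 \<le> t n \<and> t n \<le> 1" for n
      using t(1)[of n] less.prems by (auto simp: N_def)
    then obtain x1 z1 k where 1: "x1 \<in> \<gamma> \<tau>" "below x1 z1" "f z1 = r" "strict_mono (k :: nat \<Rightarrow> nat)"
      "(b \<circ> k) \<longlonglongrightarrow> z1"
      using path_below_limit[OF \<gamma> _ t(2) ab(1-3)] by blast
    have zX: "z1 \<in> X"
      using belowD 1 by blast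
    \<comment> \<open>Missing \<open>\<gamma> u\<close> survives the limit because
      \<open>\<gamma> u\<close> is isolated among the contours of its level.\<close>
    have z1: "z1 \<notin> \<gamma> u"
    proof
      assume "z1 \<in> \<gamma> u"
      obtain \<epsilon> U V where U: "openin R U" "\<gamma> u \<in> U" "\<And>B. \<lbrakk>B \<in> U; lev B = lev (\<gamma> u)\<rbrakk> \<Longrightarrow> B = \<gamma> u"
        using contour_isolated[OF Cu] by metis
      obtain e where e: "0 < e" "\<And>x y. \<lbrakk>x \<in> \<gamma> u; y \<in> X; dist x y < e\<rbrakk> \<Longrightarrow> \<phi> y \<in> U"
        using contour_nbhd[OF Cu U(1,2)] by metis
      obtain n where n: "dist ((b \<circ> k) n) z1 < e"
        using metric_LIMSEQ_D[OF 1(5) e(1)] by blast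
      have bX: "b (k n) \<in> X"
        using belowD ab(2) by blast
      then have "\<phi> (b (k n)) \<in> U"
        using e(2)[OF \<open>z1 \<in> \<gamma> u\<close> bX] n by (simp add: dist_commute)
      then have "\<phi> (b (k n)) = \<gamma> u"
        using U(3) ab(3)[of "k n"] lev_phi[OF bX] by (simp add: r_def)
      then show False
        using phi_self[OF bX] ab(4)[of "k n"] by simp
    qed
    have "\<tau> \<noteq> u"
    proof
      assume "\<tau> = u"
      then have "x1 = z1"
        using 1(1,2,3) contour_mem[OF Cu] below_level_unique[of x1 z1] by (auto simp: r_def)
      then show False
        using z1 1(1) \<open>\<tau> = u\<close> by simp
    qed
    then have "\<tau> < u"
      using \<tau> by simp
    obtain t' where t': "\<And>n. \<tau> < t' n" "\<And>n. t' n \<le> u" "t' \<longlonglongrightarrow> \<tau>"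
      using sequence_from_above[OF \<open>\<tau> < u\<close>] by blast
    have t'01: "0 \<le> t' n \<and> t' n \<le> 1" for n
      using t'(1,2)[of n] \<tau> less.prems by linarith
    \<comment> \<open>Times after \<tau> are outside \<open>N\<close>, so their descents hit
      \<open>\<gamma> u\<close>; a limit of them is a descent from
      \<open>\<gamma> \<tau>\<close>.\<close>
    have "\<exists>x z. x \<in> \<gamma> (t' n) \<and> below x z \<and> f z = r \<and> z \<in> \<gamma> u" for n
    proof -
      have C: "\<gamma> (t' n) \<in> \<C>"
        using path_contour[OF \<gamma>] t'01 by blast
      then obtain x where x: "x \<in> \<gamma> (t' n)"
        using contour_nonempty by blast
      have xX: "x \<in> X" "f x = lev (\<gamma> (t' n))"
        using contour_mem[OF C x] by auto
      have "r \<le> f x"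
        unfolding xX r_def using less.prems(4)[of "t' n"] t'(1,2)[of n] \<tau> by auto
      moreover have "0 \<le> r"
        using 1(3) by auto
      ultimately obtain z where z: "below x z" "f z = r"
        using below_between[OF below_p[OF xX(1)], of r] by auto
      have "t' n \<notin> N"
        using cSup_upper[OF _ bdd, of "t' n"] t'(1,2)[of n] by (auto simp: \<tau>_def)
      moreover have "t' n \<in> {s..u}"
        using t'(1,2)[of n] \<tau> by auto
      ultimately show ?thesis
        using x z unfolding N_def by blast
    qed
    then obtain a' b' where ab': "\<And>n. a' n \<in> \<gamma> (t' n)" "\<And>n. below (a' n) (b' n)" "\<And>n. f (b' n) = r"
      "\<And>n. b' n \<in> \<gamma> u"
      by metis
    obtain x2 z2 k' where 2: "x2 \<in> \<gamma> \<tau>" "below x2 z2" "f z2 = r" "strict_mono (k' :: nat \<Rightarrow> nat)"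
      "(b' \<circ> k') \<longlonglongrightarrow> z2"
      using path_below_limit[OF \<gamma> t'01 t'(3) ab'(1-3)] by blast
    have z2: "z2 \<in> \<gamma> u"
      using closed_sequentially[OF contour_closed[OF Cu] _ 2(5)] ab'(4) by simp
    have not_uniq: "\<not> unique_descent (\<gamma> \<tau>) r"
    proof
      assume "unique_descent (\<gamma> \<tau>) r"
      then have "\<phi> z1 = \<phi> z2"
        using 1 2 unfolding unique_descent_def by blast
      then show False
        using z1 contour_mem(2)[OF Cu z2] phi_self[OF zX] by simp
    qed
    have \<tau>01: "0 \<le> \<tau>" "\<tau> \<le> 1"
      using \<tau> less.prems by auto
    have C\<tau>: "\<gamma> \<tau> \<in> \<C>" "\<not> merging (\<gamma> \<tau>)" "r \<le> lev (\<gamma> \<tau>)"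
      using path_contour[OF \<gamma> \<tau>01] less.prems(4)[OF \<tau>] by (auto simp: r_def)
    then obtain D where D: "merging D" "r < lev D" "lev D < lev (\<gamma> \<tau>)"
      using unique_descent_no_merging not_uniq by metis
    define l where "l = Min (\<Lambda> r)"
    have "lev D \<in> \<Lambda> r"
      using D by (auto simp: \<Lambda>_def)
    then have l: "l \<in> \<Lambda> r" "l \<le> lev D"
      unfolding l_def using fin Min_in Min_le by blast+
    have "continuous_on {\<tau>..u} (\<lambda>t. lev (\<gamma> t))"
      using continuous_on_subset[OF path_lev_continuous[OF \<gamma>]] \<tau>01 u01 by simp
    then obtain c where c: "\<tau> \<le> c" "c \<le> u" "lev (\<gamma> c) = l" "\<And>t. \<lbrakk>\<tau> \<le> t; t \<le> c\<rbrakk> \<Longrightarrow> l \<le> lev (\<gamma> t)"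
      using first_time_below[of \<tau> u "\<lambda>t. lev (\<gamma> t)" l] \<tau> l D by (auto simp: \<Lambda>_def r_def)
    \<comment> \<open>The level \<open>l\<close> itself drops out, so the induction hypothesis
      covers the path from \<tau> to the first time \<open>c\<close> at which it reaches
      \<open>l\<close>.\<close>
    have "\<Lambda> l \<subset> \<Lambda> r"
      using l by (auto simp: \<Lambda>_def)
    then have card: "card (\<Lambda> l) < card (\<Lambda> r)"
      using fin psubset_card_mono by blast
    have step: "w \<in> \<gamma> c" if "y \<in> \<gamma> \<tau>" "below y w" "f w = l" for y w
    proof (rule less.hyps[of c \<tau> y w])
      show "card {l \<in> lev ` {D. merging D}. lev (\<gamma> c) < l} < card {l \<in> lev ` {D. merging D}. lev (\<gamma> u) < l}"
        using card by (simp add: \<Lambda>_def r_def c(3))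
      show "\<not> merging (\<gamma> t) \<and> lev (\<gamma> c) \<le> lev (\<gamma> t)" if "\<tau> \<le> t" "t \<le> c" for t
        using c \<tau> less.prems(4)[of t] that by auto
    qed (use c \<tau>01 u01 that in auto)
    have Cc: "\<gamma> c \<in> \<C>" "\<not> merging (\<gamma> c)"
      using path_contour[OF \<gamma>, of c] c \<tau> \<tau>01 u01 less.prems(4)[of c] by auto
    \<comment> \<open>\<open>l\<close> is the lowest merging level above \<open>r\<close>, so
      nothing merges strictly between, and \<open>\<gamma> c\<close> lies on the path and is not
      merging either.\<close>
    have "unique_descent (\<gamma> c) r"
    proof (rule unique_descent_no_merging[OF Cc])
      show "\<not> (r < lev D \<and> lev D < lev (\<gamma> c))" if "merging D" for D
        using that Min_le[OF fin, of "lev D" r] c(3) by (auto simp: l_def \<Lambda>_def)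
    qed (use c l in \<open>auto simp: \<Lambda>_def\<close>)
    moreover have "\<phi> w = \<gamma> c" if "y \<in> \<gamma> \<tau>" "below y w" "f w = l" for y w
      using contour_mem(2)[OF Cc(1) step[OF that]] .
    ultimately have "unique_descent (\<gamma> \<tau>) r"
      using C\<tau>(1) l D
      by (intro unique_descent_extend[of "\<gamma> \<tau>" r l]) (auto simp: \<Lambda>_def unique_descent_def)
    then show False
      using not_uniq by blast
  qed
qed

end

section \<open>Total variation\<close>

text \<open>The sum inside \<open>path_length\<close>, named to allow induction on the list of
  partition points.\<close>

definition chain_sum :: "(real \<Rightarrow> 'b::metric_space) \<Rightarrow> real list \<Rightarrow> real" where
  "chain_sum g ts = (\<Sum>i<length ts - 1. dist (g (ts ! i)) (g (ts ! Suc i)))"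

lemma chain_sum_simps [simp]:
  "chain_sum g [] = 0" "chain_sum g [x] = 0"
  "chain_sum g (x # y # ts) = dist (g x) (g y) + chain_sum g (y # ts)"
  by (simp_all add: chain_sum_def sum.lessThan_Suc_shift del: sum.lessThan_Suc)

lemma chain_sum_le_path_length:
  "\<lbrakk>sorted ts; set ts \<subseteq> {0..1}\<rbrakk> \<Longrightarrow> ereal (chain_sum g ts) \<le> path_length g"
  unfolding chain_sum_def path_length_def by (intro SUP_upper) auto

lemma path_length_leI:
  "(\<And>ts. \<lbrakk>sorted ts; set ts \<subseteq> {0..1}\<rbrakk> \<Longrightarrow> ereal (chain_sum g ts) \<le> b) \<Longrightarrow> path_length g \<le> b"
  unfolding chain_sum_def path_length_def by (intro SUP_least) auto

lemma path_length_nonneg: "0 \<le> path_length g"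
  using chain_sum_le_path_length[of "[]" g] by (simp add: zero_ereal_def)

lemma chain_sum_append: "chain_sum g ts + chain_sum g ts' \<le> chain_sum g (ts @ ts')"
proof (induction ts rule: induct_list012)
  case (2 x)
  then show ?case by (cases ts') auto
qed auto

lemma chain_sum_split: "chain_sum g (ts @ ts') \<le> chain_sum g (ts @ [m]) + chain_sum g (m # ts')"
proof (induction ts rule: induct_list012)
  case 1
  then show ?case by (cases ts') auto
next
  case (2 x)
  then show ?case
    using dist_triangle[of "g x" _ "g m"] by (cases ts') (auto simp: add.assoc[symmetric])
qed auto

lemma chain_sum_map: "chain_sum g (map k ts) = chain_sum (g \<circ> k) ts"
  by (auto simp: chain_sum_def intro!: sum.cong)

lemma chain_sum_cong: "(\<And>t. t \<in> set ts \<Longrightarrow> g t = h t) \<Longrightarrow> chain_sum g ts = chain_sum h ts"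
  unfolding chain_sum_def by (intro sum.cong refl) auto

lemma chain_sum_snoc: "chain_sum g (ts @ [x, y]) = chain_sum g (ts @ [x]) + dist (g x) (g y)"
  by (induction ts rule: induct_list012) auto

lemma chain_sum_rev: "chain_sum g (rev ts) = chain_sum g ts"
  by (induction ts rule: induct_list012) (auto simp: chain_sum_snoc dist_commute)

lemma path_length_reverse_le: "path_length (g \<circ> (\<lambda>t. 1 - t)) \<le> path_length g"
proof (rule path_length_leI)
  fix ts :: "real list" assume ts: "sorted ts" "set ts \<subseteq> {0..1}"
  have "chain_sum (g \<circ> (\<lambda>t. 1 - t)) ts = chain_sum g (rev (map (\<lambda>t. 1 - t) ts))"
    by (simp only: chain_sum_rev chain_sum_map)
  moreover have "sorted (rev (map (\<lambda>t. 1 - t) ts))"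
    using ts(1) by (simp add: sorted_wrt_rev sorted_wrt_map)
  moreover have "set (rev (map (\<lambda>t. 1 - t) ts)) \<subseteq> {0..1}"
    using ts(2) by auto
  ultimately show "ereal (chain_sum (g \<circ> (\<lambda>t. 1 - t)) ts) \<le> path_length g"
    using chain_sum_le_path_length by metis
qed

text \<open>Inserting the junction 1/2 into a partition does not decrease its sum, and then the two
  halves rescale to partitions for \<open>g\<close> and \<open>h\<close>.\<close>

lemma path_length_join:
  fixes g h :: "real \<Rightarrow> 'b::metric_space"
  assumes "g 1 = h 0"
  shows "path_length (\<lambda>t. if t \<le> 1/2 then g (2 * t) else h (2 * t - 1)) \<le> path_length g + path_length h"
proof (rule path_length_leI)
  define k where "k t = (if t \<le> 1/2 then g (2 * t) else h (2 * t - 1))" for t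
  fix ts :: "real list" assume ts: "sorted ts" "set ts \<subseteq> {0..1}"
  define us where "us = takeWhile (\<lambda>t. t \<le> 1/2) ts"
  define vs where "vs = dropWhile (\<lambda>t. t \<le> 1/2) ts"
  have ts_eq: "ts = us @ vs"
    by (simp add: us_def vs_def)
  have us: "\<And>t. t \<in> set us \<Longrightarrow> t \<le> 1/2"
    unfolding us_def by (rule set_takeWhileD[THEN conjunct2])
  have vs: "1/2 < t" if "t \<in> set vs" for t
  proof (cases vs)
    case (Cons v vs')
    then have "\<not> v \<le> 1/2"
      using hd_dropWhile[of "\<lambda>t. t \<le> 1/2" ts] by (metis vs_def list.distinct(1) list.sel(1))
    moreover have "v \<le> t"
      using ts(1) that Cons by (auto simp: ts_eq sorted_append)
    ultimately show ?thesis by simp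
  qed (use that in simp)
  have sub: "set us \<subseteq> {0..1}" "set vs \<subseteq> {0..1}" "sorted us" "sorted vs"
    using ts by (auto simp: ts_eq sorted_append)
  have "chain_sum k (us @ [1/2]) = chain_sum (g \<circ> (\<lambda>t. 2 * t)) (us @ [1/2])"
    using us by (intro chain_sum_cong) (auto simp: k_def)
  also have "\<dots> = chain_sum g (map (\<lambda>t. 2 * t) (us @ [1/2]))"
    by (simp only: chain_sum_map)
  finally have 1: "ereal (chain_sum k (us @ [1/2])) \<le> path_length g"
  proof (simp only:, intro chain_sum_le_path_length)
    have "sorted (us @ [1/2])"
      using sub(3) us by (auto simp: sorted_append)
    then show "sorted (map (\<lambda>t. 2 * t) (us @ [1/2]))"
      by (rule sorted_map_mono) (simp add: mono_on_def)
    show "set (map (\<lambda>t. 2 * t) (us @ [1/2])) \<subseteq> {0..1}"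
      using sub(1) us by fastforce
  qed
  have "chain_sum k (1/2 # vs) = chain_sum (h \<circ> (\<lambda>t. 2 * t - 1)) (1/2 # vs)"
  proof (intro chain_sum_cong)
    fix t assume "t \<in> set (1/2 # vs)"
    then have "2 * t = 1 \<or> 1/2 < t"
      using vs by auto
    then show "k t = (h \<circ> (\<lambda>t. 2 * t - 1)) t"
    proof
      assume t: "2 * t = 1"
      then have "t \<le> 1/2"
        by simp
      then show ?thesis
        using assms t by (simp only: k_def comp_def if_True diff_self)
    qed (simp add: k_def)
  qed
  also have "\<dots> = chain_sum h (map (\<lambda>t. 2 * t - 1) (1/2 # vs))"
    by (simp only: chain_sum_map)
  finally have 2: "ereal (chain_sum k (1/2 # vs)) \<le> path_length h"
  proof (simp only:, intro chain_sum_le_path_length)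
    have "sorted (1/2 # vs)"
      using sub(4) vs by (auto simp: less_imp_le)
    then show "sorted (map (\<lambda>t. 2 * t - 1) (1/2 # vs))"
      by (rule sorted_map_mono) (simp add: mono_on_def)
    show "set (map (\<lambda>t. 2 * t - 1) (1/2 # vs)) \<subseteq> {0..1}"
      using sub(2) vs by fastforce
  qed
  have "ereal (chain_sum k ts) \<le> ereal (chain_sum k (us @ [1/2])) + ereal (chain_sum k (1/2 # vs))"
    using chain_sum_split[of k us vs "1/2"] by (simp add: ts_eq)
  also have "\<dots> \<le> path_length g + path_length h"
    by (intro add_mono 1 2)
  finally show "ereal (chain_sum (\<lambda>t. if t \<le> 1/2 then g (2 * t) else h (2 * t - 1)) ts) \<le> path_length g + path_length h"
    by (simp add: k_def[abs_def])
qed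

context finite_geodesic_reeb
begin

abbreviation "variation \<gamma> \<equiv> path_length (lev \<circ> \<gamma>)"

lemma path_reverse: "pathin R \<gamma> \<Longrightarrow> pathin R (\<gamma> \<circ> (\<lambda>t. 1 - t))"
  unfolding pathin_def
  by (rule continuous_map_compose[of _ "top_of_set {0..1}"])
    (auto simp: continuous_map_in_subtopology intro!: continuous_intros)

text \<open>At the lowest contour \<open>\<gamma> u\<close> of the segment, descents from both ends
  arrive. Their lengths are the two differences of levels, and one diameter joins their ends. The
  time \<open>u\<close> is returned so that it can serve as a partition point.\<close>

lemma segment_estimate:
  assumes \<gamma>: "pathin R \<gamma>" and s: "0 \<le> s" "s \<le> t" "t \<le> 1"
    and avoid: "\<And>u. \<lbrakk>s \<le> u; u \<le> t\<rbrakk> \<Longrightarrow> \<not> merging (\<gamma> u)"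
    and x: "x \<in> \<gamma> s" and y: "y \<in> \<gamma> t"
  obtains u where "s \<le> u" "u \<le> t"
    "dist x y \<le> dist (lev (\<gamma> s)) (lev (\<gamma> u)) + dist (lev (\<gamma> u)) (lev (\<gamma> t)) + diam"
proof -
  have "continuous_on {s..t} (\<lambda>t. lev (\<gamma> t))"
    using s by (intro continuous_on_subset[OF path_lev_continuous[OF \<gamma>]]) auto
  moreover have "{s..t} \<noteq> {}"
    using s(2) by simp
  ultimately obtain u where "u \<in> {s..t}" "\<forall>v\<in>{s..t}. lev (\<gamma> u) \<le> lev (\<gamma> v)"
    using continuous_attains_inf[OF compact_Icc] by blast
  then have u: "s \<le> u" "u \<le> t" "\<And>v. \<lbrakk>s \<le> v; v \<le> t\<rbrakk> \<Longrightarrow> lev (\<gamma> u) \<le> lev (\<gamma> v)"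
    by auto
  define r where "r = lev (\<gamma> u)"
  have C: "\<gamma> s \<in> \<C>" "\<gamma> t \<in> \<C>" "\<gamma> u \<in> \<C>"
    using path_contour[OF \<gamma>] s u by auto
  have xy: "x \<in> X" "f x = lev (\<gamma> s)" "y \<in> X" "f y = lev (\<gamma> t)"
    using contour_mem[OF C(1) x] contour_mem[OF C(2) y] by auto
  obtain c where "c \<in> \<gamma> u"
    using contour_nonempty C(3) by blast
  then have r0: "0 \<le> r"
    using contour_mem(3)[OF C(3)] zero_le_dist[of p c] by (simp add: r_def)
  have r: "r \<le> f x" "r \<le> f y"
    using u s xy by (auto simp: r_def)
  obtain z where z: "below x z" "f z = r"
    using below_between[OF below_p[OF xy(1)], of r] r r0 by auto
  obtain w where w: "below y w" "f w = r"
    using below_between[OF below_p[OF xy(3)], of r] r r0 by auto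
  have "z \<in> \<gamma> u"
    by (rule descent_along_path[OF \<gamma>, of s u x z]) (use s u avoid x z in \<open>auto simp: r_def\<close>)
  \<comment> \<open>\<open>descent_along_path\<close> runs forwards in time, so the right end is
    treated on the reversed path.\<close>
  moreover have "w \<in> (\<gamma> \<circ> (\<lambda>t. 1 - t)) (1 - u)"
    by (rule descent_along_path[OF path_reverse[OF \<gamma>], of "1 - t" "1 - u" y w])
      (use s u avoid y w in \<open>auto simp: r_def\<close>)
  then have "w \<in> \<gamma> u"
    by simp
  ultimately have "dist z w \<le> diam"
    using dist_le_diam C(3) by blast
  moreover have "dist x z = f x - r" "dist y w = f y - r"
    using z w by (auto simp: below_def)
  moreover have "dist x y \<le> dist x z + dist z w + dist y w"
    using dist_triangle[of x y z] dist_triangle2[of z y w] by simp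
  ultimately show thesis
    using u r xy by (intro that[of u]) (auto simp: dist_real_def r_def)
qed

text \<open>Substitute for a continuous lift: some point of \<open>\<gamma> l\<close> is
  approximated by points of nearby contours of the path, by compactness of \<open>X\<close>.\<close>

lemma path_lift_approx:
  assumes \<gamma>: "pathin R \<gamma>" and t: "\<And>n::nat. 0 \<le> t n \<and> t n \<le> 1" "t \<longlonglongrightarrow> l"
  obtains x where "x \<in> \<gamma> l" "\<And>e. 0 < e \<Longrightarrow> \<exists>n. \<exists>y\<in>\<gamma> (t n). dist y x < e"
proof -
  have C: "\<gamma> (t n) \<in> \<C>" for n
    using path_contour[OF \<gamma>] t by blast
  have "\<exists>v. v \<in> \<gamma> (t n)" for n
    by (rule contour_nonempty[OF C])
  then obtain u where u: "\<And>n. u n \<in> \<gamma> (t n)"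
    by metis
  have "\<forall>n. u n \<in> X"
    using contour_mem[OF C u] by blast
  then obtain x k where x: "strict_mono (k :: nat \<Rightarrow> nat)" "(u \<circ> k) \<longlonglongrightarrow> x"
    using seq_compactE[OF compact_imp_seq_compact[OF compact_X]] by metis
  have "x \<in> \<gamma> l"
    by (rule path_limit(3)[OF \<gamma>, of "t \<circ> k" l "u \<circ> k"])
      (use t u x LIMSEQ_subseq_LIMSEQ[OF t(2) x(1)] in auto)
  moreover have "\<exists>n. \<exists>y\<in>\<gamma> (t n). dist y x < e" if "0 < e" for e
    using metric_LIMSEQ_D[OF x(2) that] u by force
  ultimately show thesis
    using that by blast
qed

lemma closed_path_preimage:
  assumes \<gamma>: "pathin R \<gamma>" and M: "finite M" "M \<subseteq> \<C>" and ab: "0 \<le> a" "b \<le> 1"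
  shows "closed {t \<in> {a..b}. \<gamma> t \<in> M}"
proof -
  have "closedin R M"
    using M Hausdorff_R closedin_Hausdorff_finite by fastforce
  then have "closedin (top_of_set {0..1}) {t \<in> {0..1}. \<gamma> t \<in> M}"
    using closedin_continuous_map_preimage[of "top_of_set {0..1}" R \<gamma> M] \<gamma> by (simp add: pathin_def)
  then have "closed {t \<in> {0..1}. \<gamma> t \<in> M}"
    by (rule closedin_closed_trans) simp
  then have "closed ({t \<in> {0..1}. \<gamma> t \<in> M} \<inter> {a..b})"
    by (intro closed_Int) auto
  then show ?thesis
    by (rule back_subst) (use ab in auto)
qed

text \<open>
  A path is cut at the first merging contour \<open>C\<close> that it meets and continued from the last time
  that it visits \<open>C\<close>, which costs at most one contour diameter.
\<close>

lemma path_estimate: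
  assumes \<gamma>: "pathin R \<gamma>" and M: "finite M"
    and ab: "0 \<le> a" "a \<le> b" "b \<le> 1"
    and avoid: "\<And>t. \<lbrakk>a \<le> t; t \<le> b; merging (\<gamma> t)\<rbrakk> \<Longrightarrow> \<gamma> t \<in> M"
    and x: "x \<in> \<gamma> a" and y: "y \<in> \<gamma> b" and e: "0 < e"
  shows "\<exists>ts. sorted ts \<and> set ts \<subseteq> {a..b} \<and>
    dist x y \<le> chain_sum (lev \<circ> \<gamma>) ts + (2 * card M + 1) * diam + e"
  using M ab avoid x y e
proof (induction M arbitrary: a x e rule: finite_psubset_induct)
  case (psubset M)
  define A where "A = {t \<in> {a..b}. \<gamma> t \<in> {D. merging D}}"
  have inC: "\<gamma> t \<in> \<C>" if "a \<le> t" "t \<le> b" for t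
    using path_contour[OF \<gamma>] psubset.prems that by auto
  show ?case
  proof (cases "A = {}")
    case True
    then obtain u where u: "a \<le> u" "u \<le> b"
      "dist x y \<le> dist (lev (\<gamma> a)) (lev (\<gamma> u)) + dist (lev (\<gamma> u)) (lev (\<gamma> b)) + diam"
      using segment_estimate[OF \<gamma> psubset.prems(1-3) _ psubset.prems(5,6)] by (auto simp: A_def)
    have "1 * diam \<le> (2 * card M + 1) * diam"
      by (intro mult_right_mono diam_nonneg) simp
    then show ?thesis
      using u psubset.prems by (intro exI[of _ "[a, u, b]"]) auto
  next
    case False
    have "closed A"
      unfolding A_def
      by (rule closed_path_preimage[OF \<gamma> finite_level_and_merging(2)])
        (use psubset.prems in \<open>auto simp: merging_def\<close>)
    moreover have bdd: "bdd_below A"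
      by (auto simp: A_def intro!: bdd_belowI[of _ a])
    ultimately have t1A: "Inf A \<in> A"
      using False by (intro closed_contains_Inf)
    define t1 where "t1 = Inf A"
    define C where "C = \<gamma> t1"
    have t1: "a \<le> t1" "t1 \<le> b" "merging C" "C \<in> \<C>"
      using t1A by (auto simp: A_def t1_def C_def merging_def)
    have before: "\<not> merging (\<gamma> t)" if "a \<le> t" "t < t1" for t
      using that t1 cInf_lower[OF _ bdd, of t] by (auto simp: A_def t1_def)
    define B where "B = {t \<in> {t1..b}. \<gamma> t \<in> {C}}"
    have "closed B"
      unfolding B_def using psubset.prems t1 by (intro closed_path_preimage[OF \<gamma>]) auto
    moreover have bddB: "bdd_above B"
      by (auto simp: B_def intro!: bdd_aboveI[of _ b])
    moreover have "t1 \<in> B"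
      using t1 by (simp add: B_def C_def)
    ultimately have t2B: "Sup B \<in> B"
      by (intro closed_contains_Sup) auto
    define t2 where "t2 = Sup B"
    have t2: "t1 \<le> t2" "t2 \<le> b" "\<gamma> t2 = C"
      using t2B by (auto simp: B_def t2_def)
    have after: "\<gamma> t \<noteq> C" if "t2 < t" "t \<le> b" for t
      using that t2 cSup_upper[OF _ bddB, of t] by (auto simp: B_def t2_def)
    have CM: "C \<in> M"
      using psubset.prems(4)[of t1] t1 by (auto simp: C_def)
    have card: "card M = Suc (card (M - {C}))"
      by (rule card.remove[OF psubset.hyps(1) CM])
    obtain x' us where x': "x' \<in> C" "sorted us" "set us \<subseteq> {a..t1}"
      "dist x x' \<le> chain_sum (lev \<circ> \<gamma>) us + diam + e / 2"
    proof (cases "a = t1")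
      case True
      then show thesis
        using that[of x "[]"] psubset.prems diam_nonneg by (auto simp: C_def)
    next
      case False
      then have "- t1 < - a"
        using t1 by simp
      \<comment> \<open>Negated times approach \<open>t1\<close> from the left. The segment must
        stop before \<open>t1\<close>, where the path is already at a merging contour; the gap to a
        point of \<open>C\<close> is paid for by \<open>e / 2\<close>.\<close>
      then obtain s where s: "\<And>n. - t1 < s n" "\<And>n. s n \<le> - a" "s \<longlonglongrightarrow> - t1"
        using sequence_from_above by blast
      have s01: "0 \<le> - s n \<and> - s n \<le> 1" for n
        using s(1,2)[of n] t1 psubset.prems by linarith
      have s_lim: "(\<lambda>n. - s n) \<longlonglongrightarrow> t1"
        using tendsto_minus[OF s(3)] by simp
      obtain x' where x': "x' \<in> \<gamma> t1" "\<And>e. 0 < e \<Longrightarrow> \<exists>n. \<exists>y\<in>\<gamma> (- s n). dist y x' < e"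
        using path_lift_approx[OF \<gamma> s01 s_lim] by blast
      obtain n v where v: "v \<in> \<gamma> (- s n)" "dist v x' < e / 2"
        using x'(2)[of "e / 2"] psubset.prems(7) by auto
      have n: "a \<le> - s n" "- s n < t1" "- s n \<le> 1"
        using s(1,2)[of n] s01[of n] by auto
      obtain u where u: "a \<le> u" "u \<le> - s n"
        "dist x v \<le> dist (lev (\<gamma> a)) (lev (\<gamma> u)) + dist (lev (\<gamma> u)) (lev (\<gamma> (- s n))) + diam"
        using segment_estimate[OF \<gamma> psubset.prems(1) n(1,3) before psubset.prems(5) v(1)] n by auto
      show thesis
      proof (rule that[of x' "[a, u, - s n]"])
        show "dist x x' \<le> chain_sum (lev \<circ> \<gamma>) [a, u, - s n] + diam + e / 2"
          using u(3) v(2) dist_triangle[of x x' v] by simp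
      qed (use x' u n in \<open>auto simp: C_def\<close>)
    qed
    obtain y' vs where y': "y' \<in> C" "sorted vs" "set vs \<subseteq> {t2..b}"
      "dist y' y \<le> chain_sum (lev \<circ> \<gamma>) vs + (2 * card (M - {C}) + 1) * diam + e / 2"
    proof (cases "t2 = b")
      case True
      then show thesis
        using that[of y "[]"] psubset.prems diam_nonneg t2 by auto
    next
      case False
      then have "t2 < b"
        using t2 by simp
      then obtain s where s: "\<And>n. t2 < s n" "\<And>n. s n \<le> b" "s \<longlonglongrightarrow> t2"
        using sequence_from_above by blast
      have s01: "0 \<le> s n \<and> s n \<le> 1" for n
        using s(1,2)[of n] t1 t2 psubset.prems by linarith
      obtain y' where y': "y' \<in> \<gamma> t2" "\<And>e. 0 < e \<Longrightarrow> \<exists>n. \<exists>y\<in>\<gamma> (s n). dist y y' < e"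
        using path_lift_approx[OF \<gamma> s01 s(3)] by blast
      obtain n v where v: "v \<in> \<gamma> (s n)" "dist v y' < e / 4"
        using y'(2)[of "e / 4"] psubset.prems(7) by auto
      have n: "t2 < s n" "s n \<le> b" "0 \<le> s n"
        using s(1,2)[of n] s01[of n] by auto
      \<comment> \<open>\<open>C\<close> is not visited after \<open>t2\<close>, so the induction
        hypothesis applies with \<open>M - {C}\<close>. Its error \<open>e / 4\<close> and the gap
        of \<open>e / 4\<close> add up to \<open>e / 2\<close>.\<close>
      have "\<exists>ts. sorted ts \<and> set ts \<subseteq> {s n..b} \<and>
        dist v y \<le> chain_sum (lev \<circ> \<gamma>) ts + (2 * card (M - {C}) + 1) * diam + e / 4"
      proof (rule psubset.IH)
        show "\<gamma> t \<in> M - {C}" if "s n \<le> t" "t \<le> b" "merging (\<gamma> t)" for t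
          using psubset.prems(4)[of t] after[of t] that n t1 t2 by auto
      qed (use CM n v psubset.prems in auto)
      then obtain ts where ts: "sorted ts" "set ts \<subseteq> {s n..b}"
        "dist v y \<le> chain_sum (lev \<circ> \<gamma>) ts + (2 * card (M - {C}) + 1) * diam + e / 4"
        by blast
      show thesis
      proof (rule that[of y' ts])
        have "dist y' y \<le> dist v y' + dist v y"
          using dist_triangle[of y' y v] by (simp add: dist_commute)
        then show "dist y' y \<le> chain_sum (lev \<circ> \<gamma>) ts + (2 * card (M - {C}) + 1) * diam + e / 2"
          using v(2) ts(3) by linarith
      qed (use y' t2 ts n in auto)
    qed
    have "dist x' y' \<le> diam"
      using dist_le_diam[OF t1(4)] x' y' by blast
    then have "dist x y \<le> (chain_sum (lev \<circ> \<gamma>) us + diam + e / 2) + diam +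
        (chain_sum (lev \<circ> \<gamma>) vs + (2 * card (M - {C}) + 1) * diam + e / 2)"
      using x'(4) y'(4) dist_triangle[of x y x'] dist_triangle[of x' y y'] by linarith
    \<comment> \<open>One diameter before \<open>C\<close>, one for the jump inside
      \<open>C\<close>, and 2 (card M - 1) + 1 afterwards.\<close>
    also have "\<dots> = chain_sum (lev \<circ> \<gamma>) us + chain_sum (lev \<circ> \<gamma>) vs + (2 * card M + 1) * diam + e"
      by (simp add: card algebra_simps)
    also have "\<dots> \<le> chain_sum (lev \<circ> \<gamma>) (us @ vs) + (2 * card M + 1) * diam + e"
      using chain_sum_append[of "lev \<circ> \<gamma>" us vs] by simp
    finally have "dist x y \<le> chain_sum (lev \<circ> \<gamma>) (us @ vs) + (2 * card M + 1) * diam + e" .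
    moreover have "sorted (us @ vs)" "set (us @ vs) \<subseteq> {a..b}"
      using x' y' t1 t2 by (fastforce simp: sorted_append)+
    ultimately show ?thesis
      by blast
  qed
qed

definition merging_count :: nat where "merging_count = card {D. merging D}"

lemma dist_le_variation:
  assumes \<gamma>: "pathin R \<gamma>" "x \<in> \<gamma> 0" "y \<in> \<gamma> 1"
  shows "ereal (dist x y - (2 * merging_count + 1) * diam) \<le> variation \<gamma>"
proof (rule ereal_le_epsilon2)
  fix e :: real assume "0 < e"
  then obtain ts where ts: "sorted ts" "set ts \<subseteq> {0..1}"
    "dist x y \<le> chain_sum (lev \<circ> \<gamma>) ts + (2 * card {D. merging D} + 1) * diam + e"
    using path_estimate[OF \<gamma>(1) finite_level_and_merging(2), of 0 1 x y e] \<gamma> by auto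
  then have "ereal (dist x y - (2 * merging_count + 1) * diam) \<le> ereal (chain_sum (lev \<circ> \<gamma>) ts) + ereal e"
    by (simp add: merging_count_def)
  also have "\<dots> \<le> variation \<gamma> + ereal e"
    using ts by (intro add_right_mono chain_sum_le_path_length)
  finally show "ereal (dist x y - (2 * merging_count + 1) * diam) \<le> variation \<gamma> + ereal e" .
qed

end

lemma pathin_join:
  assumes g: "pathin T g" and h: "pathin T h" and gh: "g 1 = h 0"
  shows "pathin T (\<lambda>t. if t \<le> 1/2 then g (2 * t) else h (2 * t - 1))"
  unfolding pathin_def
proof (rule continuous_map_cases_le)
  have g': "continuous_map (top_of_set {0..1}) T g" and h': "continuous_map (top_of_set {0..1}) T h"
    using g h by (auto simp: pathin_def)
  show "continuous_map (subtopology (top_of_set {0..1}) {x \<in> topspace (top_of_set {0..1}). x \<le> 1/2}) T (\<lambda>x. g (2 * x))"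
    by (rule continuous_map_compose[OF _ g', unfolded comp_def])
      (auto simp: continuous_map_in_subtopology subtopology_subtopology intro!: continuous_intros)
  show "continuous_map (subtopology (top_of_set {0..1}) {x \<in> topspace (top_of_set {0..1}). 1/2 \<le> x}) T (\<lambda>x. h (2 * x - 1))"
    by (rule continuous_map_compose[OF _ h', unfolded comp_def])
      (auto simp: continuous_map_in_subtopology subtopology_subtopology intro!: continuous_intros)
  show "g (2 * x) = h (2 * x - 1)" if "x = 1/2" for x
    unfolding that using gh by simp
qed (auto intro!: continuous_intros)

section \<open>The Reeb metric\<close>

context finite_geodesic_reeb
begin

abbreviation "rd \<equiv> reeb_dist X f"

lemma reeb_dist_le_variation: "\<lbrakk>pathin R \<gamma>; \<gamma> 0 = a; \<gamma> 1 = b\<rbrakk> \<Longrightarrow> rd a b \<le> variation \<gamma>"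
  unfolding reeb_dist_def by (rule INF_lower) simp

lemma reeb_dist_geI: "(\<And>\<gamma>. \<lbrakk>pathin R \<gamma>; \<gamma> 0 = a; \<gamma> 1 = b\<rbrakk> \<Longrightarrow> c \<le> variation \<gamma>) \<Longrightarrow> c \<le> rd a b"
  unfolding reeb_dist_def by (rule INF_greatest) simp

text \<open>Along a projected geodesic \<open>lev\<close> is \<open>f\<close>, which is 1-Lipschitz,
  so the variation is at most the length.\<close>

lemma reeb_dist_le_dist:
  assumes xy: "x \<in> X" "y \<in> X"
  shows "rd (\<phi> x) (\<phi> y) \<le> ereal (dist x y)"
proof -
  obtain g where g: "path g" "path_image g \<subseteq> X" "pathstart g = x" "pathfinish g = y"
    "path_length g = ereal (dist x y)"
    using geodesic_X xy unfolding geodesic_space_def by metis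
  have gX: "g t \<in> X" if "0 \<le> t" "t \<le> 1" for t
    using g(2) that by (auto simp: path_image_def)
  have "continuous_map (top_of_set {0..1}) (top_of_set X) g"
    using g(1) gX by (auto simp: continuous_map_in_subtopology path_def)
  then have path: "pathin R (\<phi> \<circ> g)"
    unfolding pathin_def by (rule continuous_map_compose[OF _ continuous_phi])
  have "rd (\<phi> x) (\<phi> y) \<le> variation (\<phi> \<circ> g)"
    using g(3,4) by (intro reeb_dist_le_variation[OF path]) (auto simp: pathstart_def pathfinish_def)
  also have "\<dots> \<le> path_length g"
  proof (rule path_length_leI)
    fix ts :: "real list" assume ts: "sorted ts" "set ts \<subseteq> {0..1}"
    have "chain_sum (lev \<circ> (\<phi> \<circ> g)) ts \<le> chain_sum g ts"
      unfolding chain_sum_def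
    proof (rule sum_mono)
      fix i assume "i \<in> {..<length ts - 1}"
      then have "ts ! i \<in> {0..1}" "ts ! Suc i \<in> {0..1}"
        using ts(2) nth_mem by (auto simp: subset_eq)
      then show "dist ((lev \<circ> (\<phi> \<circ> g)) (ts ! i)) ((lev \<circ> (\<phi> \<circ> g)) (ts ! Suc i))
          \<le> dist (g (ts ! i)) (g (ts ! Suc i))"
        using gX by (simp add: lev_phi dist_real_def abs_f_diff)
    qed
    then show "ereal (chain_sum (lev \<circ> (\<phi> \<circ> g)) ts) \<le> path_length g"
      using chain_sum_le_path_length[OF ts, of g] order_trans by (metis ereal_less_eq(3))
  qed
  finally show ?thesis
    using g(5) by simp
qed

lemma reeb_dist_nonneg: "0 \<le> rd a b"
  by (intro reeb_dist_geI path_length_nonneg)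

lemma reeb_dist_finite:
  assumes "a \<in> \<C>" "b \<in> \<C>"
  shows "\<bar>rd a b\<bar> \<noteq> \<infinity>"
proof -
  obtain x y where "x \<in> X" "y \<in> X" "a = \<phi> x" "b = \<phi> y"
    using assms contoursE by metis
  then have "rd a b \<le> ereal (dist x y)"
    using reeb_dist_le_dist by simp
  then show ?thesis
    using reeb_dist_nonneg[of a b] by auto
qed

lemma reeb_dist_commute: "rd a b = rd b a"
proof -
  have "rd a b \<le> rd b a" for a b
  proof (rule reeb_dist_geI)
    fix \<gamma> assume \<gamma>: "pathin R \<gamma>" "\<gamma> 0 = b" "\<gamma> 1 = a"
    have "rd a b \<le> variation (\<gamma> \<circ> (\<lambda>t. 1 - t))"
      using \<gamma> by (intro reeb_dist_le_variation path_reverse) auto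
    also have "\<dots> \<le> variation \<gamma>"
      using path_length_reverse_le[of "lev \<circ> \<gamma>"] by (simp add: comp_assoc)
    finally show "rd a b \<le> variation \<gamma>" .
  qed
  then show ?thesis
    by (intro order_antisym)
qed

lemma reeb_dist_near_path:
  assumes "a \<in> \<C>" "b \<in> \<C>" "0 < e"
  obtains \<gamma> where "pathin R \<gamma>" "\<gamma> 0 = a" "\<gamma> 1 = b" "variation \<gamma> \<le> rd a b + ereal e"
proof -
  have "rd a b < rd a b + ereal e"
    using reeb_dist_finite[OF assms(1,2)] assms(3) by (cases "rd a b") auto
  then obtain \<gamma> where "pathin R \<gamma>" "\<gamma> 0 = a" "\<gamma> 1 = b" "variation \<gamma> < rd a b + ereal e"
    unfolding reeb_dist_def INF_less_iff by auto
  then show thesis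
    using that less_imp_le by blast
qed

lemma reeb_dist_triangle:
  assumes "a \<in> \<C>" "b \<in> \<C>" "c \<in> \<C>"
  shows "rd a c \<le> rd a b + rd b c"
proof (rule ereal_le_epsilon2)
  fix e :: real assume "0 < e"
  then have e: "0 < e / 2" by simp
  obtain \<gamma> where \<gamma>: "pathin R \<gamma>" "\<gamma> 0 = a" "\<gamma> 1 = b" "variation \<gamma> \<le> rd a b + ereal (e / 2)"
    using reeb_dist_near_path[OF assms(1,2) e] by blast
  obtain \<gamma>' where \<gamma>': "pathin R \<gamma>'" "\<gamma>' 0 = b" "\<gamma>' 1 = c" "variation \<gamma>' \<le> rd b c + ereal (e / 2)"
    using reeb_dist_near_path[OF assms(2,3) e] by blast
  define k where "k t = (if t \<le> 1/2 then \<gamma> (2 * t) else \<gamma>' (2 * t - 1))" for t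
  have "pathin R k"
    unfolding k_def using \<gamma> \<gamma>' by (intro pathin_join) auto
  then have "rd a c \<le> variation k"
    using \<gamma> \<gamma>' by (intro reeb_dist_le_variation) (auto simp: k_def)
  also have "lev \<circ> k = (\<lambda>t. if t \<le> 1/2 then (lev \<circ> \<gamma>) (2 * t) else (lev \<circ> \<gamma>') (2 * t - 1))"
    by (auto simp: k_def)
  then have "variation k \<le> variation \<gamma> + variation \<gamma>'"
    using path_length_join[of "lev \<circ> \<gamma>" "lev \<circ> \<gamma>'"] \<gamma>(3) \<gamma>'(2) by simp
  also have "\<dots> \<le> (rd a b + ereal (e / 2)) + (rd b c + ereal (e / 2))"
    by (intro add_mono \<gamma> \<gamma>')
  also have "\<dots> = rd a b + rd b c + ereal e"
    using reeb_dist_finite[OF assms(1,2)] reeb_dist_finite[OF assms(2,3)]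
    by (cases "rd a b"; cases "rd b c") auto
  finally show "rd a c \<le> rd a b + rd b c + ereal e" .
qed

lemma variation_ge_dist:
  assumes "0 \<le> s" "s \<le> t" "t \<le> 1"
  shows "ereal \<bar>lev (\<gamma> s) - lev (\<gamma> t)\<bar> \<le> variation \<gamma>"
  using chain_sum_le_path_length[of "[s, t]" "lev \<circ> \<gamma>"] assms by (simp add: dist_real_def)

text \<open>A path between different levels varies by at least their difference. Between two
  contours of one level, connectedness forces the path out of the slab of
  \<open>contour_isolated\<close>, at the cost of \<epsilon>.\<close>

lemma reeb_dist_pos:
  assumes C: "C \<in> \<C>" "D \<in> \<C>" "C \<noteq> D"
  shows "0 < rd C D"
proof (cases "lev C = lev D")
  case False
  have "ereal \<bar>lev C - lev D\<bar> \<le> rd C D"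
    using variation_ge_dist[of 0 1] by (intro reeb_dist_geI) auto
  moreover have "0 < ereal \<bar>lev C - lev D\<bar>"
    using False by (simp add: zero_ereal_def[symmetric])
  ultimately show ?thesis
    by (rule less_le_trans[rotated])
next
  case True
  obtain \<epsilon> U V where U: "0 < \<epsilon>" "openin R U" "openin R V" "U \<inter> V = {}" "C \<in> U"
    "\<And>B. \<lbrakk>B \<in> \<C>; \<bar>lev B - lev C\<bar> < \<epsilon>\<rbrakk> \<Longrightarrow> B \<in> U \<union> V"
    "\<And>B. \<lbrakk>B \<in> U; lev B = lev C\<rbrakk> \<Longrightarrow> B = C"
    using contour_isolated[OF C(1)] by metis
  have DV: "D \<in> V"
    using U(1) U(6)[of D] U(7)[of D] C True by auto
  have "ereal \<epsilon> \<le> rd C D"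
  proof (rule reeb_dist_geI)
    fix \<gamma> assume \<gamma>: "pathin R \<gamma>" "\<gamma> 0 = C" "\<gamma> 1 = D"
    have "\<exists>t\<in>{0..1}. \<epsilon> \<le> \<bar>lev (\<gamma> t) - lev C\<bar>"
    proof (rule ccontr)
      assume "\<not> ?thesis"
      then have "\<gamma> t \<in> U \<union> V" if "t \<in> {0..1}" for t
        using that U(6)[of "\<gamma> t"] path_contour[OF \<gamma>(1), of t] by (auto simp: not_le)
      then have "\<gamma> ` {0..1} \<subseteq> U \<union> V"
        by blast
      moreover have "connectedin R (\<gamma> ` {0..1})"
        using \<gamma>(1) unfolding pathin_def
        by (rule connectedin_continuous_map_image) (simp add: connectedin_subtopology)
      moreover have "C \<in> U \<inter> \<gamma> ` {0..1}" "D \<in> V \<inter> \<gamma> ` {0..1}"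
        using \<gamma> U DV by force+
      ultimately show False
        using U(2-4) unfolding connectedin by blast
    qed
    then obtain t where t: "0 \<le> t" "t \<le> 1" "\<epsilon> \<le> \<bar>lev (\<gamma> t) - lev C\<bar>"
      by auto
    then have "ereal \<epsilon> \<le> ereal \<bar>lev (\<gamma> 0) - lev (\<gamma> t)\<bar>"
      using \<gamma>(2) by (simp add: abs_minus_commute)
    also have "\<dots> \<le> variation \<gamma>"
      using t by (intro variation_ge_dist) auto
    finally show "ereal \<epsilon> \<le> variation \<gamma>" .
  qed
  moreover have "0 < ereal \<epsilon>"
    using U(1) by simp
  ultimately show ?thesis
    by (rule less_le_trans[rotated])
qed

section \<open>The real-valued Reeb metric and the Gromov-Hausdorff bound\<close>

definition real_rd :: "'a set \<Rightarrow> 'a set \<Rightarrow> real" where "real_rd a b = real_of_ereal (rd a b)"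

lemma ereal_real_rd: "\<lbrakk>a \<in> \<C>; b \<in> \<C>\<rbrakk> \<Longrightarrow> ereal (real_rd a b) = rd a b"
  using reeb_dist_finite by (simp add: real_rd_def ereal_real)

lemma real_rd_nonneg: "0 \<le> real_rd a b"
  using reeb_dist_nonneg by (simp add: real_rd_def real_of_ereal_pos)

lemma real_rd_commute: "real_rd a b = real_rd b a"
  by (simp add: real_rd_def reeb_dist_commute[of a b])

lemma real_rd_triangle: "\<lbrakk>a \<in> \<C>; b \<in> \<C>; c \<in> \<C>\<rbrakk> \<Longrightarrow> real_rd a c \<le> real_rd a b + real_rd b c"
  using reeb_dist_triangle[of a b c] by (simp flip: ereal_real_rd)

lemma real_rd_le_dist: "\<lbrakk>x \<in> X; y \<in> X\<rbrakk> \<Longrightarrow> real_rd (\<phi> x) (\<phi> y) \<le> dist x y"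
  using reeb_dist_le_dist[of x y] by (simp add: phi_in flip: ereal_real_rd)

lemma real_rd_zero: "\<lbrakk>a \<in> \<C>; b \<in> \<C>\<rbrakk> \<Longrightarrow> real_rd a b = 0 \<longleftrightarrow> a = b"
proof
  assume *: "a \<in> \<C>" "b \<in> \<C>" "real_rd a b = 0"
  then show "a = b"
    using reeb_dist_pos[of a b] ereal_real_rd[of a b] by (auto simp: zero_ereal_def)
next
  assume "a \<in> \<C>" "b \<in> \<C>" "a = b"
  then obtain x where "x \<in> X" "a = \<phi> x" "b = \<phi> x"
    by (auto elim: contoursE)
  then show "real_rd a b = 0"
    using real_rd_le_dist[of x x] real_rd_nonneg[of a b] by simp
qed

lemma real_rd_self: "a \<in> \<C> \<Longrightarrow> real_rd a a = 0"
  using real_rd_zero by blast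

lemma dist_le_real_rd:
  assumes "x \<in> X" "y \<in> X"
  shows "dist x y \<le> real_rd (\<phi> x) (\<phi> y) + (2 * merging_count + 1) * diam"
proof -
  have "ereal (dist x y - (2 * merging_count + 1) * diam) \<le> rd (\<phi> x) (\<phi> y)"
    using assms by (intro reeb_dist_geI dist_le_variation) (auto simp: phi_self)
  then have "dist x y - (2 * merging_count + 1) * diam \<le> real_rd (\<phi> x) (\<phi> y)"
    using assms by (simp add: phi_in flip: ereal_real_rd)
  then show ?thesis
    by simp
qed

lemma distortion_le:
  "distortion X (\<lambda>x y. ereal (dist x y)) rd \<phi> \<le> ereal ((2 * merging_count + 1) * diam)"
  unfolding distortion_def
proof (rule SUP_least, clarify)
  fix x y assume xy: "x \<in> X" "y \<in> X"
  have "\<bar>dist x y - real_rd (\<phi> x) (\<phi> y)\<bar> \<le> (2 * merging_count + 1) * diam"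
    using real_rd_le_dist[OF xy] dist_le_real_rd[OF xy] by simp
  then show "\<bar>ereal (dist x y) - rd (\<phi> x) (\<phi> y)\<bar> \<le> ereal ((2 * merging_count + 1) * diam)"
    using xy by (simp add: phi_in flip: ereal_real_rd)
qed

text \<open>
  Since \<open>\<phi>\<close> does not increase distances, the usual correspondence metric on the disjoint union
  is simply \<open>\<delta>\<close> plus the distance in the Reeb graph for points on different sides.
\<close>

fun glue_dist :: "real \<Rightarrow> 'a + 'a set \<Rightarrow> 'a + 'a set \<Rightarrow> real" where
  "glue_dist \<delta> (Inl x) (Inl y) = dist x y"
| "glue_dist \<delta> (Inl x) (Inr b) = \<bar>\<delta>\<bar> + real_rd (\<phi> x) b"
| "glue_dist \<delta> (Inr a) (Inl y) = \<bar>\<delta>\<bar> + real_rd (\<phi> y) a"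
| "glue_dist \<delta> (Inr a) (Inr b) = real_rd a b"

lemma Metric_space_glue_dist:
  assumes \<delta>: "0 < \<delta>" "(2 * merging_count + 1) * diam \<le> 2 * \<delta>"
  shows "Metric_space (Inl ` X \<union> Inr ` \<C>) (glue_dist \<delta>)"
proof
  show "0 \<le> glue_dist \<delta> u v" for u v
    by (cases u; cases v) (simp_all add: real_rd_nonneg)
  show "glue_dist \<delta> u v = glue_dist \<delta> v u" for u v
    by (cases u; cases v) (simp_all add: dist_commute real_rd_commute)
  fix u v assume uv: "u \<in> Inl ` X \<union> Inr ` \<C>" "v \<in> Inl ` X \<union> Inr ` \<C>"
  have "0 < \<delta> + real_rd a b" for a b
    using \<delta>(1) real_rd_nonneg[of a b] by simp
  then show "glue_dist \<delta> u v = 0 \<longleftrightarrow> u = v"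
    using uv \<delta>(1) by (auto simp: real_rd_zero less_imp_neq[symmetric])
  fix w assume w: "w \<in> Inl ` X \<union> Inr ` \<C>"
  have sd: "\<bar>\<delta>\<bar> = \<delta>"
    using \<delta> by simp
  have tri1: "\<bar>\<delta>\<bar> + real_rd (\<phi> x) c \<le> dist x y + (\<bar>\<delta>\<bar> + real_rd (\<phi> y) c)"
    "\<bar>\<delta>\<bar> + real_rd (\<phi> x) c \<le> (\<bar>\<delta>\<bar> + real_rd (\<phi> y) c) + dist y x"
    if "x \<in> X" "y \<in> X" "c \<in> \<C>" for x y c
    using real_rd_le_dist[OF that(1,2)] real_rd_triangle[OF phi_in[OF that(1)] phi_in[OF that(2)] that(3)]
    by (auto simp: dist_commute)
  \<comment> \<open>This triangle fixes the size of \<delta>: a detour between two points of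
    \<open>X\<close> through a contour gains 2 \<delta>, which must cover the distortion.\<close>
  have tri2: "dist x y \<le> (\<bar>\<delta>\<bar> + real_rd (\<phi> x) a) + (\<bar>\<delta>\<bar> + real_rd (\<phi> y) a)"
    if "x \<in> X" "y \<in> X" "a \<in> \<C>" for x y a
    unfolding sd
    using dist_le_real_rd[OF that(1,2)] real_rd_triangle[OF phi_in[OF that(1)] that(3) phi_in[OF that(2)]] \<delta>(2)
      real_rd_commute[of a "\<phi> y"] by linarith
  have tri3: "\<bar>\<delta>\<bar> + real_rd (\<phi> x) b \<le> (\<bar>\<delta>\<bar> + real_rd (\<phi> x) a) + real_rd a b"
    "\<bar>\<delta>\<bar> + real_rd (\<phi> x) b \<le> real_rd b a + (\<bar>\<delta>\<bar> + real_rd (\<phi> x) a)"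
    if "x \<in> X" "a \<in> \<C>" "b \<in> \<C>" for x a b
    using real_rd_triangle[OF phi_in[OF that(1)] that(2,3)] real_rd_commute[of a b] by auto
  have tri4: "real_rd a b \<le> (\<bar>\<delta>\<bar> + real_rd (\<phi> x) a) + (\<bar>\<delta>\<bar> + real_rd (\<phi> x) b)"
    if "x \<in> X" "a \<in> \<C>" "b \<in> \<C>" for x a b
    using real_rd_triangle[OF that(2) phi_in[OF that(1)] that(3)] real_rd_commute[of a "\<phi> x"] \<delta>(1) by simp
  show "glue_dist \<delta> u w \<le> glue_dist \<delta> u v + glue_dist \<delta> v w"
    using uv w by (elim UnE imageE, simp_all only: glue_dist.simps)
      (rule dist_triangle | (rule tri1 tri2 tri3 tri4 real_rd_triangle; assumption))+
qed

lemma gh_dist_le: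
  "gh_dist X (\<lambda>x y. ereal (dist x y)) \<C> rd \<le> ereal ((merging_count + 1) * diam)"
proof (rule ereal_le_epsilon2)
  fix e :: real assume e: "0 < e"
  \<comment> \<open>The summand \<open>e / 2\<close> keeps \<delta> positive when
    \<open>diam\<close> is zero and leaves room for the strict inequality with
    \<open>r\<close>.\<close>
  define \<delta> where "\<delta> = (merging_count + 1) * diam + e / 2"
  have \<delta>0: "0 \<le> (merging_count + 1) * diam"
    by (intro mult_nonneg_nonneg diam_nonneg) simp
  then have \<delta>: "0 < \<delta>"
    using e by (simp add: \<delta>_def)
  have "(2 * real merging_count + 1) * diam \<le> (2 * real merging_count + 2) * diam"
    by (intro mult_right_mono diam_nonneg) simp
  then have \<delta>2: "(2 * merging_count + 1) * diam \<le> 2 * \<delta>"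
    using e by (simp add: \<delta>_def algebra_simps)
  define r where "r = (merging_count + 1) * diam + e"
  have "0 < r" "\<delta> < r"
    using e \<delta>0 by (simp_all add: r_def \<delta>_def)
  have "hausdorff_dist (glue_dist \<delta>) (Inl ` X) (Inr ` \<C>) \<le> ereal \<delta>"
  proof -
    have "(SUP a\<in>Inl ` X. INF b\<in>Inr ` \<C>. ereal (glue_dist \<delta> a b)) \<le> ereal \<delta>"
    proof (rule SUP_least, clarify)
      fix x assume x: "x \<in> X"
      show "(INF b\<in>Inr ` \<C>. ereal (glue_dist \<delta> (Inl x) b)) \<le> ereal \<delta>"
        by (rule INF_lower2[of "Inr (\<phi> x)"]) (use x \<delta> in \<open>simp_all add: phi_in real_rd_self\<close>)
    qed
    moreover have "(SUP b\<in>Inr ` \<C>. INF a\<in>Inl ` X. ereal (glue_dist \<delta> a b)) \<le> ereal \<delta>"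
    proof (rule SUP_least, clarify)
      fix C assume "C \<in> \<C>"
      then obtain x where x: "x \<in> X" "C = \<phi> x"
        by (rule contoursE)
      show "(INF a\<in>Inl ` X. ereal (glue_dist \<delta> a (Inr C))) \<le> ereal \<delta>"
        by (rule INF_lower2[of "Inl x"]) (use x \<delta> in \<open>simp_all add: phi_in real_rd_self\<close>)
    qed
    ultimately show ?thesis
      by (simp add: hausdorff_dist_def)
  qed
  also have "\<dots> < ereal r"
    using \<open>\<delta> < r\<close> by simp
  finally have "hausdorff_dist (glue_dist \<delta>) (Inl ` X) (Inr ` \<C>) < ereal r" .
  moreover have "isometric_embedding X (\<lambda>x y. ereal (dist x y)) (Inl ` X \<union> Inr ` \<C>) (glue_dist \<delta>) Inl"
    "isometric_embedding \<C> rd (Inl ` X \<union> Inr ` \<C>) (glue_dist \<delta>) Inr"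
    by (auto simp: isometric_embedding_def ereal_real_rd)
  ultimately have "gh_dist X (\<lambda>x y. ereal (dist x y)) \<C> rd \<le> ereal r"
    unfolding gh_dist_def using Metric_space_glue_dist[OF \<delta> \<delta>2] \<open>0 < r\<close> by (intro Inf_lower) blast
  then show "gh_dist X (\<lambda>x y. ereal (dist x y)) \<C> rd \<le> ereal ((merging_count + 1) * diam) + ereal e"
    by (simp add: r_def)
qed

end

section \<open>Merging contours and the co-rank\<close>

lemma finite_uniform_pos:
  fixes P :: "'b \<Rightarrow> real \<Rightarrow> bool"
  assumes "finite A" and ex: "\<And>a. a \<in> A \<Longrightarrow> \<exists>\<eta>>0. P a \<eta>"
    and mono: "\<And>a \<eta> \<eta>'. \<lbrakk>a \<in> A; P a \<eta>; 0 < \<eta>'; \<eta>' \<le> \<eta>\<rbrakk> \<Longrightarrow> P a \<eta>'"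
  shows "\<exists>\<eta>>0. \<forall>a\<in>A. P a \<eta>"
proof -
  obtain h where h: "\<And>a. a \<in> A \<Longrightarrow> 0 < h a \<and> P a (h a)"
    using ex by metis
  define \<eta> where "\<eta> = Min (insert 1 (h ` A))"
  have "0 < \<eta>" "\<And>a. a \<in> A \<Longrightarrow> \<eta> \<le> h a"
    using assms(1) h by (auto simp: \<eta>_def)
  then show ?thesis
    using h mono by blast
qed

section \<open>Tubes around contours and paths for the generating loops\<close>

context geodesic_reeb
begin

definition tube :: "'a set \<Rightarrow> real \<Rightarrow> 'a set" where
  "tube C \<delta> = {x \<in> X. \<exists>a\<in>C. dist a x < \<delta>}"

lemma tube_mono: "\<delta> \<le> \<delta>' \<Longrightarrow> tube C \<delta> \<subseteq> tube C \<delta>'"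
  by (force simp: tube_def)

lemma tube_step:
  assumes "x \<in> tube C \<delta>" "y \<in> X" "dist x y < \<delta>'"
  shows "y \<in> tube C (\<delta> + \<delta>')"
proof -
  obtain a where a: "a \<in> C" "dist a x < \<delta>"
    using assms(1) by (auto simp: tube_def)
  have "dist a y < \<delta> + \<delta>'"
    using a(2) assms(3) dist_triangle[of a y x] by linarith
  then show ?thesis
    using a(1) assms(2) by (auto simp: tube_def)
qed

text \<open>A contour is connected but perhaps not path-connected. Nearby points of it are joined by
  geodesics inside the tube, so path components of the tube are relatively open on the
  contour.\<close>

lemma contour_path:
  assumes C: "C \<in> \<C>" "x \<in> C" "y \<in> C" and "0 < \<delta>"
  obtains g where "path g" "path_image g \<subseteq> tube C \<delta>" "pathstart g = x" "pathfinish g = y"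
proof -
  have "path_component (tube C \<delta>) x y"
  proof (rule connected_equivalence_relation[OF contour_connected[OF C(1)] C(2,3)])
    show "path_component (tube C \<delta>) b a" if "path_component (tube C \<delta>) a b" for a b
      using that by (rule path_component_sym)
    show "path_component (tube C \<delta>) a c" if "path_component (tube C \<delta>) a b" "path_component (tube C \<delta>) b c" for a b c
      using that by (rule path_component_trans)
    fix a assume a: "a \<in> C"
    have "path_component (tube C \<delta>) a b" if b: "b \<in> C \<inter> ball a \<delta>" for b
    proof -
      have "a \<in> X" "b \<in> X"
        using contour_mem(1)[OF C(1)] a b by auto
      then obtain g where g: "path g" "path_image g \<subseteq> X \<inter> cball a (dist a b)" "pathstart g = a" "pathfinish g = b"
        using geodesic_in_ball by blast
      have "path_image g \<subseteq> tube C \<delta>"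
      proof
        fix q assume "q \<in> path_image g"
        then have "q \<in> X" "dist a q \<le> dist a b" "dist a b < \<delta>"
          using g(2) b by auto
        then show "q \<in> tube C \<delta>"
          using a by (force simp: tube_def)
      qed
      then show ?thesis
        unfolding path_component_def using g by blast
    qed
    then show "\<exists>T. openin (top_of_set C) T \<and> a \<in> T \<and> (\<forall>x\<in>T. path_component (tube C \<delta>) a x)"
      using a \<open>0 < \<delta>\<close> by (intro exI[of _ "C \<inter> ball a \<delta>"]) (auto intro: openin_open_Int)
  qed
  then show thesis
    unfolding path_component_def using that by blast
qed

text \<open>The ray at constant speed. It goes through the prescribed point \<open>z\<close> and
  meets the level of \<open>z\<close> nowhere else, which decides whether it passes through a given
  cut.\<close>

lemma ray_path:
  assumes "below x z"
  obtains g where "path g" "path_image g \<subseteq> X" "pathstart g = x" "pathfinish g = p"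
    "\<And>s t. \<lbrakk>0 \<le> s; s \<le> t; t \<le> 1\<rbrakk> \<Longrightarrow> below (g s) (g t)"
    "\<And>t. \<lbrakk>0 \<le> t; t \<le> 1\<rbrakk> \<Longrightarrow> f (g t) = (1 - t) * f x"
    "\<And>t. \<lbrakk>0 \<le> t; t \<le> 1; f (g t) = f z\<rbrakk> \<Longrightarrow> g t = z"
proof -
  obtain D where D: "\<And>l. \<lbrakk>0 \<le> l; l \<le> f x\<rbrakk> \<Longrightarrow> D l \<in> X \<and> f (D l) = l \<and> below x (D l)"
    "\<And>l l'. \<lbrakk>0 \<le> l; l \<le> l'; l' \<le> f x\<rbrakk> \<Longrightarrow> below (D l') (D l)"
    "D (f x) = x" "D (f z) = z" "D 0 = p"
    using ray[OF assms] by metis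
  define g where "g = (\<lambda>t. D ((1 - t) * f x))"
  have range: "0 \<le> (1 - t) * f x" "(1 - t) * f x \<le> f x" if "0 \<le> t" "t \<le> 1" for t
    using that by (auto intro: mult_left_le_one_le)
  have fg: "f (g t) = (1 - t) * f x" "g t \<in> X" if "0 \<le> t" "t \<le> 1" for t
    using D(1)[OF range[OF that]] by (auto simp: g_def)
  show thesis
  proof (rule that[of g])
    have "continuous_on {0..f x} D"
      using D(1,2) by (intro ray_continuous) auto
    then have "continuous_on {0..1} (D \<circ> (\<lambda>t. (1 - t) * f x))"
      using range by (intro continuous_on_compose continuous_intros) (auto elim!: continuous_on_subset)
    then show "path g"
      by (simp add: path_def g_def comp_def)
    show "path_image g \<subseteq> X"
      using fg(2) by (auto simp: path_image_def)
    show "pathstart g = x" "pathfinish g = p"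
      using D(3,5) by (auto simp: g_def pathstart_def pathfinish_def)
    show "below (g s) (g t)" if "0 \<le> s" "s \<le> t" "t \<le> 1" for s t
      unfolding g_def using that range[of s] range[of t] by (intro D(2) mult_right_mono) auto
    show "f (g t) = (1 - t) * f x" if "0 \<le> t" "t \<le> 1" for t
      using fg(1)[OF that] .
    show "g t = z" if "0 \<le> t" "t \<le> 1" "f (g t) = f z" for t
      using fg(1)[OF that(1,2)] that(3) D(4) by (simp add: g_def)
  qed
qed

end

context finite_geodesic_reeb
begin

lemma tubes_disjoint:
  assumes "C \<in> \<C>" "D \<in> \<C>" "C \<noteq> D"
  shows "\<exists>\<delta>>0. tube C \<delta> \<inter> tube D \<delta> = {}"
proof -
  obtain U V where UV: "openin R U" "openin R V" "C \<in> U" "D \<in> V" "disjnt U V"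
    using Hausdorff_R assms unfolding Hausdorff_space_def by (metis topspace_R)
  obtain d where d: "0 < d" "\<And>x y. \<lbrakk>x \<in> C; y \<in> X; dist x y < d\<rbrakk> \<Longrightarrow> \<phi> y \<in> U"
    using contour_nbhd[OF assms(1) UV(1,3)] by metis
  obtain d' where d': "0 < d'" "\<And>x y. \<lbrakk>x \<in> D; y \<in> X; dist x y < d'\<rbrakk> \<Longrightarrow> \<phi> y \<in> V"
    using contour_nbhd[OF assms(2) UV(2,4)] by metis
  have False if "x \<in> tube C (min d d')" "x \<in> tube D (min d d')" for x
  proof -
    obtain a b where "x \<in> X" "a \<in> C" "dist a x < d" "b \<in> D" "dist b x < d'"
      using \<open>x \<in> tube C (min d d')\<close> \<open>x \<in> tube D (min d d')\<close> by (auto simp: tube_def)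
    then have "\<phi> x \<in> U" "\<phi> x \<in> V"
      using d(2) d'(2) by blast+
    then show False
      using UV(5) by (auto simp: disjnt_iff)
  qed
  then show ?thesis
    using d(1) d'(1) by (intro exI[of _ "min d d'"]) auto
qed

lemma tube_isolated:
  assumes "C \<in> \<C>"
  shows "\<exists>\<delta>>0. \<forall>q\<in>tube C \<delta>. f q = lev C \<longrightarrow> q \<in> C"
proof -
  obtain \<epsilon> U V where U: "openin R U" "C \<in> U" "\<And>B. \<lbrakk>B \<in> U; lev B = lev C\<rbrakk> \<Longrightarrow> B = C"
    using contour_isolated[OF assms] by metis
  obtain d where d: "0 < d" "\<And>x y. \<lbrakk>x \<in> C; y \<in> X; dist x y < d\<rbrakk> \<Longrightarrow> \<phi> y \<in> U"
    using contour_nbhd[OF assms U(1,2)] by metis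
  have "q \<in> C" if q: "q \<in> tube C d" "f q = lev C" for q
  proof -
    have "q \<in> X" "\<phi> q \<in> U"
      using q d(2) by (auto simp: tube_def)
    then show ?thesis
      using U(3)[of "\<phi> q"] q(2) lev_phi phi_self by metis
  qed
  then show ?thesis
    using d(1) by blast
qed

text \<open>If \<open>D\<close> is lower, half the gap of levels keeps \<open>z\<close> above all of
  \<open>D\<close>. At equal levels both descents are short and remain in disjoint neighbourhoods.
  Hence a cut close below \<open>C\<close> is never met by descents from \<open>D\<close>.\<close>

lemma separate_descents:
  assumes C: "C \<in> \<C>" "D \<in> \<C>" "C \<noteq> D" "lev D \<le> lev C"
  shows "\<exists>\<eta>>0. \<forall>x\<in>C. \<forall>y\<in>D. \<forall>z w. below x z \<and> below y w \<and> lev C - \<eta> \<le> f z \<longrightarrow> \<phi> z \<noteq> \<phi> w"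
proof (cases "lev D = lev C")
  case True
  obtain U V where UV: "openin R U" "openin R V" "C \<in> U" "D \<in> V" "disjnt U V"
    using Hausdorff_R C unfolding Hausdorff_space_def by (metis topspace_R)
  obtain d where d: "0 < d" "\<And>x y. \<lbrakk>x \<in> C; y \<in> X; dist x y < d\<rbrakk> \<Longrightarrow> \<phi> y \<in> U"
    using contour_nbhd[OF C(1) UV(1,3)] by metis
  obtain d' where d': "0 < d'" "\<And>x y. \<lbrakk>x \<in> D; y \<in> X; dist x y < d'\<rbrakk> \<Longrightarrow> \<phi> y \<in> V"
    using contour_nbhd[OF C(2) UV(2,4)] by metis
  have "\<phi> z \<noteq> \<phi> w"
    if *: "x \<in> C" "y \<in> D" "below x z" "below y w" "lev C - min d d' / 2 \<le> f z" for x y z w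
  proof
    assume eq: "\<phi> z = \<phi> w"
    have X: "z \<in> X" "w \<in> X"
      using belowD * by blast+
    then have "f z = f w"
      using eq lev_phi by metis
    moreover have "f x = lev C" "f y = lev C"
      using contour_mem C * True by metis+
    ultimately have "dist x z < d" "dist y w < d'"
      using * d(1) d'(1) by (auto simp: below_def)
    then have "\<phi> z \<in> U" "\<phi> w \<in> V"
      using d(2) d'(2) * X by blast+
    then show False
      using UV(5) eq by (auto simp: disjnt_iff)
  qed
  then show ?thesis
    using d(1) d'(1) by (intro exI[of _ "min d d' / 2"]) auto
next
  case False
  have "\<phi> z \<noteq> \<phi> w"
    if *: "x \<in> C" "y \<in> D" "below x z" "below y w" "lev C - (lev C - lev D) / 2 \<le> f z" for x y z w
  proof
    assume eq: "\<phi> z = \<phi> w"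
    have "f z = f w"
      using eq lev_phi belowD * by metis
    moreover have "f w \<le> lev D"
      using contour_mem(3)[OF C(2) *(2)] belowD[OF *(4)] by simp
    ultimately show False
      using *(5) C(4) False by (simp add: field_simps)
  qed
  then show ?thesis
    using C(4) False by (intro exI[of _ "(lev C - lev D) / 2"]) auto
qed

end

text \<open>
  Every contour \<open>v \<in> M\<close> comes with two descents, from \<open>x0 v\<close> to \<open>z0 v\<close> and from \<open>y0 v\<close> to
  \<open>w0 v\<close>, that end in distinct contours at the same level.  The contour \<open>cut_of v\<close> of \<open>z0 v\<close> is the
  cut whose crossings are counted by the generator \<open>idx v\<close>.
\<close>

locale cut_system = finite_geodesic_reeb X p for X :: "'a::metric_space set" and p :: 'a +
  fixes M :: "'a set set" and idx :: "'a set \<Rightarrow> nat" and m :: nat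
    and x0 y0 z0 w0 :: "'a set \<Rightarrow> 'a" and \<delta>0 :: real
  assumes finite_M: "finite M" and idx: "bij_betw idx M {..<m}"
    and M_contour: "\<And>v. v \<in> M \<Longrightarrow> v \<in> contours X (dist p)"
    and x0: "\<And>v. v \<in> M \<Longrightarrow> x0 v \<in> v" and y0: "\<And>v. v \<in> M \<Longrightarrow> y0 v \<in> v"
    and z0: "\<And>v. v \<in> M \<Longrightarrow> geodesic_reeb.below X p (x0 v) (z0 v)"
    and w0: "\<And>v. v \<in> M \<Longrightarrow> geodesic_reeb.below X p (y0 v) (w0 v)"
    and level: "\<And>v. v \<in> M \<Longrightarrow> dist p (w0 v) = dist p (z0 v)"
    and level_less: "\<And>v. v \<in> M \<Longrightarrow> dist p (z0 v) < reeb_fun (dist p) v"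
    and branches: "\<And>v. v \<in> M \<Longrightarrow> w0 v \<notin> reeb_map X (dist p) (z0 v)"
    and avoid: "\<And>v v' x q. \<lbrakk>v \<in> M; v' \<in> M; v \<noteq> v'; reeb_fun (dist p) v' \<le> reeb_fun (dist p) v;
        x \<in> v'; geodesic_reeb.below X p x q\<rbrakk> \<Longrightarrow> q \<notin> reeb_map X (dist p) (z0 v)"
    and delta0: "0 < \<delta>0"
    and cuts_disjoint: "\<And>v v'. \<lbrakk>v \<in> M; v' \<in> M; v \<noteq> v'\<rbrakk> \<Longrightarrow>
        geodesic_reeb.tube X (reeb_map X (dist p) (z0 v)) \<delta>0
          \<inter> geodesic_reeb.tube X (reeb_map X (dist p) (z0 v')) \<delta>0 = {}"
    and cuts_avoid_M: "\<And>v v'. \<lbrakk>v \<in> M; v' \<in> M\<rbrakk> \<Longrightarrow>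
        geodesic_reeb.tube X (reeb_map X (dist p) (z0 v)) \<delta>0 \<inter> geodesic_reeb.tube X v' \<delta>0 = {}"
    and cut_isolated: "\<And>v q. \<lbrakk>v \<in> M; q \<in> geodesic_reeb.tube X (reeb_map X (dist p) (z0 v)) (2 * \<delta>0);
        dist p q = dist p (z0 v)\<rbrakk> \<Longrightarrow> q \<in> reeb_map X (dist p) (z0 v)"
begin

section \<open>Signed crossings with the cuts\<close>

abbreviation "cut_of v \<equiv> \<phi> (z0 v)"
abbreviation "\<rho> v \<equiv> f (z0 v)"
abbreviation "U v \<equiv> tube (cut_of v) \<delta>0"
text \<open>A quarter, because \<open>crosses_near\<close> adds three distances below \<delta> and
  has to stay below \<open>\<delta>0\<close>.\<close>

abbreviation "\<delta> \<equiv> \<delta>0 / 4"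
abbreviation "F \<equiv> free_group {..<m}"

definition above :: "'a set \<Rightarrow> 'a \<Rightarrow> bool" where "above v x \<longleftrightarrow> \<rho> v \<le> f x"

text \<open>Both points must be close to the cut: passing the level \<open>\<rho> v\<close> in a
  different part of \<open>X\<close> does not count.\<close>

definition crosses :: "'a set \<Rightarrow> 'a \<Rightarrow> 'a \<Rightarrow> bool" where
  "crosses v x y \<longleftrightarrow> v \<in> M \<and> x \<in> U v \<and> y \<in> U v \<and> above v x \<noteq> above v y"

text \<open>The tubes of different cuts are disjoint, so at most one \<open>v\<close> qualifies. The
  letter is positive when the step from \<open>x\<close> to \<open>y\<close> goes upwards.\<close>

definition crossing :: "'a \<Rightarrow> 'a \<Rightarrow> (nat \<times> bool) list" where
  "crossing x y = (if \<exists>v. crosses v x y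
     then let v = (THE v. crosses v x y) in [(idx v, above v y)] else [])"

lemma U_unique: "\<lbrakk>v \<in> M; v' \<in> M; x \<in> U v; x \<in> U v'\<rbrakk> \<Longrightarrow> v = v'"
  using cuts_disjoint by blast

lemma crossing_eq:
  assumes "crosses v x y"
  shows "crossing x y = [(idx v, above v y)]"
proof -
  have "(THE v. crosses v x y) = v"
  proof (rule the_equality)
    show "crosses v x y"
      by (rule assms)
    show "v' = v" if "crosses v' x y" for v'
      using that assms U_unique unfolding crosses_def by blast
  qed
  then show ?thesis
    using assms by (auto simp: crossing_def)
qed

lemma z0_in: "v \<in> M \<Longrightarrow> z0 v \<in> X"
  using belowD z0 by blast

text \<open>Since \<open>x\<close> is below the level of the cut, the drop from \<open>y\<close> to
  that level is less than \<open>dist x y\<close>. So \<open>q\<close> stays within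
  \<open>2 * \<delta>0\<close> of the cut, where the cut is the only part of its level.\<close>

lemma cross_near_cut:
  assumes v: "v \<in> M" and y: "y \<in> U v" "above v y" and x: "\<not> above v x" "dist x y < \<delta>"
    and q: "below y q" "f q = \<rho> v"
  shows "q \<in> cut_of v" "dist y q < \<delta>"
proof -
  show d: "dist y q < \<delta>"
    using q x abs_f_diff[of x y] by (auto simp: below_def above_def)
  have "q \<in> tube (cut_of v) (\<delta>0 + \<delta>)"
    using tube_step[OF y(1) _ d] belowD[OF q(1)] by simp
  then have "q \<in> tube (cut_of v) (2 * \<delta>0)"
    using tube_mono[of "\<delta>0 + \<delta>" "2 * \<delta>0"] delta0 by auto
  then show "q \<in> cut_of v"
    using cut_isolated[OF v] q(2) by simp
qed

text \<open>The upper of the two crossing points is within \<delta> of the cut itself, which leaves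
  room in the tube for any third nearby point.\<close>

lemma crosses_near:
  assumes "crosses v x y" "dist x y < \<delta>" "u \<in> X" "dist x u < \<delta>"
  shows "u \<in> U v"
proof -
  have v: "v \<in> M"
    using assms by (simp add: crosses_def)
  have near: "\<exists>q\<in>cut_of v. dist b q < \<delta>"
    if ab: "a \<in> U v" "b \<in> U v" "above v b" "\<not> above v a" "dist a b < \<delta>" for a b
  proof -
    have "b \<in> X"
      using ab by (simp add: tube_def)
    then obtain q where "below b q" "f q = \<rho> v"
      using below_between[OF below_p, of b "\<rho> v"] ab(3) by (auto simp: above_def)
    then show ?thesis
      using cross_near_cut[OF v ab(2,3,4,5)] by blast
  qed
  obtain q where q: "q \<in> cut_of v" "dist x q < \<delta> \<or> dist y q < \<delta>"
    using near[of x y] near[of y x] assms(1,2) by (auto simp: crosses_def dist_commute)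
  have "dist q u < \<delta>0"
    using q(2) assms(2,4) delta0 dist_triangle[of q u x] dist_triangle[of q x y]
    by (auto simp: dist_commute)
  then show ?thesis
    using q(1) assms(3) by (auto simp: tube_def)
qed

lemma crossing_on_U:
  assumes "v \<in> M" "x \<in> U v" "y \<in> U v"
  shows "crossing x y = (if above v x \<noteq> above v y then [(idx v, above v y)] else [])"
proof (cases "above v x \<noteq> above v y")
  case True
  then show ?thesis
    using crossing_eq[of v x y] assms by (simp add: crosses_def)
next
  case False
  then have "\<not> crosses v' x y" for v'
    using U_unique[OF assms(1) _ assms(2)] by (auto simp: crosses_def)
  then show ?thesis
    using False by (simp add: crossing_def)
qed

text \<open>If one of the three pairs crosses, all three points lie in the same \<open>U v\<close>,
  and there \<open>crossing\<close> is the coboundary of the two-valued function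
  \<open>above v\<close>.\<close>

lemma crossing_cocycle:
  assumes X: "x \<in> X" "y \<in> X" "u \<in> X" and d: "dist x y < \<delta>" "dist y u < \<delta>" "dist x u < \<delta>"
  shows "crossing x y \<otimes>\<^bsub>F\<^esub> crossing y u = crossing x u"
proof (cases "\<exists>v. crosses v x y \<or> crosses v y u \<or> crosses v x u")
  case True
  then obtain v where v: "crosses v x y \<or> crosses v y u \<or> crosses v x u"
    by blast
  then have "v \<in> M"
    by (auto simp: crosses_def)
  moreover have near: "a \<in> U v \<and> b \<in> U v \<and> w \<in> U v"
    if "crosses v a b" "dist a b < \<delta>" "w \<in> X" "dist a w < \<delta>" for a b w
    using crosses_near[OF that] that(1) by (simp add: crosses_def)
  have "x \<in> U v \<and> y \<in> U v \<and> u \<in> U v"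
    using v
  proof (elim disjE)
    assume "crosses v x y"
    then show ?thesis
      using near[OF _ d(1) X(3) d(3)] by blast
  next
    assume "crosses v y u"
    moreover have "dist y x < \<delta>"
      using d(1) by (simp add: dist_commute)
    ultimately show ?thesis
      using near[OF _ d(2) X(1)] by blast
  next
    assume "crosses v x u"
    then show ?thesis
      using near[OF _ d(3) X(2) d(1)] by blast
  qed
  ultimately show ?thesis
    by (auto simp: crossing_on_U free_group_def push_letter_def inv_letter_def)
next
  case False
  then show ?thesis
    by (simp add: crossing_def free_group_def)
qed

lemma crossing_cases:
  obtains "crossing x y = []" | v where "crosses v x y" "crossing x y = [(idx v, above v y)]"
proof (cases "\<exists>v. crosses v x y")
  case True
  then show thesis
    using crossing_eq that(2) by blast
next
  case False
  then show thesis
    by (intro that(1)) (simp add: crossing_def)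
qed

lemma idx_less: "v \<in> M \<Longrightarrow> idx v < m"
  using idx by (auto simp: bij_betw_def)

lemma crossing_closed: "crossing x y \<in> carrier F"
  by (cases rule: crossing_cases[of x y])
    (auto simp: crosses_def intro!: letter_in_free_group idx_less, simp add: free_group_def)

sublocale local_cocycle F X \<delta> crossing
proof (intro local_cocycle.intro local_cocycle_axioms.intro group_free_group)
  show "0 < \<delta>"
    using delta0 by simp
qed (auto intro: crossing_closed crossing_cocycle)

text \<open>Levels do not increase, so every crossing is downward. By continuity it passes through a
  point of the cut, which is then below \<open>x\<close>; by \<open>avoid\<close> the cut belongs to
  \<open>v\<close> or to a strictly lower contour.\<close>

lemma descent_crosses:
  assumes v: "v \<in> M" "x \<in> v" and g: "path g" "g 0 = x"
    and all_below: "\<forall>s t. 0 \<le> s \<and> s \<le> t \<and> t \<le> 1 \<longrightarrow> below (g s) (g t)"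
    and st: "0 \<le> s" "s \<le> t" "t \<le> 1" "dist (g s) (g t) < \<delta>" and cr: "crosses u (g s) (g t)"
  shows "above u (g s)" "\<not> above u (g t)" "u = v \<or> lev u < lev v"
    "\<exists>r. s \<le> r \<and> r \<le> t \<and> f (g r) = \<rho> u \<and> g r \<in> cut_of u"
proof -
  have below_g: "below (g s) (g t)" if "0 \<le> s" "s \<le> t" "t \<le> 1" for s t
    using all_below that by blast
  have u: "u \<in> M" "g s \<in> U u"
    using cr by (auto simp: crosses_def)
  have "f (g t) \<le> f (g s)"
    using belowD[OF below_g[OF st(1-3)]] by simp
  then show ab: "above u (g s)" "\<not> above u (g t)"
    using cr by (auto simp: crosses_def above_def)
  have "continuous_on {s..t} (\<lambda>t. f (g t))"
    using g(1) st unfolding path_def by (intro continuous_intros) (auto elim!: continuous_on_subset)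
  then obtain r where r: "s \<le> r" "r \<le> t" "f (g r) = \<rho> u"
    using IVT2'[of "\<lambda>t. f (g t)" t "\<rho> u" s] ab st(2) by (auto simp: above_def)
  have gr: "g r \<in> cut_of u"
  proof (rule cross_near_cut(1)[OF u ab])
    show "dist (g t) (g s) < \<delta>"
      using st(4) by (simp add: dist_commute)
    show "below (g s) (g r)"
      using r st by (intro below_g) auto
  qed (rule r(3))
  then show "\<exists>r. s \<le> r \<and> r \<le> t \<and> f (g r) = \<rho> u \<and> g r \<in> cut_of u"
    using r by blast
  have "below x (g r)"
    using below_g[of 0 r] g(2) r st by auto
  then show "u = v \<or> lev u < lev v"
    using avoid[OF u(1) v(1) _ _ v(2), of "g r"] gr by (meson linorder_not_le)
qed

text \<open>
  The loop runs up to \<open>x0 v\<close>, along \<open>v\<close> to \<open>y0 v\<close> and down again.  It crosses \<open>cut_of v\<close> exactly once,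
  on the way up, and otherwise only cuts belonging to contours strictly below \<open>v\<close>.
\<close>

lemma generator_in_image:
  assumes v: "v \<in> M"
    and IH: "\<And>u. \<lbrakk>u \<in> M; lev u < lev v\<rbrakk> \<Longrightarrow> [(idx u, True)] \<in> hol ` loops_at X p"
  shows "[(idx v, True)] \<in> hol ` loops_at X p"
proof -
  define H where "H = hol ` loops_at X p"
  have H: "subgroup H F"
    unfolding H_def by (rule subgroup_hol_loops[OF p_in])
  note H_mult = subgroup.m_closed[OF H] and H_inv = subgroup.m_inv_closed[OF H]
  have H_carrier: "a \<in> carrier F" if "a \<in> H" for a
    using subgroup.mem_carrier[OF H that] .
  have one: "[] \<in> H"
    using subgroup.one_closed[OF H] by (simp add: free_group_def)
  have inv_letter_H: "[(idx u, \<not> b)] \<in> H" if "[(idx u, b)] \<in> H" "u \<in> M" for u b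
    using H_inv[OF that(1)] inv_letter_free_group[of "idx u" "{..<m}" b] idx_less[OF that(2)] by simp
  have low: "[(idx u, False)] \<in> H" if "u \<in> M" "lev u < lev v" for u
    using inv_letter_H[of u True] IH[OF that] that(1) by (simp add: H_def)
  have xv: "x0 v \<in> v" "y0 v \<in> v" "x0 v \<in> X" "f (x0 v) = lev v"
    using x0[OF v] y0[OF v] contour_mem[OF M_contour[OF v]] by auto
  obtain \<sigma> where \<sigma>: "path \<sigma>" "path_image \<sigma> \<subseteq> X" "pathstart \<sigma> = x0 v" "pathfinish \<sigma> = p"
    "\<And>s t. \<lbrakk>0 \<le> s; s \<le> t; t \<le> 1\<rbrakk> \<Longrightarrow> below (\<sigma> s) (\<sigma> t)"
    "\<And>t. \<lbrakk>0 \<le> t; t \<le> 1\<rbrakk> \<Longrightarrow> f (\<sigma> t) = (1 - t) * f (x0 v)"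
    "\<And>t. \<lbrakk>0 \<le> t; t \<le> 1; f (\<sigma> t) = f (z0 v)\<rbrakk> \<Longrightarrow> \<sigma> t = z0 v"
    using ray_path[OF z0[OF v]] by metis
  obtain \<tau> where \<tau>: "path \<tau>" "path_image \<tau> \<subseteq> X" "pathstart \<tau> = y0 v" "pathfinish \<tau> = p"
    "\<And>s t. \<lbrakk>0 \<le> s; s \<le> t; t \<le> 1\<rbrakk> \<Longrightarrow> below (\<tau> s) (\<tau> t)"
    "\<And>t. \<lbrakk>0 \<le> t; t \<le> 1; f (\<tau> t) = f (w0 v)\<rbrakk> \<Longrightarrow> \<tau> t = w0 v"
    using ray_path[OF w0[OF v]] by metis
  obtain \<kappa> where \<kappa>: "path \<kappa>" "path_image \<kappa> \<subseteq> tube v \<delta>0" "pathstart \<kappa> = x0 v" "pathfinish \<kappa> = y0 v"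
    using contour_path[OF M_contour[OF v] xv(1,2) delta0] by metis
  have \<kappa>X: "path_image \<kappa> \<subseteq> X"
    using \<kappa>(2) by (auto simp: tube_def)
  have \<sigma>0: "\<sigma> 0 = x0 v" and \<tau>0: "\<tau> 0 = y0 v"
    using \<sigma>(3) \<tau>(3) by (simp_all add: pathstart_def)
  have "\<forall>s t. 0 \<le> s \<and> s \<le> t \<and> t \<le> 1 \<longrightarrow> below (\<sigma> s) (\<sigma> t)"
    "\<forall>s t. 0 \<le> s \<and> s \<le> t \<and> t \<le> 1 \<longrightarrow> below (\<tau> s) (\<tau> t)"
    using \<sigma>(5) \<tau>(5) by blast+
  note \<sigma>_crosses = descent_crosses[OF v xv(1) \<sigma>(1) \<sigma>0 this(1)]
    and \<tau>_crosses = descent_crosses[OF v xv(2) \<tau>(1) \<tau>0 this(2)]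

  \<comment> \<open>The connecting path stays in the tube of \<open>v\<close>, which is disjoint
    from all tubes of cuts.\<close>
  have "hol \<kappa> \<in> {\<one>\<^bsub>F\<^esub>}"
  proof (rule hol_in_subgroup[OF \<kappa>(1) \<kappa>X triv_subgroup])
    fix s t :: real assume "0 \<le> s" "s \<le> t" "t \<le> 1"
    then have "\<kappa> s \<in> tube v \<delta>0"
      using \<kappa>(2) by (auto simp: path_image_def)
    then have "\<not> crosses u (\<kappa> s) (\<kappa> t)" for u
      using cuts_avoid_M[of u v] v by (auto simp: crosses_def)
    then show "crossing (\<kappa> s) (\<kappa> t) \<in> {\<one>\<^bsub>F\<^esub>}"
      by (simp add: crossing_def free_group_def)
  qed
  then have hol\<kappa>: "hol \<kappa> = \<one>\<^bsub>F\<^esub>"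
    by simp

  \<comment> \<open>The descent \<tau> meets the level of \<open>cut_of v\<close> only at
    \<open>w0 v\<close>, which is on another branch. All other cuts it crosses have generators in
    \<open>H\<close> by induction.\<close>
  have hol\<tau>: "hol \<tau> \<in> H"
  proof (rule hol_in_subgroup[OF \<tau>(1,2) H])
    fix s t :: real assume st: "0 \<le> s" "s \<le> t" "t \<le> 1" "dist (\<tau> s) (\<tau> t) < \<delta>"
    show "crossing (\<tau> s) (\<tau> t) \<in> H"
    proof (cases rule: crossing_cases[of "\<tau> s" "\<tau> t"])
      case 1
      then show ?thesis
        using one by simp
    next
      case (2 u)
      have "u \<noteq> v"
      proof
        assume "u = v"
        then obtain r where "s \<le> r" "r \<le> t" "f (\<tau> r) = \<rho> v" "\<tau> r \<in> cut_of v"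
          using \<tau>_crosses(4)[OF st 2(1)] by blast
        then show False
          using \<tau>(6)[of r] level[OF v] branches[OF v] st by auto
      qed
      then show ?thesis
        using \<tau>_crosses(2,3)[OF st 2(1)] 2 low[of u] by (auto simp: crosses_def)
    qed
  qed

  define \<omega> where "\<omega> = reversepath \<sigma> +++ (\<kappa> +++ \<tau>)"
  have "\<omega> \<in> loops_at X p"
    using \<sigma>(1-4) \<tau>(1-4) \<kappa> \<kappa>X by (auto simp: loops_at_def \<omega>_def path_image_join)
  then have "hol \<omega> \<in> H"
    by (simp add: H_def)
  moreover have "hol \<omega> = inv\<^bsub>F\<^esub> (hol \<sigma>) \<otimes>\<^bsub>F\<^esub> hol \<tau>"
    using \<sigma>(1-4) \<tau>(1-4) \<kappa> \<kappa>X hol\<kappa> hol_closed[OF \<tau>(1,2)]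
    by (simp add: \<omega>_def hol_join hol_reversepath path_image_join)
  moreover have \<sigma>c: "hol \<sigma> \<in> carrier F"
    by (rule hol_closed[OF \<sigma>(1,2)])
  \<comment> \<open>Solves the holonomy of the loop \<omega> for \<open>hol \<sigma>\<close>, as
    \<open>hol \<tau>\<close> is already in \<open>H\<close>.\<close>
  ultimately have "hol \<tau> \<otimes>\<^bsub>F\<^esub> inv\<^bsub>F\<^esub> (inv\<^bsub>F\<^esub> (hol \<sigma>) \<otimes>\<^bsub>F\<^esub> hol \<tau>) \<in> H"
    using H_mult[OF hol\<tau> H_inv] by metis
  then have hol\<sigma>: "hol \<sigma> \<in> H"
    using \<sigma>c H_carrier[OF hol\<tau>] by (simp add: inv_mult_group flip: m_assoc)

  have \<rho>: "0 < \<rho> v" "\<rho> v < f (x0 v)"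
  proof -
    \<comment> \<open>At level zero both branches would end at \<open>p\<close>.\<close>
    have "\<rho> v \<noteq> 0"
    proof
      assume "\<rho> v = 0"
      then have "z0 v = p" "w0 v = p"
        using level[OF v] by auto
      then show False
        using branches[OF v] phi_self[OF p_in] by simp
    qed
    then show "0 < \<rho> v"
      using zero_le_dist[of p "z0 v"] by linarith
    show "\<rho> v < f (x0 v)"
      using level_less[OF v] xv(4) by simp
  qed
  define r where "r = 1 - \<rho> v / f (x0 v)"
  have fx: "0 < f (x0 v)"
    using \<rho> by linarith
  have r: "0 < r" "r < 1"
    using divide_pos_pos[OF \<rho>(1) fx] divide_less_eq_1_pos[THEN iffD2, OF fx \<rho>(2)] by (simp_all only: r_def)
  have r_eq: "(1 - r) * f (x0 v) = \<rho> v"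
    using fx by (simp add: r_def)
  have above_iff: "above v (\<sigma> t) \<longleftrightarrow> t \<le> r" if "0 \<le> t" "t \<le> 1" for t
    unfolding above_def \<sigma>(6)[OF that] r_eq[symmetric] mult_le_cancel_right_pos[OF fx] by simp
  have no_cross: "crossing (\<sigma> s) (\<sigma> t) \<in> H"
    if st: "0 \<le> s" "s \<le> t" "t \<le> 1" "dist (\<sigma> s) (\<sigma> t) < \<delta>" and side: "t \<le> r \<or> r < s" for s t
  proof (cases rule: crossing_cases[of "\<sigma> s" "\<sigma> t"])
    case 1
    then show ?thesis
      using one by simp
  next
    case (2 u)
    have "u \<noteq> v"
      using 2(1) side above_iff[of s] above_iff[of t] st by (auto simp: crosses_def)
    then show ?thesis
      using \<sigma>_crosses(2,3)[OF st 2(1)] 2 low[of u] by (auto simp: crosses_def)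
  qed
  obtain L where L: "path_lift \<sigma> L"
    using path_lift_exists[OF \<sigma>(1,2)] by blast
  obtain \<eta> where eta: "0 < \<eta>"
    "\<And>s t. \<lbrakk>s \<in> {0..1}; t \<in> {0..1}; \<bar>s - t\<bar> < \<eta>\<rbrakk> \<Longrightarrow> L t = L s \<otimes>\<^bsub>F\<^esub> crossing (\<sigma> s) (\<sigma> t)"
    using path_liftE[OF L] by metis
  \<comment> \<open>The three bounds keep the step short enough for the lift relation, inside the
    unit interval, and within \<open>\<delta>0\<close> of \<open>z0 v\<close>.\<close>
  define e where "e = min (\<eta> / 2) (min (1 - r) (\<delta>0 / (2 * f (x0 v))))"
  have e: "0 < e" "e < \<eta>" "r + e \<le> 1" "e * f (x0 v) < \<delta>0"
  proof -
    show "0 < e" "e < \<eta>" "r + e \<le> 1"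
      using eta(1) r divide_pos_pos[of \<delta>0 "2 * f (x0 v)"] delta0 fx unfolding e_def by linarith+
    have "e * f (x0 v) \<le> \<delta>0 / (2 * f (x0 v)) * f (x0 v)"
      by (intro mult_right_mono) (auto simp: e_def)
    also have "\<dots> < \<delta>0"
      using fx delta0 by simp
    finally show "e * f (x0 v) < \<delta>0" .
  qed
  have \<sigma>r: "\<sigma> r = z0 v"
    using \<sigma>(6,7)[of r] r r_eq by simp
  have "dist (\<sigma> r) (\<sigma> (r + e)) < \<delta>0"
  proof -
    have "below (\<sigma> r) (\<sigma> (r + e))"
      using r e by (intro \<sigma>(5)) auto
    then have "dist (\<sigma> r) (\<sigma> (r + e)) = (1 - r) * f (x0 v) - (1 - (r + e)) * f (x0 v)"
      using \<sigma>(6)[of r] \<sigma>(6)[of "r + e"] r e by (simp add: below_def)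
    then show ?thesis
      using e(4) by (simp add: algebra_simps)
  qed
  moreover have "\<sigma> (r + e) \<in> X" "z0 v \<in> cut_of v"
    using path_mem[OF \<sigma>(2)] r e z0_in[OF v] phi_self by auto
  ultimately have "\<sigma> (r + e) \<in> U v" "\<sigma> r \<in> U v"
    using \<sigma>r delta0 z0_in[OF v] unfolding tube_def by (auto intro!: bexI[of _ "z0 v"])
  \<comment> \<open>\<open>above\<close> includes the level of the cut, so \<open>\<sigma> r\<close>
    still counts as above and the crossing happens just after \<open>r\<close>.\<close>
  then have cross: "crossing (\<sigma> r) (\<sigma> (r + e)) = [(idx v, False)]"
    using crossing_on_U[OF v, of "\<sigma> r" "\<sigma> (r + e)"] above_iff[of r] above_iff[of "r + e"] r e by simp
  have Lc: "L 0 \<in> carrier F" "L r \<in> carrier F" "L (r + e) \<in> carrier F" "L 1 \<in> carrier F"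
    using path_lift_closed[OF L] r e by auto
  define h where "h = inv\<^bsub>F\<^esub> (L 0) \<otimes>\<^bsub>F\<^esub> L r"
  define h' where "h' = inv\<^bsub>F\<^esub> (L (r + e)) \<otimes>\<^bsub>F\<^esub> L 1"
  have "h \<in> H"
    unfolding h_def by (rule path_lift_subgroup[OF \<sigma>(1,2) L H]) (use r in \<open>auto intro!: no_cross\<close>)
  have "h' \<in> H"
    unfolding h'_def by (rule path_lift_subgroup[OF \<sigma>(1,2) L H]) (use r e in \<open>auto intro!: no_cross\<close>)
  define a where "a = [(idx v, False)]"
  have a: "a \<in> carrier F"
    unfolding a_def using idx_less[OF v] by (intro letter_in_free_group) simp
  have La: "L (r + e) = L r \<otimes>\<^bsub>F\<^esub> a"
    unfolding a_def cross[symmetric] using r e by (intro eta) auto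
  have "a = inv\<^bsub>F\<^esub> (L r) \<otimes>\<^bsub>F\<^esub> L (r + e)"
    using La Lc a by (simp flip: m_assoc)
  moreover have "hol \<sigma> = inv\<^bsub>F\<^esub> (L 0) \<otimes>\<^bsub>F\<^esub> L 1"
    by (rule hol_eqI[OF \<sigma>(2) L])
  moreover have "inv\<^bsub>F\<^esub> (L 0) \<otimes>\<^bsub>F\<^esub> L 1 = h \<otimes>\<^bsub>F\<^esub> (inv\<^bsub>F\<^esub> (L r) \<otimes>\<^bsub>F\<^esub> L (r + e)) \<otimes>\<^bsub>F\<^esub> h'"
    unfolding h_def h'_def using Lc by (simp add: inv_mult_telescope)
  \<comment> \<open>The parts before \<open>r\<close> and after \<open>r + e\<close> contribute
    elements of \<open>H\<close>, so the one remaining letter is in \<open>H\<close> too.\<close>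
  ultimately have "hol \<sigma> = h \<otimes>\<^bsub>F\<^esub> a \<otimes>\<^bsub>F\<^esub> h'"
    by simp
  then have "inv\<^bsub>F\<^esub> h \<otimes>\<^bsub>F\<^esub> hol \<sigma> \<otimes>\<^bsub>F\<^esub> inv\<^bsub>F\<^esub> h' = a"
    using H_carrier[OF \<open>h \<in> H\<close>] H_carrier[OF \<open>h' \<in> H\<close>] a
    by (simp add: m_assoc) (simp flip: m_assoc)
  then have "a \<in> H"
    using \<open>h \<in> H\<close> \<open>h' \<in> H\<close> hol\<sigma> H_mult H_inv by metis
  then show ?thesis
    using inv_letter_H[of v False] v by (simp add: a_def H_def)
qed

lemma epi_onto_free_group: "epi (fundamental_group X p) (free_group {..<m}) \<noteq> {}"
proof (rule epi_fundamental_group[OF p_in])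
  have gen: "[(idx v, True)] \<in> hol ` loops_at X p" if "v \<in> M" for v
    using that
  proof (induction "card {u \<in> M. lev u < lev v}" arbitrary: v rule: less_induct)
    case less
    show ?case
    proof (rule generator_in_image[OF less.prems])
      fix u assume u: "u \<in> M" "lev u < lev v"
      have "{w \<in> M. lev w < lev u} \<subset> {w \<in> M. lev w < lev v}"
        using u by auto
      then show "[(idx u, True)] \<in> hol ` loops_at X p"
        using u finite_M by (intro less.hyps psubset_card_mono) auto
    qed
  qed
  have "hol ` loops_at X p = carrier F"
  proof (rule subgroup_free_group_eq_carrier[OF subgroup_hol_loops[OF p_in]])
    fix s assume "s \<in> {..<m}"
    then obtain v where "v \<in> M" "s = idx v"
      using idx by (auto simp: bij_betw_def)
    then show "[(s, True)] \<in> hol ` loops_at X p"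
      using gen by simp
  qed
  then show "carrier F \<subseteq> hol ` loops_at X p"
    by simp
qed

end

section \<open>Choice of the cuts for all merging contours\<close>

context finite_geodesic_reeb
begin

text \<open>The order of choices matters: first an \<eta> that separates the descents of all pairs
  of merging contours, then branches within \<eta> below each of them, and last a tube radius for
  the finitely many cuts so obtained.\<close>

lemma merging_count_le_corank: "enat merging_count \<le> corank (fundamental_group X p)"
proof -
  define M where "M = {D. merging D}"
  have finM: "finite M"
    unfolding M_def by (rule finite_level_and_merging(2))
  have MC: "v \<in> \<C>" if "v \<in> M" for v
    using that by (simp add: M_def merging_def)
  define pairs where "pairs = {(v, v') \<in> M \<times> M. v \<noteq> v' \<and> lev v' \<le> lev v}"
  have "\<exists>\<eta>>0. \<forall>a\<in>pairs. case a of (C, D) \<Rightarrow>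
      \<forall>x\<in>C. \<forall>y\<in>D. \<forall>z w. below x z \<and> below y w \<and> lev C - \<eta> \<le> f z \<longrightarrow> \<phi> z \<noteq> \<phi> w"
  proof (rule finite_uniform_pos)
    show "finite pairs"
      using finM by (auto simp: pairs_def intro: finite_subset[of _ "M \<times> M"])
    show "\<exists>\<eta>>0. case a of (C, D) \<Rightarrow>
      \<forall>x\<in>C. \<forall>y\<in>D. \<forall>z w. below x z \<and> below y w \<and> lev C - \<eta> \<le> f z \<longrightarrow> \<phi> z \<noteq> \<phi> w" if "a \<in> pairs" for a
    proof -
      obtain C D where "a = (C, D)" "C \<in> M" "D \<in> M" "C \<noteq> D" "lev D \<le> lev C"
        using \<open>a \<in> pairs\<close> unfolding pairs_def by blast
      then show ?thesis
        using separate_descents[OF MC MC] by simp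
    qed
  qed force
  then obtain \<eta> where eta: "0 < \<eta>" and all_pairs: "\<forall>a\<in>pairs. case a of (C, D) \<Rightarrow>
      \<forall>x\<in>C. \<forall>y\<in>D. \<forall>z w. below x z \<and> below y w \<and> lev C - \<eta> \<le> f z \<longrightarrow> \<phi> z \<noteq> \<phi> w"
    by (elim exE conjE)
  have sep: "\<phi> z \<noteq> \<phi> w" if v: "v \<in> M" "v' \<in> M" "v \<noteq> v'" "lev v' \<le> lev v"
    and xy: "x \<in> v" "y \<in> v'" "below x z" "below y w" "lev v - \<eta> \<le> f z" for v v' x y z w
  proof -
    have "(v, v') \<in> pairs"
      using v by (simp add: pairs_def)
    from bspec[OF all_pairs this] show ?thesis
      using xy by blast
  qed
  have "\<exists>x y z w. x \<in> v \<and> y \<in> v \<and> below x z \<and> below y w \<and> f z = f w \<and>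
     lev v - \<eta> \<le> f z \<and> f z < lev v \<and> \<phi> z \<noteq> \<phi> w" if "v \<in> M" for v
  proof -
    have "lev v - \<eta> < lev v"
      using eta by simp
    then show ?thesis
      using that unfolding M_def merging_def by blast
  qed
  then obtain x0 y0 z0 w0 where data: "\<And>v. v \<in> M \<Longrightarrow> x0 v \<in> v \<and> y0 v \<in> v \<and> below (x0 v) (z0 v) \<and>
     below (y0 v) (w0 v) \<and> f (z0 v) = f (w0 v) \<and> lev v - \<eta> \<le> f (z0 v) \<and> f (z0 v) < lev v \<and>
     \<phi> (z0 v) \<noteq> \<phi> (w0 v)"
    by metis
  have zX: "z0 v \<in> X" if "v \<in> M" for v
    using data[OF that] belowD by blast
  have cutC: "\<phi> (z0 v) \<in> \<C>" if "v \<in> M" for v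
    using phi_in zX that by blast
  have avoid: "q \<notin> \<phi> (z0 v)"
    if "v \<in> M" "v' \<in> M" "v \<noteq> v'" "lev v' \<le> lev v" "x \<in> v'" "below x q" for v v' x q
    using sep[OF that(1-4) _ that(5) _ that(6), of "x0 v" "z0 v"] data[OF that(1)] phi_eqI by blast
  have cut_ne: "\<phi> (z0 v) \<noteq> \<phi> (z0 v')" if v: "v \<in> M" "v' \<in> M" "v \<noteq> v'" for v v'
  proof (cases "lev v' \<le> lev v")
    case True
    then show ?thesis
      using avoid[OF v True] data[OF v(2)] phi_self[OF zX[OF v(2)]] by metis
  next
    case False
    then show ?thesis
      using avoid[OF v(2,1)] v(3) data[OF v(1)] phi_self[OF zX[OF v(1)]] by (metis linear)
  qed
  \<comment> \<open>Otherwise \<open>v'\<close> would lie below \<open>v\<close> and its point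
    \<open>z0 v\<close>, a trivial descent from \<open>v'\<close>, would lie in the cut of
    \<open>v\<close>.\<close>
  have cut_ne_M: "\<phi> (z0 v) \<noteq> v'" if v: "v \<in> M" "v' \<in> M" for v v'
  proof
    assume eq: "\<phi> (z0 v) = v'"
    then have lev: "lev v' < lev v" "z0 v \<in> v'"
      using lev_phi[OF zX[OF v(1)]] data[OF v(1)] phi_self[OF zX[OF v(1)]] by auto
    then have "v \<noteq> v'"
      by blast
    from avoid[OF v this less_imp_le[OF lev(1)] lev(2) below_refl[OF zX[OF v(1)]]] show False
      using phi_self[OF zX[OF v(1)]] by blast
  qed
  have "\<exists>d>0. \<forall>a\<in>{(v, v') \<in> M \<times> M. v \<noteq> v'}. case a of (v, v') \<Rightarrow>
      tube (\<phi> (z0 v)) d \<inter> tube (\<phi> (z0 v')) d = {}"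
  proof (rule finite_uniform_pos)
    show "finite {(v, v') \<in> M \<times> M. v \<noteq> v'}"
      using finM by (auto intro: finite_subset[of _ "M \<times> M"])
    show "\<exists>d>0. case a of (v, v') \<Rightarrow> tube (\<phi> (z0 v)) d \<inter> tube (\<phi> (z0 v')) d = {}"
      if "a \<in> {(v, v') \<in> M \<times> M. v \<noteq> v'}" for a
    proof -
      obtain v v' where "a = (v, v')" "v \<in> M" "v' \<in> M" "v \<noteq> v'"
        using \<open>a \<in> {(v, v') \<in> M \<times> M. v \<noteq> v'}\<close> by blast
      then show ?thesis
        using tubes_disjoint[OF cutC cutC cut_ne, of v v'] by simp
    qed
  qed (use tube_mono in blast)
  then obtain d1 where d1: "0 < d1" "\<And>v v'. \<lbrakk>v \<in> M; v' \<in> M; v \<noteq> v'\<rbrakk> \<Longrightarrow>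
      tube (\<phi> (z0 v)) d1 \<inter> tube (\<phi> (z0 v')) d1 = {}"
    by fast
  have "\<exists>d>0. \<forall>a\<in>M \<times> M. case a of (v, v') \<Rightarrow> tube (\<phi> (z0 v)) d \<inter> tube v' d = {}"
  proof (rule finite_uniform_pos)
    show "\<exists>d>0. case a of (v, v') \<Rightarrow> tube (\<phi> (z0 v)) d \<inter> tube v' d = {}" if "a \<in> M \<times> M" for a
      using that tubes_disjoint[OF cutC MC cut_ne_M] by auto
  qed (use finM tube_mono in \<open>simp, blast\<close>)
  then obtain d2 where d2: "0 < d2" "\<And>v v'. \<lbrakk>v \<in> M; v' \<in> M\<rbrakk> \<Longrightarrow> tube (\<phi> (z0 v)) d2 \<inter> tube v' d2 = {}"
    by fast
  have "\<exists>d>0. \<forall>v\<in>M. \<forall>q\<in>tube (\<phi> (z0 v)) d. f q = lev (\<phi> (z0 v)) \<longrightarrow> q \<in> \<phi> (z0 v)"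
  proof (rule finite_uniform_pos[OF finM])
    show "\<exists>d>0. \<forall>q\<in>tube (\<phi> (z0 v)) d. f q = lev (\<phi> (z0 v)) \<longrightarrow> q \<in> \<phi> (z0 v)" if "v \<in> M" for v
      by (rule tube_isolated[OF cutC[OF that]])
  qed (use tube_mono in blast)
  then obtain d3 where d3: "0 < d3"
    "\<And>v q. \<lbrakk>v \<in> M; q \<in> tube (\<phi> (z0 v)) d3; f q = lev (\<phi> (z0 v))\<rbrakk> \<Longrightarrow> q \<in> \<phi> (z0 v)"
    by blast
  \<comment> \<open>\<open>d3\<close> is halved because cuts have to be isolated in tubes of twice
    the radius.\<close>
  define d where "d = min d1 (min d2 (d3 / 2))"
  have d: "0 < d" "tube C d \<subseteq> tube C d1" "tube C d \<subseteq> tube C d2" "tube C (2 * d) \<subseteq> tube C d3" for C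
    using d1(1) d2(1) d3(1) by (auto simp: d_def intro!: tube_mono)
  obtain idx where idx: "bij_betw idx M {..<merging_count}"
    using ex_bij_betw_finite_nat[OF finM] unfolding merging_count_def M_def atLeast0LessThan by blast
  interpret cut_system X p M idx merging_count x0 y0 z0 w0 d
  proof
    show "f (w0 v) = f (z0 v)" "f (z0 v) < lev v" if "v \<in> M" for v
      using data[OF that] by simp_all
    show "w0 v \<notin> \<phi> (z0 v)" if "v \<in> M" for v
      using data[OF that] phi_eqI by blast
    show "tube (\<phi> (z0 v)) d \<inter> tube (\<phi> (z0 v')) d = {}" if "v \<in> M" "v' \<in> M" "v \<noteq> v'" for v v'
      using d1(2)[OF that] d(2) by blast
    show "tube (\<phi> (z0 v)) d \<inter> tube v' d = {}" if "v \<in> M" "v' \<in> M" for v v'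
      using d2(2)[OF that] d(3) by blast
    show "q \<in> \<phi> (z0 v)" if "v \<in> M" "q \<in> tube (\<phi> (z0 v)) (2 * d)" "f q = f (z0 v)" for v q
      using d3(2)[OF that(1)] that d(4) lev_phi[OF zX] by auto
  qed (use finM idx MC data d(1) avoid in auto)
  have "{..<merging_count} \<in> {S :: nat set. epi (fundamental_group X p) (free_group S) \<noteq> {}}"
    using epi_onto_free_group by simp
  from SUP_upper[OF this, of "\<lambda>S. if finite S then enat (card S) else \<infinity>"] show ?thesis
    by (simp add: corank_def)
qed

end

theorem theorem5p2:
  fixes X :: "'a::metric_space set" and p :: 'a and f :: "'a \<Rightarrow> real"
  assumes "compact X" and "geodesic_space X" and "p \<in> X"
    and "f = dist p"
    and "finite_topological_graph (reeb_graph X f)"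
  shows "distortion X (\<lambda>x y. ereal (dist x y)) (reeb_dist X f) (reeb_map X f)
           \<le> 2 * (ereal_of_enat (corank (fundamental_group X p)) + 1) * contour_diameter X f \<and>
         gh_dist X (\<lambda>x y. ereal (dist x y)) (topspace (reeb_graph X f)) (reeb_dist X f)
           \<le> (ereal_of_enat (corank (fundamental_group X p)) + 1) * contour_diameter X f"
proof -
  interpret finite_geodesic_reeb X p
    by unfold_locales (use assms in simp_all)
  define N where "N = ereal_of_enat (corank (fundamental_group X p)) + 1"
  have "ereal_of_enat (enat merging_count) \<le> ereal_of_enat (corank (fundamental_group X p))"
    unfolding ereal_of_enat_le_iff by (rule merging_count_le_corank)
  then have "ereal (real merging_count) + 1 \<le> N"
    unfolding N_def by (intro add_right_mono) simp
  then have N: "ereal (real (merging_count + 1)) \<le> N"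
    by (simp add: one_ereal_def add.commute)
  \<comment> \<open>For infinite co-rank this relies on extended arithmetic: if \<open>diam\<close>
    is zero, the right side is zero, but so is the left.\<close>
  have gh: "ereal (real (merging_count + 1) * diam) \<le> N * ereal diam"
    using ereal_mult_right_mono[OF N, of "ereal diam"] diam_nonneg by simp
  \<comment> \<open>The odd number of diameters is rounded up to the even number 2 (m + 1) of the
    claim.\<close>
  have "real (2 * merging_count + 1) * diam \<le> 2 * (real (merging_count + 1) * diam)"
    using diam_nonneg by (simp add: algebra_simps)
  then have "ereal (real (2 * merging_count + 1) * diam) \<le> 2 * ereal (real (merging_count + 1) * diam)"
    by (metis ereal_less_eq(3) numeral_eq_ereal times_ereal.simps(1))
  also have "\<dots> \<le> 2 * (N * ereal diam)"
    using gh by (intro ereal_mult_left_mono) auto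
  finally have dis: "ereal (real (2 * merging_count + 1) * diam) \<le> 2 * N * ereal diam"
    by (simp add: mult.assoc)
  show ?thesis
    unfolding assms(4) contour_diameter_eq N_def[symmetric] topspace_R
    using order_trans[OF distortion_le dis] order_trans[OF gh_dist_le gh] by blast
qed

end
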